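(* Let $U_2=\phi\big(\mathrm{Sq}\setminus\{1+i,-1+i,-1-i,1-i\}\big)$ and $A(x+iy)=x+iKy$ for $x,y\in\mathbb{R}$. For all $z\in U_2$ we have $$\phi^{-1}(z)=A\left(\int_0^z\left(\frac{(u-z_2)(u-z_4)}{(u-z_1)(u-z_3)}\right)^{\frac{\log K}{2i\pi}}du\right),$$ where the path of integration between $0$ and $z$ is contained in $U_2$ (or just homotopic within $\mathbb{S}\setminus\{z_1,z_2,z_3,z_4\}$ to a path contained in $U_2$ with the same endpoints), for the branch of the expression $\left(\frac{(u-z_2)(u-z_4)}{(u-z_1)(u-z_3)}\right)^{\frac{\log K}{2i\pi}}$ defined continuously along the path and taking at $u=0$ the value $\exp(-2\theta_1\log(K)/\pi)$, where $\theta_1$ is the unique argument of $z_1$ that belongs to $(0,\pi/2)$.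
   Context: Let $\mathrm{Sq}=\{x+iy : x\in[-1,1],\ y\in[-1,1]\}\subset\mathbb{C}$. For a real $K>1$, let $\mu$ be the function on $\mathbb{C}$ equal to $\frac{K-1}{K+1}$ on $\mathrm{Sq}$ and to $0$ outside $\mathrm{Sq}$ (the Beltrami form $\mu\, d\bar z/dz$, whose ellipses are vertical with axis ratio $K$ in $\mathrm{Sq}$ and circles outside). Let $\phi:\mathbb{C}\to\mathbb{C}$ be its straightening, i.e. the unique quasiconformal homeomorphism with $\partial_{\bar z}\phi=\mu\,\partial_z\phi$ almost everywhere, normalized by $\phi(z)=z+o(1)$ as $z\to\infty$. Denote the images of the corners by $$z_1=\phi(1+i),\quad z_2=\phi(-1+i),\quad z_3=\phi(-1-i),\quad z_4=\phi(1-i);$$ by symmetry $z_1=x+iy$, $z_2=-x+iy$, $z_3=-x-iy$, $z_4=x-iy$ for some $x,y>0$. $\mathbb{S}=\mathbb{C}\cup\{\infty\}$ is the Riemann sphere. For $w\neq0$, the branches of $w^{\frac{\log K}{2i\pi}}$ are the values $\exp\left(\frac{\log K}{2i\pi}\log w\right)$ for the various determinations of $\log w$. *)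

theory Defs
  imports "HOL-Complex_Analysis.Complex_Analysis"
begin

section \<open>Distributional Wirtinger derivatives\<close>

text \<open>The family \<open>D m n\<close> consists of the mixed partial derivatives of order \<open>m\<close> in the real and
  \<open>n\<close> in the imaginary direction; each of them is differentiable, hence continuous.\<close>

definition smooth_fun :: "(complex \<Rightarrow> real) \<Rightarrow> bool" where
  "smooth_fun \<eta> \<longleftrightarrow> (\<exists>D :: nat \<Rightarrow> nat \<Rightarrow> complex \<Rightarrow> real. D 0 0 = \<eta> \<and>
     (\<forall>m n z. (D m n has_derivative
        (\<lambda>h. Re h * D (Suc m) n z + Im h * D m (Suc n) z)) (at z)))"

definition test_fun :: "(complex \<Rightarrow> real) \<Rightarrow> bool" where
  "test_fun \<eta> \<longleftrightarrow> smooth_fun \<eta> \<and> compact (closure {z. \<eta> z \<noteq> 0})"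

definition L2_loc :: "(complex \<Rightarrow> complex) \<Rightarrow> bool" where
  "L2_loc g \<longleftrightarrow> g \<in> borel_measurable lborel \<and>
     (\<forall>S. compact S \<longrightarrow> set_integrable lborel S (\<lambda>z. (norm (g z))\<^sup>2))"

text \<open>\<open>g\<close> is the distributional derivative of \<open>f\<close> in the direction \<open>e\<close>.\<close>

definition weak_partial ::
  "complex \<Rightarrow> (complex \<Rightarrow> complex) \<Rightarrow> (complex \<Rightarrow> complex) \<Rightarrow> bool" where
  "weak_partial e f g \<longleftrightarrow> (\<forall>\<eta>. test_fun \<eta> \<longrightarrow>
     (LINT z|lborel. frechet_derivative \<eta> (at z) e *\<^sub>R f z) = - (LINT z|lborel. \<eta> z *\<^sub>R g z))"

text \<open>\<open>f\<close> belongs to the local Sobolev space of first order with exponent 2, and \<open>p\<close>, \<open>q\<close>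
  represent its distributional derivatives with respect to \<open>z\<close> and to the conjugate of \<open>z\<close>.\<close>

definition weak_wirtinger ::
  "(complex \<Rightarrow> complex) \<Rightarrow> (complex \<Rightarrow> complex) \<Rightarrow> (complex \<Rightarrow> complex) \<Rightarrow> bool" where
  "weak_wirtinger f p q \<longleftrightarrow> L2_loc f \<and> (\<exists>fx fy. L2_loc fx \<and> L2_loc fy \<and>
     weak_partial 1 f fx \<and> weak_partial \<i> f fy \<and>
     p = (\<lambda>z. (fx z - \<i> * fy z) / 2) \<and> q = (\<lambda>z. (fx z + \<i> * fy z) / 2))"

section \<open>Quasiconformal maps and straightenings\<close>

text \<open>Analytic definition. The homeomorphism preserves orientation automatically, since the
  dilatation bound makes the Jacobian \<open>|p|\<^sup>2 - |q|\<^sup>2\<close> nonnegative almost everywhere.\<close>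

definition quasiconformal :: "(complex \<Rightarrow> complex) \<Rightarrow> bool" where
  "quasiconformal f \<longleftrightarrow> (\<exists>g. homeomorphism UNIV UNIV f g) \<and>
     (\<exists>p q k. weak_wirtinger f p q \<and> k < (1::real) \<and>
        (AE z in lborel. norm (q z) \<le> k * norm (p z)))"

definition straightening :: "(complex \<Rightarrow> complex) \<Rightarrow> (complex \<Rightarrow> complex) \<Rightarrow> bool" where
  "straightening \<mu> f \<longleftrightarrow> quasiconformal f \<and>
     (\<exists>p q. weak_wirtinger f p q \<and> (AE z in lborel. q z = \<mu> z * p z)) \<and>
     ((\<lambda>z. f z - z) \<longlongrightarrow> 0) at_infinity"

definition Sq :: "complex set" where
  "Sq = {z. Re z \<in> {-1..1} \<and> Im z \<in> {-1..1}}"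

definition Sq_beltrami :: "real \<Rightarrow> complex \<Rightarrow> complex" where
  "Sq_beltrami K z = (if z \<in> Sq then of_real ((K - 1) / (K + 1)) else 0)"

definition vstretch :: "real \<Rightarrow> complex \<Rightarrow> complex" where
  "vstretch K z = Complex (Re z) (K * Im z)"

section \<open>Paths and branches\<close>

definition riemann_sphere :: "complex option topology" where
  "riemann_sphere = Alexandroff_compactification euclidean"

text \<open>Homotopy with fixed endpoints, within the sphere punctured at \<open>P\<close>, of two paths that
  themselves run in the complex plane.\<close>

definition sphere_homotopic_paths ::
  "complex set \<Rightarrow> (real \<Rightarrow> complex) \<Rightarrow> (real \<Rightarrow> complex) \<Rightarrow> bool" where
  "sphere_homotopic_paths P \<gamma> \<delta> \<longleftrightarrow>
     homotopic_with (\<lambda>r. r 0 = Some (pathstart \<gamma>) \<and> r 1 = Some (pathfinish \<gamma>))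
       (top_of_set {0..1}) (subtopology riemann_sphere (- (Some ` P)))
       (Some \<circ> \<gamma>) (Some \<circ> \<delta>)"

definition power_branches :: "complex \<Rightarrow> complex \<Rightarrow> complex set" where
  "power_branches w a = {exp (a * l) | l. exp l = w}"

text \<open>The branch is a function of the path parameter, since a path may revisit a point with a
  different determination.\<close>

definition branch_along ::
  "(real \<Rightarrow> complex) \<Rightarrow> (complex \<Rightarrow> complex) \<Rightarrow> complex \<Rightarrow> complex \<Rightarrow> (real \<Rightarrow> complex) \<Rightarrow> bool" where
  "branch_along \<gamma> R a b B \<longleftrightarrow> continuous_on {0..1} B \<and> B 0 = b \<and>
     (\<forall>t\<in>{0..1}. B t \<in> power_branches (R (\<gamma> t)) a)"

end

theory Submission
  imports Defs
begin

text \<open>Write \<open>A\<close> for \<open>vstretch K\<close>. Inside the square the Beltrami equation says that \<open>\<phi> \<circ> A\<close> is holomorphic,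
  outside that \<open>\<phi>\<close> is. This is Weyl's lemma, \<open>holomorphic_if_weak_solution\<close>. So, away from the corners,
  \<open>\<phi>\<close> uniformizes a surface that is glued from the outer plane and the square squeezed by \<open>A\<close> inverse.
  Along the horizontal edges the two pieces fit by a translation, along the vertical edges only
  after the outer piece has been scaled by \<open>1 / K\<close>. The theorem \<open>holomorphic_on_comp_inverse\<close> says that every
  function that is conformal for these charts becomes holomorphic when composed with the inverse \<open>g\<close>
  of \<open>\<phi>\<close>. Uniqueness of \<open>\<phi>\<close>, hence its symmetry in both axes, is a first consequence.

  Continuing \<open>A\<close> inverse from the square across its open edges gives a map \<open>develop\<close> on a cross-shaped
  region, and \<open>dev = develop \<circ> g\<close> is conformal on the image \<open>\<Omega>\<close> of the cross. Outside the square \<open>dev\<close> and \<open>g\<close>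
  differ by affine maps, so \<open>dev'' / dev'\<close> and \<open>g'' / g'\<close> together form a single-valued function \<open>N\<close> off the four
  corner images. A turn around a corner multiplies the developing map, centred there, by \<open>K\<close> or \<open>1 / K\<close>; a suitable complex
  power of it is therefore a single-valued chart, and from this chart \<open>N\<close> is seen to have a simple pole
  with residue \<open>a\<close> or \<open>- a\<close>, where \<open>a = ln K / (2 \<pi> \<i>)\<close>. Since \<open>N\<close> vanishes at infinity, Liouville's theorem gives
  \<open>N = a R' / R\<close> (\<open>N_eq\<close>). So \<open>dev'\<close> is a multiple of a branch of \<open>R\<close> to the power \<open>a\<close>. On the imaginary axis
  the modulus of \<open>R\<close> is 1 and its argument can be followed from infinity, where \<open>dev'\<close> tends to 1, to the
  origin, where it is \<open>- 4 \<theta>\<close> with \<open>\<theta>\<close> the argument of \<open>z\<^sub>1\<close>; this fixes the multiple and the value at 0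
  (\<open>deriv_dev_eq_normalized_branch\<close>). For paths in \<open>\<Omega>\<close> the formula is now the fundamental theorem of calculus.

  It remains to allow homotopies on the sphere, which may pass through infinity. In the coordinate
  \<open>v = 1 / (u - z\<^sub>1)\<close> the punctured sphere is the plane without three points, and the integrand has a double pole
  at \<open>v = 0\<close>. Its residue vanishes because the four points sum to zero in pairs. Subtracting the
  differential of \<open>(u - z\<^sub>1)\<close> times the branch leaves a form that is regular at \<open>v = 0\<close>, and the multivalued form has
  a primitive along the whole homotopy (\<open>primitive_along_homotopy\<close>), because the parameter square is
  convex. Comparing this primitive on the two sides of the square gives
  \<open>integral_along_homotopic_path\<close>.\<close>

section \<open>A smooth bump function on the line\<close>

text \<open>The bump \<open>exp (- 1 / (x (1 - x)))\<close> and all its derivatives have the form of a polynomial over a power of \<open>x (1 - x)\<close>,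
  times the exponential; this family is closed under differentiation.\<close>

definition bump_term :: "real poly \<Rightarrow> nat \<Rightarrow> real \<Rightarrow> real" where
  "bump_term r n x =
     (if 0 < x \<and> x < 1 then poly r x / (x * (1 - x)) ^ n * exp (- (1 / (x * (1 - x)))) else 0)"

definition bump_deriv_poly :: "real poly \<Rightarrow> nat \<Rightarrow> real poly" where
  "bump_deriv_poly r n =
     pderiv r * [:0, 1, -1:]\<^sup>2 - smult (real n) (r * [:1, -2:] * [:0, 1, -1:]) + r * [:1, -2:]"

text \<open>The term of index \<open>n + 2\<close> of the exponential series bounds \<open>exp (1 / s)\<close> from below. The two spare powers
  of \<open>s\<close> make all derivatives of the bump vanish to second order at the ends of the interval.\<close>

lemma exp_neg_inverse_power_bound:
  fixes s :: real assumes "0 < s"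
  shows "exp (- (1 / s)) / s ^ n \<le> fact (n + 2) * s\<^sup>2"
proof -
  have sm: "summable (\<lambda>k. (1 / s) ^ k / fact k)"
    using summable_exp_generic[of "1/s"] by (simp add: scaleR_conv_of_real field_simps)
  have "(\<Sum>k\<in>{n+2}. (1 / s) ^ k / fact k) \<le> (\<Sum>k. (1 / s) ^ k / fact k)"
    by (rule sum_le_suminf[OF sm]) (use assms in auto)
  then have "(1 / s) ^ (n + 2) / fact (n + 2) \<le> exp (1 / s)"
    by (simp add: exp_def scaleR_conv_of_real field_simps)
  then have "inverse (exp (1 / s)) \<le> inverse ((1 / s) ^ (n + 2) / fact (n + 2))"
    by (rule le_imp_inverse_le) (use assms in simp)
  then have "exp (- (1 / s)) \<le> fact (n + 2) * s ^ (n + 2)"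
    by (simp add: exp_minus power_one_over inverse_eq_divide mult_ac)
  then show ?thesis
    using assms by (simp add: field_simps power_add power2_eq_square)
qed

lemma bump_term_bound:
  obtains M where "\<And>x. \<bar>bump_term r n x\<bar> \<le> M * x\<^sup>2" "\<And>x. \<bar>bump_term r n x\<bar> \<le> M * (x - 1)\<^sup>2"
proof -
  have "compact (poly r ` {0..1})"
    by (intro compact_continuous_image continuous_intros) auto
  then have "bounded (poly r ` {0..1})"
    by (rule compact_imp_bounded)
  then obtain C where C: "\<And>x. x \<in> {0..1} \<Longrightarrow> \<bar>poly r x\<bar> \<le> C"
    unfolding bounded_iff by (metis imageI real_norm_def)
  have C0: "0 \<le> C" using C[of 0] by auto
  define M where "M = C * fact (n + 2)"
  have main: "\<bar>bump_term r n x\<bar> \<le> M * (x * (1 - x))\<^sup>2" if "0 < x" "x < 1" for x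
  proof -
    have s: "0 < x * (1 - x)" using that by simp
    have "\<bar>bump_term r n x\<bar> = \<bar>poly r x\<bar> * (exp (- (1 / (x * (1 - x)))) / (x * (1 - x)) ^ n)"
      using that s by (simp add: bump_term_def abs_mult)
    also have "\<dots> \<le> C * (fact (n + 2) * (x * (1 - x))\<^sup>2)"
      using C[of x] that s C0 exp_neg_inverse_power_bound[OF s, of n]
      by (intro mult_mono) auto
    finally show ?thesis by (simp add: M_def mult.assoc)
  qed
  have M0: "0 \<le> M" using C0 by (simp add: M_def)
  have "\<bar>bump_term r n x\<bar> \<le> M * x\<^sup>2" for x
  proof (cases "0 < x \<and> x < 1")
    case True
    have "(x * (1 - x))\<^sup>2 \<le> x\<^sup>2" using True by (intro power_mono) (auto simp: mult_le_cancel_left1)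
    then have "M * (x * (1 - x))\<^sup>2 \<le> M * x\<^sup>2" by (rule mult_left_mono[OF _ M0])
    then show ?thesis using main[of x] True by linarith
  qed (use M0 in \<open>auto simp: bump_term_def\<close>)
  moreover have "\<bar>bump_term r n x\<bar> \<le> M * (x - 1)\<^sup>2" for x
  proof (cases "0 < x \<and> x < 1")
    case True
    have "(x * (1 - x))\<^sup>2 \<le> (1 - x)\<^sup>2" using True by (intro power_mono) (auto simp: mult_le_cancel_right1)
    then have "M * (x * (1 - x))\<^sup>2 \<le> M * (x - 1)\<^sup>2" 
      unfolding power2_commute[of x 1] by (rule mult_left_mono[OF _ M0])
    then show ?thesis using main[of x] True by linarith
  qed (use M0 in \<open>auto simp: bump_term_def\<close>)
  ultimately show ?thesis by (rule that)
qed

lemma DERIV_zero_if_quadratic_bound: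
  fixes f :: "real \<Rightarrow> real"
  assumes "\<And>y. \<bar>f y\<bar> \<le> M * (y - x)\<^sup>2"
  shows "(f has_real_derivative 0) (at x)"
proof -
  have f0: "f x = 0" using assms[of x] by simp
  have "((\<lambda>h. (f (x + h) - f x) / h) \<longlongrightarrow> 0) (at 0)"
  proof (rule Lim_null_comparison)
    show "\<forall>\<^sub>F h in at 0. norm ((f (x + h) - f x) / h) \<le> M * \<bar>h\<bar>"
    proof (rule always_eventually, rule)
      fix h show "norm ((f (x + h) - f x) / h) \<le> M * \<bar>h\<bar>"
        using assms[of "x + h"] f0
        by (cases "h = 0") (auto simp: divide_simps power2_eq_square mult.assoc abs_mult)
    qed
    show "((\<lambda>h. M * \<bar>h\<bar>) \<longlongrightarrow> 0) (at 0)"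
      by (intro tendsto_eq_intros) auto
  qed
  then show ?thesis by (simp add: DERIV_def)
qed

lemma DERIV_bump_term:
  "(bump_term r n has_real_derivative bump_term (bump_deriv_poly r n) (n + 2) x) (at x)"
proof -
  consider "0 < x \<and> x < 1" | "x < 0" | "x > 1" | "x = 0" | "x = 1" by linarith
  then show ?thesis
  proof cases
    case 1
    then have s: "x * (1 - x) \<noteq> 0" by auto
    define U where "U = (\<lambda>x :: real. 1 / (x * (1 - x)))"
    define u where "u = U x"
    have DU: "(U has_real_derivative - ((1 - 2 * x) * u\<^sup>2)) (at x)"
    proof -
      have "((\<lambda>x. x * (1 - x)) has_real_derivative 1 - 2 * x) (at x)"
        by (auto intro!: derivative_eq_intros)
      from DERIV_inverse_fun[OF this s]
      have "((\<lambda>x. inverse (x * (1 - x))) has_real_derivative - ((1 - 2 * x) * u\<^sup>2)) (at x)"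
        by (rule DERIV_cong) (simp add: u_def U_def power2_eq_square inverse_eq_divide)
      then show ?thesis by (simp only: U_def inverse_eq_divide)
    qed
    have "((\<lambda>x. poly r x * U x ^ n * exp (- U x)) has_real_derivative
       (poly (pderiv r) x * u ^ n + poly r x * (real n * u ^ (n - 1) * (- ((1 - 2 * x) * u\<^sup>2)))) * exp (- u)
       + poly r x * u ^ n * (exp (- u) * ((1 - 2 * x) * u\<^sup>2))) (at x)"
      by (rule DERIV_cong[OF DERIV_mult[OF DERIV_mult[OF poly_DERIV[of r x] DERIV_power[OF DU, of n]]
          DERIV_chain2[OF DERIV_exp DERIV_minus[OF DU]]]])
        (simp add: u_def[symmetric] algebra_simps)
    moreover have "(poly (pderiv r) x * u ^ n + poly r x * (real n * u ^ (n - 1) * (- ((1 - 2 * x) * u\<^sup>2)))) * exp (- u)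
       + poly r x * u ^ n * (exp (- u) * ((1 - 2 * x) * u\<^sup>2)) = bump_term (bump_deriv_poly r n) (n + 2) x"
    proof -
      have su: "x * (1 - x) = 1 / u" "u \<noteq> 0" using s by (auto simp: u_def U_def)
      have e1: "poly r x * (real n * u ^ (n - 1) * (- ((1 - 2 * x) * u\<^sup>2)))
        = - (poly r x * (1 - 2 * x) * u * (real n * u ^ n))"
        by (cases n) (auto simp: power2_eq_square)
      have e2: "bump_term (bump_deriv_poly r n) (n + 2) x =
          poly (bump_deriv_poly r n) x * u ^ (n + 2) * exp (- u)"
        using 1 by (simp add: bump_term_def u_def U_def power_one_over)
      have e3: "poly (bump_deriv_poly r n) x =
          poly (pderiv r) x * (x * (1 - x))\<^sup>2 - real n * (poly r x * (1 - 2 * x) * (x * (1 - x)))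
          + poly r x * (1 - 2 * x)"
        by (simp add: bump_deriv_poly_def algebra_simps)
      show ?thesis
        using su(2) unfolding distrib_right e1 e2 e3 su(1) by (simp add: power2_eq_square algebra_simps)
    qed
    ultimately have "((\<lambda>x. poly r x / (x * (1 - x)) ^ n * exp (- (1 / (x * (1 - x)))))
      has_real_derivative bump_term (bump_deriv_poly r n) (n + 2) x) (at x)"
      by (simp add: U_def power_one_over)
    then show ?thesis
      by (rule has_field_derivative_transform_within_open[where S="{0<..<1}"])
        (use 1 in \<open>auto simp: bump_term_def\<close>)
  next
    case 2
    have "((\<lambda>x. 0) has_real_derivative bump_term (bump_deriv_poly r n) (n + 2) x) (at x)"
      using 2 by (simp add: bump_term_def)
    then show ?thesis
      by (rule has_field_derivative_transform_within_open[where S="{..<0}"])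
        (use 2 in \<open>auto simp: bump_term_def\<close>)
  next
    case 3
    have "((\<lambda>x. 0) has_real_derivative bump_term (bump_deriv_poly r n) (n + 2) x) (at x)"
      using 3 by (simp add: bump_term_def)
    then show ?thesis
      by (rule has_field_derivative_transform_within_open[where S="{1<..}"])
        (use 3 in \<open>auto simp: bump_term_def\<close>)
  next
    case 4
    obtain M where "\<And>x. \<bar>bump_term r n x\<bar> \<le> M * x\<^sup>2"
      using bump_term_bound by metis
    with 4 show ?thesis
      using DERIV_zero_if_quadratic_bound[of "bump_term r n" M 0] by (simp add: bump_term_def)
  next
    case 5
    obtain M where "\<And>x. \<bar>bump_term r n x\<bar> \<le> M * (x - 1)\<^sup>2"
      using bump_term_bound by metis
    with 5 show ?thesis
      using DERIV_zero_if_quadratic_bound[of "bump_term r n" M 1] by (simp add: bump_term_def)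
  qed
qed

text \<open>The members of the sequence are the successive derivatives of one nonnegative bump, as the definition of
  smoothness for test functions asks for derivatives of every order.\<close>

lemma bump_sequence_exists:
  fixes \<epsilon> :: real assumes "0 < \<epsilon>"
  obtains D :: "nat \<Rightarrow> real \<Rightarrow> real" where
    "\<And>n x. (D n has_real_derivative D (Suc n) x) (at x)"
    "\<And>n x. D n x \<noteq> 0 \<Longrightarrow> 0 < x \<and> x < \<epsilon>" "\<And>x. 0 \<le> D 0 x" "0 < D 0 (\<epsilon> / 2)"
proof -
  define q where "q = rec_nat (1 :: real poly, 0 :: nat) (\<lambda>_ (r, n). (bump_deriv_poly r n, n + 2))"
  define D where "D = (\<lambda>k x. bump_term (fst (q k)) (snd (q k)) (x / \<epsilon>) / \<epsilon> ^ k)"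
  have q: "q (Suc k) = (bump_deriv_poly (fst (q k)) (snd (q k)), snd (q k) + 2)" for k
    by (simp add: q_def case_prod_unfold)
  have "(D k has_real_derivative D (Suc k) x) (at x)" for k x
  proof -
    have "((\<lambda>x. x / \<epsilon>) has_real_derivative 1 / \<epsilon>) (at x)"
      using assms by (auto intro!: derivative_eq_intros)
    from DERIV_chain2[OF DERIV_bump_term this, THEN DERIV_cdivide, of _ _ "\<epsilon> ^ k"]
    show ?thesis unfolding D_def q by (simp add: field_simps)
  qed
  moreover have "0 < x \<and> x < \<epsilon>" if "D k x \<noteq> 0" for k x
    using that assms by (auto simp: D_def bump_term_def field_simps split: if_splits)
  moreover have "0 \<le> D 0 x" "0 < D 0 (\<epsilon> / 2)" for x
    using assms by (auto simp: D_def q_def bump_term_def)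
  ultimately show ?thesis by (rule that)
qed

section \<open>Weyl's lemma for the stretched Cauchy-Riemann equation\<close>

lemma Re_vstretch [simp]: "Re (vstretch c z) = Re z" and Im_vstretch [simp]: "Im (vstretch c z) = c * Im z"
  by (simp_all add: vstretch_def)

lemma vstretch_eq: "vstretch c z = of_real (Re z) + \<i> * of_real (c * Im z)"
  by (simp add: complex_eq_iff)

lemma continuous_on_vstretch [continuous_intros]:
  "continuous_on S f \<Longrightarrow> continuous_on S (\<lambda>z. vstretch c (f z))"
  unfolding vstretch_eq by (intro continuous_intros)

lemma open_vimage_vstretch: "open \<Omega> \<Longrightarrow> open (vstretch c -` \<Omega>)"
  by (rule open_vimage) (auto intro: continuous_intros)

text \<open>Makes the total mass of the mollifying kernel independent of the point at which it is centred.\<close>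

lemma lborel_integral_reflect:
  fixes h :: "complex \<Rightarrow> real"
  assumes "continuous_on UNIV h"
  shows "(LINT z|lborel. h (w - z)) = (LINT z|lborel. h z)"
proof -
  have [measurable]: "h \<in> borel_measurable borel"
    by (rule borel_measurable_continuous_onI[OF assms])
  have "(lborel :: complex measure) = distr lborel borel (\<lambda>x. w + (-1) *\<^sub>R x)"
    by (subst lborel_affine[of "-1" w]) (simp_all add: density_1)
  then have "(LINT z|lborel. h z) = (LINT z|distr lborel borel (\<lambda>x. w + (-1) *\<^sub>R x). h z)"
    by metis
  also have "\<dots> = (LINT z|lborel. h (w - z))"
    by (subst integral_distr) auto
  finally show ?thesis by simp
qed

lemma lborel_integral_eq_cbox:
  fixes F :: "complex \<Rightarrow> 'b :: euclidean_space"
  assumes "continuous_on UNIV F" "\<And>z. F z \<noteq> 0 \<Longrightarrow> z \<in> cbox a b"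
  shows "(LINT z|lborel. F z) = integral (cbox a b) F"
proof -
  have "set_integrable lborel (cbox a b) F"
    unfolding set_integrable_def
    by (rule borel_integrable_compact) (auto intro: continuous_on_subset[OF assms(1)])
  from set_borel_integral_eq_integral(2)[OF this]
  have "(LINT z|lborel. indicator (cbox a b) z *\<^sub>R F z) = integral (cbox a b) F"
    by (simp add: set_lebesgue_integral_def)
  moreover have "(\<lambda>z. indicator (cbox a b) z *\<^sub>R F z) = F"
    using assms(2) by (fastforce simp: indicator_def)
  ultimately show ?thesis by simp
qed

lemma has_derivative_separated_product:
  assumes "\<And>x. (A has_real_derivative A' x) (at x)" "\<And>x. (B has_real_derivative B' x) (at x)"
  shows "((\<lambda>z. A (Re z) * B (Im z)) has_derivative
     (\<lambda>d. Re d * (A' (Re z) * B (Im z)) + Im d * (A (Re z) * B' (Im z)))) (at z)"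
proof -
  have "((\<lambda>z. A (Re z)) has_derivative (\<lambda>d. A' (Re z) * Re d)) (at z)"
    by (rule has_derivative_compose[OF has_derivative_Re[OF has_derivative_ident],
          where g=A and g'="(*) (A' (Re z))"])
      (use assms(1) in \<open>simp add: has_field_derivative_def\<close>)
  moreover have "((\<lambda>z. B (Im z)) has_derivative (\<lambda>d. B' (Im z) * Im d)) (at z)"
    by (rule has_derivative_compose[OF has_derivative_Im[OF has_derivative_ident],
          where g=B and g'="(*) (B' (Im z))"])
      (use assms(2) in \<open>simp add: has_field_derivative_def\<close>)
  ultimately have "((\<lambda>z. A (Re z) * B (Im z)) has_derivative
      (\<lambda>d. A (Re z) * (B' (Im z) * Im d) + (A' (Re z) * Re d) * B (Im z))) (at z)"
    by (rule has_derivative_mult)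
  then show ?thesis by (simp add: algebra_simps)
qed

text \<open>The kernel \<open>\<eta>\<close> of the mollification at \<open>w\<close> is itself an admissible test function. Moving the
  point \<open>w\<close> and moving the variable \<open>z\<close> differentiate it with opposite signs, which turns the weak
  equation into an equation for the mollified function.\<close>

lemma test_fun_reflected_bump:
  fixes D :: "nat \<Rightarrow> real \<Rightarrow> real" and w :: complex
  assumes D: "\<And>n x. (D n has_real_derivative D (Suc n) x) (at x)"
    and supp: "\<And>n x. D n x \<noteq> 0 \<Longrightarrow> 0 < x \<and> x < \<epsilon>"
  defines "\<eta> \<equiv> \<lambda>z. D 0 (Re (w - z)) * D 0 (Im (w - z))"
  shows "test_fun \<eta>"
    and "frechet_derivative \<eta> (at z) d =
      - (Re d * (D 1 (Re (w - z)) * D 0 (Im (w - z))) + Im d * (D 0 (Re (w - z)) * D 1 (Im (w - z))))"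
proof -
  define E where "E = (\<lambda>m n z. (-1) ^ (m + n) * (D m (Re (w - z)) * D n (Im (w - z))))"
  have E: "(E m n has_derivative (\<lambda>h. Re h * E (Suc m) n z + Im h * E m (Suc n) z)) (at z)" for m n z
  proof -
    have "((\<lambda>z. w - z) has_derivative uminus) (at z)"
      by (auto intro!: derivative_eq_intros)
    from has_derivative_compose[OF this has_derivative_separated_product[OF D[of m] D[of n]]]
    have "((\<lambda>z. D m (Re (w - z)) * D n (Im (w - z))) has_derivative (\<lambda>h. Re (- h) *
        (D (Suc m) (Re (w - z)) * D n (Im (w - z))) + Im (- h) * (D m (Re (w - z)) * D (Suc n) (Im (w - z))))) (at z)" .
    from has_derivative_mult_right[OF this, of "(-1) ^ (m + n)"] show ?thesis
      unfolding E_def by (rule has_derivative_eq_rhs) (auto simp: fun_eq_iff algebra_simps)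
  qed
  have E0: "E 0 0 = \<eta>" by (simp add: E_def \<eta>_def)
  have "smooth_fun \<eta>"
    unfolding smooth_fun_def using E E0 by blast
  moreover have "closure {z. \<eta> z \<noteq> 0} \<subseteq> cball w (2 * \<epsilon>)"
  proof (rule closure_minimal)
    show "{z. \<eta> z \<noteq> 0} \<subseteq> cball w (2 * \<epsilon>)"
    proof
      fix z assume "z \<in> {z. \<eta> z \<noteq> 0}"
      then have "D 0 (Re (w - z)) \<noteq> 0" "D 0 (Im (w - z)) \<noteq> 0" by (auto simp: \<eta>_def)
      then have "\<bar>Re (w - z)\<bar> \<le> \<epsilon>" "\<bar>Im (w - z)\<bar> \<le> \<epsilon>"
        using supp by fastforce+
      then show "z \<in> cball w (2 * \<epsilon>)"
        using cmod_le[of "w - z"] by (simp add: dist_norm)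
    qed
  qed auto
  then have "compact (closure {z. \<eta> z \<noteq> 0})"
    by (meson bounded_cball bounded_subset closed_closure compact_eq_bounded_closed)
  ultimately show "test_fun \<eta>" by (simp add: test_fun_def)
  have "frechet_derivative \<eta> (at z) = (\<lambda>h. Re h * E 1 0 z + Im h * E 0 1 z)"
    using frechet_derivative_at[OF E[of 0 0 z]] unfolding E0 by simp
  then show "frechet_derivative \<eta> (at z) d =
      - (Re d * (D 1 (Re (w - z)) * D 0 (Im (w - z))) + Im d * (D 0 (Re (w - z)) * D 1 (Im (w - z))))"
    by (simp add: E_def)
qed

lemma has_derivative_mollified:
  fixes h hx hy :: "complex \<Rightarrow> real" and f :: "complex \<Rightarrow> complex"
  assumes h: "\<And>z. (h has_derivative (\<lambda>d. Re d * hx z + Im d * hy z)) (at z)"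
    and hx: "continuous_on UNIV hx" and hy: "continuous_on UNIV hy" and f: "continuous_on UNIV f"
  shows "((\<lambda>u. integral (cbox a b) (\<lambda>z. h (u - z) *\<^sub>R f z)) has_derivative
    (\<lambda>d. Re d *\<^sub>R integral (cbox a b) (\<lambda>z. hx (u - z) *\<^sub>R f z)
       + Im d *\<^sub>R integral (cbox a b) (\<lambda>z. hy (u - z) *\<^sub>R f z))) (at u)"
proof -
  have ch: "continuous_on UNIV h"
    using h by (meson has_derivative_continuous continuous_at_imp_continuous_on)
  have conts: "continuous_on S (\<lambda>x. h (F x))" "continuous_on S (\<lambda>x. hx (F x))" "continuous_on S (\<lambda>x. hy (F x))"
     "continuous_on S (\<lambda>x. f (F x))"
    if "continuous_on S F" for S and F :: "'z :: topological_space \<Rightarrow> complex"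
    using continuous_on_compose2[OF ch that] continuous_on_compose2[OF hx that]
      continuous_on_compose2[OF hy that] continuous_on_compose2[OF f that] by auto
  define R where "R = Blinfun Re"
  define I where "I = Blinfun Im"
  have R: "blinfun_apply R = Re" and I: "blinfun_apply I = Im"
    by (simp_all add: R_def I_def bounded_linear_Blinfun_apply bounded_linear_Re bounded_linear_Im)
  define L where "L = (\<lambda>u z. (blinfun_scaleR_left (hx (u - z) *\<^sub>R f z) o\<^sub>L R)
                        + (blinfun_scaleR_left (hy (u - z) *\<^sub>R f z) o\<^sub>L I))"
  have L: "blinfun_apply (L u z) d = (Re d * hx (u - z) + Im d * hy (u - z)) *\<^sub>R f z" for u z d
    by (simp add: L_def R I blinfun.bilinear_simps algebra_simps)
  have deriv: "((\<lambda>u. integral (cbox a b) (\<lambda>z. h (u - z) *\<^sub>R f z)) has_derivative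
      blinfun_apply (integral (cbox a b) (L u))) (at u within UNIV)"
  proof (rule leibniz_rule)
    fix u z :: complex
    have "((\<lambda>u. u - z) has_derivative (\<lambda>d. d)) (at u)"
      by (auto intro!: derivative_eq_intros)
    from has_derivative_compose[OF this h]
    have "((\<lambda>u. h (u - z)) has_derivative (\<lambda>d. Re d * hx (u - z) + Im d * hy (u - z))) (at u)" .
    from has_derivative_scaleR_left[OF this, of "f z"]
    show "((\<lambda>u. h (u - z) *\<^sub>R f z) has_derivative blinfun_apply (L u z)) (at u within UNIV)"
      by (rule has_derivative_eq_rhs) (auto simp: L)
  next
    show "(\<lambda>z. h (u - z) *\<^sub>R f z) integrable_on cbox a b" for u
      by (intro integrable_continuous continuous_intros conts)
  next
    show "continuous_on (UNIV \<times> cbox a b) (\<lambda>(u, z). L u z)"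
      unfolding L_def case_prod_unfold by (intro continuous_intros conts)
  qed auto
  have *: "blinfun_apply (integral (cbox a b) (L u)) d =
       Re d *\<^sub>R integral (cbox a b) (\<lambda>z. hx (u - z) *\<^sub>R f z)
       + Im d *\<^sub>R integral (cbox a b) (\<lambda>z. hy (u - z) *\<^sub>R f z)" for d
  proof -
    have "L u integrable_on cbox a b"
      unfolding L_def by (intro integrable_continuous continuous_intros conts)
    then have "blinfun_apply (integral (cbox a b) (L u)) d = integral (cbox a b) (\<lambda>z. L u z d)"
      by (rule blinfun_apply_integral)
    also have "\<dots> = integral (cbox a b) (\<lambda>z. Re d *\<^sub>R (hx (u - z) *\<^sub>R f z) + Im d *\<^sub>R (hy (u - z) *\<^sub>R f z))"
      by (simp add: L scaleR_left_distrib)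
    also have "\<dots> = integral (cbox a b) (\<lambda>z. Re d *\<^sub>R (hx (u - z) *\<^sub>R f z))
        + integral (cbox a b) (\<lambda>z. Im d *\<^sub>R (hy (u - z) *\<^sub>R f z))"
      by (intro integral_add integrable_continuous continuous_intros conts)
    finally show ?thesis unfolding integral_cmul .
  qed
  show ?thesis
    by (rule has_derivative_eq_rhs[OF deriv]) (rule ext, rule *)
qed

text \<open>Mollify \<open>f\<close> and divide by the mass of the kernel. The mollified function is differentiable, and testing the weak
  equation against the kernel gives its stretched Cauchy-Riemann equation, so it is holomorphic after composition
  with \<open>vstretch c\<close>. It stays within the oscillation of \<open>f\<close> on the scale of the kernel.\<close>

lemma weak_solution_holomorphic_approximation:
  fixes f :: "complex \<Rightarrow> complex" and c \<epsilon> e \<rho> :: real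
  assumes cf: "continuous_on UNIV f" and eps: "0 < \<epsilon>" "2 * \<epsilon> \<le> \<rho>" "\<rho> \<le> 1" and e: "0 < e"
    and weak: "\<And>\<eta>. test_fun \<eta> \<Longrightarrow> (\<And>z. \<eta> z \<noteq> 0 \<Longrightarrow> z \<in> \<Omega>) \<Longrightarrow>
      (LINT z|lborel. frechet_derivative \<eta> (at z) 1 *\<^sub>R f z)
      + \<i> * of_real c * (LINT z|lborel. frechet_derivative \<eta> (at z) \<i> *\<^sub>R f z) = 0"
    and ball: "ball w0 (2 * \<rho>) \<subseteq> \<Omega>"
    and osc: "\<And>u z. u \<in> ball w0 \<rho> \<Longrightarrow> dist z u < 2 * \<epsilon> \<Longrightarrow> dist (f z) (f u) \<le> e"
  obtains G where "G holomorphic_on (vstretch c -` ball w0 \<rho>)"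
    "\<And>v. vstretch c v \<in> ball w0 \<rho> \<Longrightarrow> dist (G v) (f (vstretch c v)) \<le> e"
proof -
  obtain D :: "nat \<Rightarrow> real \<Rightarrow> real" where
    D: "\<And>n x. (D n has_real_derivative D (Suc n) x) (at x)"
    and supp: "\<And>n x. D n x \<noteq> 0 \<Longrightarrow> 0 < x \<and> x < \<epsilon>"
    and D0: "\<And>x. 0 \<le> D 0 x" and Dpos: "0 < D 0 (\<epsilon> / 2)"
    using bump_sequence_exists[OF eps(1)] by metis
  have contD: "continuous_on S (\<lambda>z. D n (F z))" if "continuous_on S F" for n S and F :: "complex \<Rightarrow> real"
    using D[THEN DERIV_isCont] that
    by (metis continuous_at_imp_continuous_on continuous_on_compose2 subset_UNIV)
  define h where "h = (\<lambda>z. D 0 (Re z) * D 0 (Im z))"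
  define hx where "hx = (\<lambda>z. D 1 (Re z) * D 0 (Im z))"
  define hy where "hy = (\<lambda>z. D 0 (Re z) * D 1 (Im z))"
  have dh: "(h has_derivative (\<lambda>d. Re d * hx z + Im d * hy z)) (at z)" for z
    using has_derivative_separated_product[OF D[of 0] D[of 0], of z]
    by (simp add: h_def hx_def hy_def)
  have conts: "continuous_on UNIV h" "continuous_on UNIV hx" "continuous_on UNIV hy"
    unfolding h_def hx_def hy_def by (intro continuous_intros contD)+
  have refl: "continuous_on S (\<lambda>z. k (u - z))" if "continuous_on UNIV k" for S u and k :: "complex \<Rightarrow> real"
    by (rule continuous_on_compose2[OF that]) (auto intro!: continuous_intros)
  \<comment> \<open>a box that contains the support of every kernel centred in the ball\<close>
  define a b where "a = w0 - Complex 3 3" and "b = w0 + Complex 3 3"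
  have near: "dist z u < 2 * \<epsilon>" if "k (u - z) \<noteq> 0" "k \<in> {h, hx, hy}" for k u z
  proof -
    have "0 < Re (u - z) \<and> Re (u - z) < \<epsilon>" "0 < Im (u - z) \<and> Im (u - z) < \<epsilon>"
      using that supp[of 0 "Re (u - z)"] supp[of 1 "Re (u - z)"] supp[of 0 "Im (u - z)"] supp[of 1 "Im (u - z)"]
      by (auto simp: h_def hx_def hy_def simp del: minus_complex.sel)
    then show ?thesis using cmod_le[of "u - z"] by (simp add: dist_norm norm_minus_commute)
  qed
  have inbox: "z \<in> cbox a b" if "k (u - z) \<noteq> 0" "k \<in> {h, hx, hy}" "u \<in> ball w0 \<rho>" for k u z
  proof -
    have "dist z w0 < 3"
      using near[OF that(1,2)] that(3) eps dist_triangle[of z w0 u] by (simp add: dist_commute)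
    then have "\<bar>Re (z - w0)\<bar> < 3" "\<bar>Im (z - w0)\<bar> < 3"
      using abs_Re_le_cmod[of "z - w0"] abs_Im_le_cmod[of "z - w0"] by (auto simp: dist_norm)
    then show ?thesis by (auto simp: a_def b_def in_cbox_complex_iff)
  qed
  have to_cbox: "(LINT z|lborel. k (u - z) *\<^sub>R g z) = integral (cbox a b) (\<lambda>z. k (u - z) *\<^sub>R g z)"
    if "k \<in> {h, hx, hy}" "u \<in> ball w0 \<rho>" "continuous_on UNIV g" for k u and g :: "complex \<Rightarrow> 'z :: euclidean_space"
  proof (rule lborel_integral_eq_cbox)
    have "continuous_on UNIV k" using conts that(1) by auto
    then show "continuous_on UNIV (\<lambda>z. k (u - z) *\<^sub>R g z)"
      by (rule continuous_on_scaleR[OF refl that(3)])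
  qed (use inbox that in auto)
  define m where "m = (LINT z|lborel. h z)"
  have m: "integral (cbox a b) (\<lambda>z. h (u - z)) = m" if "u \<in> ball w0 \<rho>" for u
    using to_cbox[of h u "\<lambda>_. 1 :: real"] that lborel_integral_reflect[OF conts(1), of u]
    by (simp add: m_def)
  have h_integrable: "(\<lambda>z. h (u - z) *\<^sub>R g z) integrable_on cbox a b" 
    if "continuous_on UNIV g" for u and g :: "complex \<Rightarrow> 'z :: euclidean_space"
    by (intro integrable_continuous continuous_on_scaleR refl conts(1) continuous_on_subset[OF that]) auto
  have hpos: "0 \<le> h z" for z by (simp add: h_def D0)
  have w0: "w0 \<in> ball w0 \<rho>" using eps by simp
  have "m \<noteq> 0"
  proof
    assume "m = 0"
    define z where "z = w0 - Complex (\<epsilon>/2) (\<epsilon>/2)"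
    have hz: "h (w0 - z) \<noteq> 0" using Dpos by (simp add: h_def z_def)
    have "((\<lambda>z. h (w0 - z)) has_integral 0) (cbox a b)"
      using m[OF w0] h_integrable[of "\<lambda>_. 1 :: real" w0] \<open>m = 0\<close> by (simp add: has_integral_iff)
    moreover have "continuous_on (cbox a b) (\<lambda>z. h (w0 - z))"
      by (rule refl[OF conts(1)])
    moreover have "w0 \<in> box a b" by (simp add: in_box_complex_iff a_def b_def)
    ultimately have "h (w0 - z) = 0"
      using inbox[of h w0 z] w0 hz hpos
      by (intro has_integral_0_cbox_imp_0[of a b "\<lambda>z. h (w0 - z)" z]) auto
    with hz show False by simp
  qed
  moreover have "0 \<le> m" unfolding m_def by (rule Bochner_Integration.integral_nonneg) (simp add: hpos)
  ultimately have mpos: "0 < m" by simp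
  define F where "F = (\<lambda>u. integral (cbox a b) (\<lambda>z. h (u - z) *\<^sub>R f z))"
  define P where "P = (\<lambda>u. integral (cbox a b) (\<lambda>z. hx (u - z) *\<^sub>R f z))"
  define Q where "Q = (\<lambda>u. integral (cbox a b) (\<lambda>z. hy (u - z) *\<^sub>R f z))"
  have dF: "(F has_derivative (\<lambda>d. Re d *\<^sub>R P u + Im d *\<^sub>R Q u)) (at u)" for u
    unfolding F_def P_def Q_def by (rule has_derivative_mollified[OF dh conts(2,3) cf])
  have CR: "P u + \<i> * of_real c * Q u = 0" if u: "u \<in> ball w0 \<rho>" for u
  proof -
    define \<eta> where "\<eta> = (\<lambda>z. D 0 (Re (u - z)) * D 0 (Im (u - z)))"
    note T = test_fun_reflected_bump[where D=D and \<epsilon>=\<epsilon> and w=u, OF D supp, folded \<eta>_def]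
    have "(LINT z|lborel. frechet_derivative \<eta> (at z) 1 *\<^sub>R f z)
      + \<i> * of_real c * (LINT z|lborel. frechet_derivative \<eta> (at z) \<i> *\<^sub>R f z) = 0"
    proof (rule weak[OF T(1)])
      fix z assume "\<eta> z \<noteq> 0"
      then have "dist z u < 2 * \<epsilon>" using near[of h u z] by (simp add: h_def \<eta>_def)
      then have "dist w0 z < 2 * \<rho>" using eps u dist_triangle[of w0 z u] by (simp add: dist_commute)
      then show "z \<in> \<Omega>" using ball by auto
    qed
    then have "(LINT z|lborel. - (hx (u - z) *\<^sub>R f z)) + \<i> * of_real c * (LINT z|lborel. - (hy (u - z) *\<^sub>R f z)) = 0"
      by (simp add: T(2) hx_def hy_def)
    then show ?thesis
      using to_cbox[of hx u f] to_cbox[of hy u f] u cf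
      by (simp add: P_def Q_def algebra_simps add_eq_0_iff)
  qed
  define G where "G = (\<lambda>v. F (vstretch c v) / of_real m)"
  have dG: "(G has_field_derivative P (vstretch c v) / of_real m) (at v)" if v: "vstretch c v \<in> ball w0 \<rho>" for v
  proof -
    have "(vstretch c has_derivative vstretch c) (at v)"
    proof -
      have vs: "vstretch c = (\<lambda>z. of_real (Re z) + \<i> * of_real (c * Im z))"
        by (simp add: fun_eq_iff vstretch_eq)
      show ?thesis unfolding vs by (auto intro!: derivative_eq_intros)
    qed
    from has_derivative_compose[OF this dF]
    have "((\<lambda>v. F (vstretch c v)) has_derivative
      (\<lambda>d. Re d *\<^sub>R P (vstretch c v) + (c * Im d) *\<^sub>R Q (vstretch c v))) (at v)"
      by simp
    moreover have "Re d *\<^sub>R P (vstretch c v) + (c * Im d) *\<^sub>R Q (vstretch c v) = P (vstretch c v) * d" for d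
    proof -
      have cQ: "of_real c * Q (vstretch c v) = \<i> * P (vstretch c v)"
        using CR[OF v] by (simp add: add_eq_0_iff2 mult.assoc) 
      have "Re d *\<^sub>R P (vstretch c v) + (c * Im d) *\<^sub>R Q (vstretch c v)
        = of_real (Re d) * P (vstretch c v) + of_real (Im d) * (of_real c * Q (vstretch c v))"
        by (simp add: scaleR_conv_of_real algebra_simps)
      also have "\<dots> = P (vstretch c v) * (of_real (Re d) + \<i> * of_real (Im d))"
        unfolding cQ by (simp add: algebra_simps)
      finally show ?thesis by (simp add: complex_eq[symmetric])
    qed
    ultimately have "((\<lambda>v. F (vstretch c v)) has_field_derivative P (vstretch c v)) (at v)"
      by (simp add: has_field_derivative_def)
    from DERIV_cdivide[OF this, of "of_real m"] show ?thesis by (simp add: G_def)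
  qed
  have "G holomorphic_on (vstretch c -` ball w0 \<rho>)"
    unfolding holomorphic_on_def field_differentiable_def
    using dG has_field_derivative_at_within by blast
  moreover have "dist (G v) (f (vstretch c v)) \<le> e" if v: "vstretch c v \<in> ball w0 \<rho>" for v
  proof -
    define u where "u = vstretch c v"
    have "F u - m *\<^sub>R f u = integral (cbox a b) (\<lambda>z. h (u - z) *\<^sub>R f z) - integral (cbox a b) (\<lambda>z. h (u - z) *\<^sub>R f u)"
      using integral_linear[OF _ bounded_linear_scaleR_left, of "\<lambda>z. h (u - z)" "cbox a b" "f u"]
        m[of u] v h_integrable[of "\<lambda>_. 1 :: real" u] by (simp add: F_def u_def o_def)
    also have "\<dots> = integral (cbox a b) (\<lambda>z. h (u - z) *\<^sub>R (f z - f u))"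
      using h_integrable[OF cf, of u] h_integrable[of "\<lambda>_. f u" u]
      by (simp add: integral_diff scaleR_diff_right)
    finally have "norm (F u - m *\<^sub>R f u) = norm \<dots>" by simp
    also have "\<dots> \<le> integral (cbox a b) (\<lambda>z. h (u - z) *\<^sub>R e)"
    proof (rule Henstock_Kurzweil_Integration.integral_norm_bound_integral)
      show "(\<lambda>z. h (u - z) *\<^sub>R (f z - f u)) integrable_on cbox a b"
        by (intro h_integrable continuous_intros cf)
      show "(\<lambda>z. h (u - z) *\<^sub>R e) integrable_on cbox a b"
        by (intro h_integrable continuous_intros)
      show "norm (h (u - z) *\<^sub>R (f z - f u)) \<le> h (u - z) *\<^sub>R e" for z
      proof (cases "h (u - z) = 0")
        case False
        then have "dist (f z) (f u) \<le> e"
          using osc[of u z] near[of h u z] v by (simp add: u_def)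
        then show ?thesis
          using hpos[of "u - z"] by (simp add: dist_norm mult_left_mono)
      qed simp
    qed
    also have "\<dots> = m * e"
      using m[of u] v by (simp add: u_def)
    finally have "norm (F u - m *\<^sub>R f u) \<le> m * e" .
    moreover from mpos have "G v - f u = (F u - m *\<^sub>R f u) / of_real m"
      by (simp add: G_def u_def diff_divide_distrib scaleR_conv_of_real)
    then have "norm (G v - f u) = norm (F u - m *\<^sub>R f u) / m"
      using mpos by (simp only: norm_divide norm_of_real abs_of_pos)
    ultimately show ?thesis
      using mpos by (simp add: dist_norm u_def[symmetric] divide_le_eq mult.commute)
  qed
  ultimately show ?thesis by (rule that)
qed

text \<open>Weyl's lemma: the holomorphic approximations of the previous lemma converge locally uniformly to
  \<open>f \<circ> vstretch c\<close>.\<close>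

theorem holomorphic_if_weak_solution:
  fixes f :: "complex \<Rightarrow> complex" and c :: real
  assumes cf: "continuous_on UNIV f" and "open \<Omega>"
    and weak: "\<And>\<eta>. test_fun \<eta> \<Longrightarrow> (\<And>z. \<eta> z \<noteq> 0 \<Longrightarrow> z \<in> \<Omega>) \<Longrightarrow>
      (LINT z|lborel. frechet_derivative \<eta> (at z) 1 *\<^sub>R f z)
      + \<i> * of_real c * (LINT z|lborel. frechet_derivative \<eta> (at z) \<i> *\<^sub>R f z) = 0"
  shows "(f \<circ> vstretch c) holomorphic_on (vstretch c -` \<Omega>)"
proof -
  have "\<exists>r>0. (f \<circ> vstretch c) holomorphic_on ball v0 r" if v0: "vstretch c v0 \<in> \<Omega>" for v0
  proof -
    define w0 where "w0 = vstretch c v0"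
    obtain r0 where r0: "0 < r0" "ball w0 r0 \<subseteq> \<Omega>"
      using \<open>open \<Omega>\<close> v0 by (metis openE w0_def)
    \<comment> \<open>the cap 1 keeps all kernels inside one fixed box\<close>
  define \<rho> where "\<rho> = min 1 (r0 / 2)"
    have \<rho>: "0 < \<rho>" "\<rho> \<le> 1" "ball w0 (2 * \<rho>) \<subseteq> \<Omega>"
      using r0 by (auto simp: \<rho>_def)
    have "open (vstretch c -` ball w0 \<rho>)" by (rule open_vimage_vstretch) simp
    moreover have "v0 \<in> vstretch c -` ball w0 \<rho>" using \<rho> by (simp add: w0_def)
    ultimately obtain r where r: "0 < r" "cball v0 r \<subseteq> vstretch c -` ball w0 \<rho>"
      by (meson open_contains_cball)
    have "\<exists>G. G holomorphic_on (vstretch c -` ball w0 \<rho>)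
        \<and> (\<forall>v. vstretch c v \<in> ball w0 \<rho> \<longrightarrow> dist (G v) (f (vstretch c v)) \<le> e)" if e: "0 < e" for e
    proof -
      have "uniformly_continuous_on (cball w0 3) f"
        by (rule compact_uniformly_continuous) (auto intro: continuous_on_subset[OF cf])
      then obtain \<delta> where \<delta>: "0 < \<delta>" "\<And>z u. z \<in> cball w0 3 \<Longrightarrow> u \<in> cball w0 3 \<Longrightarrow> dist z u < \<delta> \<Longrightarrow> dist (f z) (f u) < e"
        using e unfolding uniformly_continuous_on_def by metis
      define \<epsilon> where "\<epsilon> = min (\<rho> / 2) (\<delta> / 2)"
      have eps: "0 < \<epsilon>" "2 * \<epsilon> \<le> \<rho>" "2 * \<epsilon> \<le> \<delta>" using \<rho> \<delta> by (auto simp: \<epsilon>_def)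
      have "dist (f z) (f u) \<le> e" if "u \<in> ball w0 \<rho>" "dist z u < 2 * \<epsilon>" for u z
      proof -
        have "dist w0 z \<le> 3"
          using that \<rho> eps dist_triangle[of w0 z u] by (simp add: dist_commute)
        then show ?thesis
          using that \<rho> eps by (intro less_imp_le \<delta>(2)) auto
      qed
      from weak_solution_holomorphic_approximation[OF cf eps(1,2) \<rho>(2) e weak \<rho>(3) this]
      show ?thesis by metis
    qed
    then have "\<exists>G. G holomorphic_on (vstretch c -` ball w0 \<rho>)
        \<and> (\<forall>v. vstretch c v \<in> ball w0 \<rho> \<longrightarrow> dist (G v) (f (vstretch c v)) \<le> inverse (real (Suc n)))" for n
      by simp
    then obtain G where G: "\<And>n. G n holomorphic_on (vstretch c -` ball w0 \<rho>)"
      "\<And>n v. vstretch c v \<in> ball w0 \<rho> \<Longrightarrow> dist (G n v) (f (vstretch c v)) \<le> inverse (real (Suc n))"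
      by metis
    have "f \<circ> vstretch c holomorphic_on ball v0 r"
    proof (rule holomorphic_uniform_limit)
      show "\<forall>\<^sub>F n in sequentially. continuous_on (cball v0 r) (G n) \<and> G n holomorphic_on ball v0 r"
        using G(1) r(2) ball_subset_cball[of v0 r]
        by (intro always_eventually allI conjI)
          (meson holomorphic_on_imp_continuous_on holomorphic_on_subset order_trans)+
      show "uniform_limit (cball v0 r) G (f \<circ> vstretch c) sequentially"
      proof (rule uniform_limitI)
        fix e :: real assume "0 < e"
        then have "\<forall>\<^sub>F n in sequentially. inverse (real (Suc n)) < e"
          by (metis LIMSEQ_inverse_real_of_nat order_tendstoD(2))
        then show "\<forall>\<^sub>F n in sequentially. \<forall>v\<in>cball v0 r. dist (G n v) ((f \<circ> vstretch c) v) < e"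
        proof eventually_elim
          case (elim n)
          then show ?case using G(2)[of _ n] r(2) by fastforce
        qed
      qed
    qed (auto intro: that)
    with r(1) show ?thesis by blast
  qed
  then have "(f \<circ> vstretch c) field_differentiable (at v)" if "v \<in> vstretch c -` \<Omega>" for v
    using that by (metis centre_in_ball holomorphic_on_imp_differentiable_at open_ball vimageE)
  then show ?thesis
    by (simp add: holomorphic_on_def field_differentiable_at_within)
qed

section \<open>From the Beltrami equation to piecewise holomorphy\<close>

definition open_Sq :: "complex set" where
  "open_Sq = {z. \<bar>Re z\<bar> < 1 \<and> \<bar>Im z\<bar> < 1}"

text \<open>On the compact support of \<open>\<eta>\<close> the modulus of \<open>g\<close> is at most \<open>|g|\<^sup>2 + 1\<close>.\<close>

lemma integrable_test_fun_mult_L2_loc: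
  assumes \<eta>: "test_fun \<eta>" and g: "L2_loc g"
  shows "integrable lborel (\<lambda>z. \<eta> z *\<^sub>R g z)"
proof -
  define S where "S = closure {z. \<eta> z \<noteq> 0}"
  have S: "compact S" using \<eta> by (simp add: test_fun_def S_def)
  obtain D :: "nat \<Rightarrow> nat \<Rightarrow> complex \<Rightarrow> real" where "D 0 0 = \<eta>"
    "\<And>m n z. (D m n has_derivative (\<lambda>h. Re h * D (Suc m) n z + Im h * D m (Suc n) z)) (at z)"
    using \<eta> by (auto simp: test_fun_def smooth_fun_def)
  then have cont: "continuous_on UNIV \<eta>"
    by (metis continuous_at_imp_continuous_on has_derivative_continuous)
  have [measurable]: "\<eta> \<in> borel_measurable borel"
    by (rule borel_measurable_continuous_onI[OF cont])
  have [measurable]: "g \<in> borel_measurable borel" using g by (simp add: L2_loc_def)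
  have "compact (\<eta> ` S)"
    by (intro compact_continuous_image S continuous_on_subset[OF cont]) auto
  then have "bounded (\<eta> ` S)" by (rule compact_imp_bounded)
  then obtain M where M: "\<And>z. z \<in> S \<Longrightarrow> \<bar>\<eta> z\<bar> \<le> M"
    unfolding bounded_iff by (metis imageI real_norm_def)
  have "set_integrable lborel S (\<lambda>z. (norm (g z))\<^sup>2)"
    using g S by (auto simp: L2_loc_def)
  moreover have "set_integrable lborel S (\<lambda>z. 1 :: real)"
    unfolding set_integrable_def using borel_integrable_compact[OF S, of "\<lambda>z. 1 :: real"] by simp
  ultimately have "integrable lborel (\<lambda>z. \<bar>M\<bar> *\<^sub>R (indicator S z *\<^sub>R (norm (g z))\<^sup>2 + indicator S z *\<^sub>R 1))"
    unfolding set_integrable_def by (intro integrable_scaleR_right integrable_add) auto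
  then show ?thesis
  proof (rule Bochner_Integration.integrable_bound)
    show "(\<lambda>z. \<eta> z *\<^sub>R g z) \<in> borel_measurable lborel" by measurable
    show "AE z in lborel. norm (\<eta> z *\<^sub>R g z)
      \<le> norm (\<bar>M\<bar> *\<^sub>R (indicator S z *\<^sub>R (norm (g z))\<^sup>2 + indicator S z *\<^sub>R 1))"
    proof (rule AE_I2)
      fix z
      show "norm (\<eta> z *\<^sub>R g z)
        \<le> norm (\<bar>M\<bar> *\<^sub>R (indicator S z *\<^sub>R (norm (g z))\<^sup>2 + indicator S z *\<^sub>R 1 :: real))"
      proof (cases "\<eta> z = 0")
        case False
        then have z: "z \<in> S" by (simp add: S_def closure_def)
        have "norm (g z) \<le> (norm (g z))\<^sup>2 + 1"
          using zero_le_power2[of "norm (g z) - 1"] by (simp add: power2_eq_square algebra_simps)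
            (smt (verit) mult_nonneg_nonneg norm_ge_zero)
        then have "\<bar>\<eta> z\<bar> * norm (g z) \<le> \<bar>M\<bar> * ((norm (g z))\<^sup>2 + 1)"
          using M[OF z] by (intro mult_mono) auto
        then show ?thesis using z by (simp add: abs_mult)
      qed simp
    qed
  qed
qed

lemma straightening_weak_equation:
  assumes fx: "L2_loc fx" "weak_partial 1 f fx" and fy: "L2_loc fy" "weak_partial \<i> f fy"
    and eq: "AE z in lborel. z \<in> \<Omega> \<longrightarrow> fx z + \<i> * of_real c * fy z = 0"
    and \<eta>: "test_fun \<eta>" "\<And>z. \<eta> z \<noteq> 0 \<Longrightarrow> z \<in> \<Omega>"
  shows "(LINT z|lborel. frechet_derivative \<eta> (at z) 1 *\<^sub>R f z)
      + \<i> * of_real c * (LINT z|lborel. frechet_derivative \<eta> (at z) \<i> *\<^sub>R f z) = 0"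
proof -
  have [measurable]: "fx \<in> borel_measurable borel" "fy \<in> borel_measurable borel"
    using fx fy by (auto simp: L2_loc_def)
  have ix: "integrable lborel (\<lambda>z. \<eta> z *\<^sub>R fx z)" and iy: "integrable lborel (\<lambda>z. \<eta> z *\<^sub>R fy z)"
    using fx fy \<eta>(1) integrable_test_fun_mult_L2_loc by auto
  have "(LINT z|lborel. \<eta> z *\<^sub>R fx z) + \<i> * of_real c * (LINT z|lborel. \<eta> z *\<^sub>R fy z)
    = (LINT z|lborel. \<eta> z *\<^sub>R fx z + \<i> * of_real c * (\<eta> z *\<^sub>R fy z))"
    by (simp only: Bochner_Integration.integral_add[OF ix integrable_mult_right[OF iy]]
        integral_mult_right_zero)
  also have "\<dots> = 0"
  proof (rule integral_eq_zero_AE)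
    show "AE z in lborel. \<eta> z *\<^sub>R fx z + \<i> * of_real c * (\<eta> z *\<^sub>R fy z) = 0"
      using eq
    proof eventually_elim
      case (elim z)
      have "\<eta> z *\<^sub>R fx z + \<i> * of_real c * (\<eta> z *\<^sub>R fy z) = \<eta> z *\<^sub>R (fx z + \<i> * of_real c * fy z)"
        by (simp add: scaleR_conv_of_real algebra_simps)
      then show ?case using elim \<eta>(2)[of z] by (cases "\<eta> z = 0") auto
    qed
  qed
  finally show ?thesis
    using fx(2) fy(2) \<eta>(1) unfolding weak_partial_def by (simp add: algebra_simps add_eq_0_iff)
qed

lemma closed_Sq: "closed Sq"
proof -
  have "Sq = cbox (Complex (-1) (-1)) (Complex 1 1)"
    by (auto simp: Sq_def in_cbox_complex_iff)
  then show ?thesis by (metis closed_cbox)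
qed

lemma open_open_Sq: "open open_Sq"
  unfolding open_Sq_def by (intro open_Collect_conj open_Collect_less continuous_intros)

text \<open>Outside the square \<open>\<mu> = 0\<close> is the Cauchy-Riemann equation. Inside, \<open>\<mu> = (K - 1) / (K + 1)\<close> turns
  \<open>q = \<mu> p\<close> into \<open>fx + \<i> K fy = 0\<close>, the Cauchy-Riemann equation stretched by \<open>K\<close>.\<close>

lemma straightening_conformal:
  assumes K: "K > 1" and \<phi>: "straightening (Sq_beltrami K) \<phi>"
  shows "\<phi> holomorphic_on - Sq" and "(\<phi> \<circ> vstretch K) holomorphic_on (vstretch K -` open_Sq)"
proof -
  obtain p q where pq: "weak_wirtinger \<phi> p q" and mu: "AE z in lborel. q z = Sq_beltrami K z * p z"
    using \<phi> by (auto simp: straightening_def)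
  obtain fx fy where fx: "L2_loc fx" "weak_partial 1 \<phi> fx" and fy: "L2_loc fy" "weak_partial \<i> \<phi> fy"
    and p: "p = (\<lambda>z. (fx z - \<i> * fy z) / 2)" and q: "q = (\<lambda>z. (fx z + \<i> * fy z) / 2)"
    using pq by (auto simp: weak_wirtinger_def)
  have cont: "continuous_on UNIV \<phi>"
    using \<phi> by (auto simp: straightening_def quasiconformal_def homeomorphism_def)
  have "AE z in lborel. z \<in> - Sq \<longrightarrow> fx z + \<i> * of_real 1 * fy z = 0"
    using mu by eventually_elim (auto simp: q Sq_beltrami_def)
  from holomorphic_if_weak_solution[OF cont _ straightening_weak_equation[OF fx fy this], OF open_Compl[OF closed_Sq]]
  have "(\<phi> \<circ> vstretch 1) holomorphic_on (vstretch 1 -` (- Sq))" by simp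
  moreover have "vstretch 1 = id" by (auto simp: fun_eq_iff complex_eq_iff)
  ultimately show "\<phi> holomorphic_on - Sq" by simp
  have "AE z in lborel. z \<in> open_Sq \<longrightarrow> fx z + \<i> * of_real K * fy z = 0"
    using mu
  proof eventually_elim
    case (elim z)
    show ?case
    proof
      assume "z \<in> open_Sq"
      then have "z \<in> Sq" by (auto simp: open_Sq_def Sq_def)
      then have "q z = of_real ((K - 1) / (K + 1)) * p z"
        using elim by (simp add: Sq_beltrami_def)
      moreover have "fx z + \<i> * fy z = k * (fx z - \<i> * fy z)" if "q z = k * p z" for k
      proof -
        have 2: "fx z + \<i> * fy z = 2 * q z" "fx z - \<i> * fy z = 2 * p z" by (simp_all add: p q)
        show ?thesis unfolding 2 that by simp
      qed
      ultimately have "fx z + \<i> * fy z = of_real ((K - 1) / (K + 1)) * (fx z - \<i> * fy z)"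
        by blast
      then have "of_real (K + 1) * (fx z + \<i> * fy z) = of_real (K - 1) * (fx z - \<i> * fy z)"
        using K by (simp add: field_simps del: of_real_add of_real_diff)
      then have "2 * (fx z + \<i> * of_real K * fy z) = 0"
        by (simp add: algebra_simps)
      then show "fx z + \<i> * of_real K * fy z = 0"
        by (metis mult_eq_0_iff zero_neq_numeral)
    qed
  qed
  from holomorphic_if_weak_solution[OF cont open_open_Sq straightening_weak_equation[OF fx fy this]]
  show "(\<phi> \<circ> vstretch K) holomorphic_on (vstretch K -` open_Sq)" by simp
qed

section \<open>Charts across the boundary of the square\<close>

text \<open>Conformality with respect to the Beltrami form of the square, without asking anything at its boundary beyond
  continuity. The charts in which it is tested are the identity outside and \<open>vstretch K\<close> inside.\<close>

definition sq_conformal :: "real \<Rightarrow> complex set \<Rightarrow> (complex \<Rightarrow> complex) \<Rightarrow> bool" where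
  "sq_conformal K V \<xi> \<longleftrightarrow> continuous_on V \<xi> \<and> \<xi> holomorphic_on (V - Sq) \<and>
     (\<xi> \<circ> vstretch K) holomorphic_on (vstretch K -` (V \<inter> open_Sq))"

definition corners :: "complex set" where
  "corners = {Complex 1 1, Complex (-1) 1, Complex (-1) (-1), Complex 1 (-1)}"

lemma vstretch_add: "vstretch c (z + w) = vstretch c z + vstretch c w"
  by (simp add: complex_eq_iff algebra_simps)

lemma vstretch_inverse [simp]: "c \<noteq> 0 \<Longrightarrow> vstretch c (vstretch (1 / c) z) = z"
  "c \<noteq> 0 \<Longrightarrow> vstretch (1 / c) (vstretch c z) = z"
  by (simp_all add: complex_eq_iff)

text \<open>\<open>\<xi> \<circ> g\<close> is the transition between the two holomorphic maps \<open>\<phi> \<circ> L\<close> and \<open>\<xi> \<circ> L\<close>, the first of which is injective.\<close>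

lemma holomorphic_on_comp_inverse_via_chart:
  assumes gf: "g \<circ> \<phi> = id" and W: "open W" and L: "inj_on L W"
    and \<phi>: "(\<phi> \<circ> L) holomorphic_on W" and \<xi>: "(\<xi> \<circ> L) holomorphic_on W"
  shows "(\<xi> \<circ> g) holomorphic_on \<phi> ` L ` W"
proof -
  have gf': "g (\<phi> z) = z" for z using gf by (metis comp_apply id_apply)
  then have "inj \<phi>" by (metis injI)
  with L have "inj_on (\<phi> \<circ> L) W" by (meson comp_inj_on inj_on_subset subset_UNIV)
  then obtain G where G: "G holomorphic_on (\<phi> \<circ> L) ` W" "\<And>w. w \<in> W \<Longrightarrow> G ((\<phi> \<circ> L) w) = w"
    using holomorphic_has_inverse[OF \<phi> W] by metis
  have "((\<xi> \<circ> L) \<circ> G) holomorphic_on (\<phi> \<circ> L) ` W"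
    by (rule holomorphic_on_compose[OF G(1)]) (use G(2) in \<open>auto intro: holomorphic_on_subset[OF \<xi>]\<close>)
  moreover have "((\<xi> \<circ> L) \<circ> G) u = (\<xi> \<circ> g) u" if "u \<in> (\<phi> \<circ> L) ` W" for u
    using that G(2) gf' by auto
  ultimately have "(\<xi> \<circ> g) holomorphic_on (\<phi> \<circ> L) ` W"
    by (rule holomorphic_transform)
  then show ?thesis by (simp add: image_comp)
qed

text \<open>A chart around an edge through \<open>p\<close> with inner normal \<open>d\<close>. The inner half plane is stretched, the outer one scaled
  by \<open>l\<close>, where \<open>l\<close> is chosen such that both maps agree on the edge.\<close>

definition edge_chart :: "real \<Rightarrow> complex \<Rightarrow> complex \<Rightarrow> real \<Rightarrow> complex \<Rightarrow> complex" where
  "edge_chart K p d l w = p + (if 0 \<le> d \<bullet> w then vstretch K w else l *\<^sub>R w)"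

text \<open>The set \<open>\<Sigma>\<close> is an open strip that meets the boundary of the square in one open edge only.\<close>

locale edge =
  fixes K l :: real and p d :: complex and \<Sigma> :: "complex set"
  assumes K: "0 < K" and l: "0 < l" and d: "d \<noteq> 0"
    and agree: "\<And>w. d \<bullet> w = 0 \<Longrightarrow> vstretch K w = l *\<^sub>R w"
    and sign: "\<And>w. 0 < d \<bullet> vstretch K w \<longleftrightarrow> 0 < d \<bullet> w"
    and open_\<Sigma>: "open \<Sigma>"
    and inner_side: "\<And>z. z \<in> \<Sigma> \<Longrightarrow> 0 < d \<bullet> (z - p) \<Longrightarrow> z \<in> open_Sq"
    and outer_side: "\<And>z. z \<in> \<Sigma> \<Longrightarrow> d \<bullet> (z - p) < 0 \<Longrightarrow> z \<notin> Sq"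
begin

abbreviation "L \<equiv> edge_chart K p d l"

lemma sign0: "0 \<le> d \<bullet> vstretch K w \<longleftrightarrow> 0 \<le> d \<bullet> w"
proof -
  have "vstretch K (- w) = - vstretch K w" by (simp add: complex_eq_iff)
  with sign[of "- w"] show ?thesis by (simp add: not_less[symmetric])
qed

lemma inj_L: "inj L"
proof (rule injI)
  fix w w' assume eq: "L w = L w'"
  have side: "0 \<le> d \<bullet> (L w - p) \<longleftrightarrow> 0 \<le> d \<bullet> w" for w
    using sign0[of w] l by (simp add: edge_chart_def zero_le_mult_iff)
  have "0 \<le> d \<bullet> w \<longleftrightarrow> 0 \<le> d \<bullet> w'"
    using side[of w] side[of w'] eq by simp
  moreover have "w = w'" if "vstretch K w = vstretch K w'"
    using that K by (simp add: complex_eq_iff)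
  ultimately show "w = w'"
    using eq l by (auto simp: edge_chart_def split: if_splits)
qed

lemma image_vimage_L: "L ` (L -` X) = X"
proof -
  have "\<exists>w. L w = z" for z
  proof (cases "0 \<le> d \<bullet> (z - p)")
    case True
    then have "L (vstretch (1 / K) (z - p)) = z"
      using sign0[of "vstretch (1 / K) (z - p)"] K by (simp add: edge_chart_def)
    then show ?thesis ..
  next
    case False
    then have "\<not> 0 \<le> d \<bullet> ((1 / l) *\<^sub>R (z - p))"
      using l by (simp add: zero_le_divide_iff)
    then have "L ((1 / l) *\<^sub>R (z - p)) = z"
      using l by (simp add: edge_chart_def)
    then show ?thesis ..
  qed
  then show ?thesis by (metis surj_def surj_image_vimage_eq)
qed

lemma continuous_L: "continuous_on UNIV L"
proof -
  have "continuous_on ({w. 0 \<le> d \<bullet> w} \<union> {w. d \<bullet> w \<le> 0}) (\<lambda>w. if 0 \<le> d \<bullet> w then vstretch K w else l *\<^sub>R w)"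
    by (rule continuous_on_If)
      (auto intro!: continuous_intros closed_Collect_le agree)
  moreover have "{w. 0 \<le> d \<bullet> w} \<union> {w. d \<bullet> w \<le> 0} = UNIV" by auto
  ultimately show ?thesis
    unfolding edge_chart_def by (intro continuous_intros) simp
qed

lemma open_vimage_L: "open X \<Longrightarrow> open (L -` X)"
  by (rule open_vimage[OF _ continuous_L])

text \<open>The chart straightens the edge to the line \<open>d \<bullet> w = 0\<close>. The composition is holomorphic on both sides of it and
  continuous across it, so Morera's theorem for a line applies.\<close>

lemma holomorphic_on_comp_L:
  assumes V: "open V" and \<xi>: "sq_conformal K V \<xi>"
  shows "(\<xi> \<circ> L) holomorphic_on (L -` (V \<inter> \<Sigma>))"
proof (rule holomorphic_on_paste_across_line[OF _ d])
  let ?W = "L -` (V \<inter> \<Sigma>)"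
  show W: "open ?W" by (intro open_vimage_L open_Int V open_\<Sigma>)
  show "continuous_on ?W (\<xi> \<circ> L)"
    using \<xi> unfolding sq_conformal_def
    by (intro continuous_on_compose continuous_on_subset[OF continuous_L])
      (auto intro: continuous_on_subset)
  show "(\<xi> \<circ> L) holomorphic_on (?W \<inter> {z. d \<bullet> z < 0})"
  proof (rule holomorphic_transform)
    have "(\<lambda>w. p + l *\<^sub>R w) holomorphic_on (?W \<inter> {z. d \<bullet> z < 0})"
      unfolding scaleR_conv_of_real by (intro holomorphic_intros)
    then show "(\<xi> \<circ> (\<lambda>w. p + l *\<^sub>R w)) holomorphic_on (?W \<inter> {z. d \<bullet> z < 0})"
    proof (rule holomorphic_on_compose_gen)
      show "\<xi> holomorphic_on (V - Sq)" using \<xi> by (simp add: sq_conformal_def)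
      show "(\<lambda>w. p + l *\<^sub>R w) ` (?W \<inter> {z. d \<bullet> z < 0}) \<subseteq> V - Sq"
      proof (rule image_subsetI)
        fix w assume w: "w \<in> ?W \<inter> {z. d \<bullet> z < 0}"
        then have "p + l *\<^sub>R w \<in> V \<inter> \<Sigma>" by (auto simp: edge_chart_def)
        moreover have "d \<bullet> (p + l *\<^sub>R w - p) < 0" using w l by (simp add: mult_pos_neg)
        ultimately show "p + l *\<^sub>R w \<in> V - Sq" using outer_side by blast
      qed
    qed
  qed (auto simp: edge_chart_def)
  show "(\<xi> \<circ> L) holomorphic_on (?W \<inter> {z. 0 < d \<bullet> z})"
  proof (rule holomorphic_transform)
    define q where "q = vstretch (1 / K) p"
    have q: "vstretch K (q + w) = p + vstretch K w" for w
      using K by (simp add: q_def vstretch_add)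
    have "(\<lambda>w. q + w) holomorphic_on (?W \<inter> {z. 0 < d \<bullet> z})"
      by (intro holomorphic_intros)
    then show "((\<xi> \<circ> vstretch K) \<circ> (\<lambda>w. q + w)) holomorphic_on (?W \<inter> {z. 0 < d \<bullet> z})"
    proof (rule holomorphic_on_compose_gen)
      show "(\<xi> \<circ> vstretch K) holomorphic_on (vstretch K -` (V \<inter> open_Sq))" 
        using \<xi> by (simp add: sq_conformal_def)
      show "(\<lambda>w. q + w) ` (?W \<inter> {z. 0 < d \<bullet> z}) \<subseteq> vstretch K -` (V \<inter> open_Sq)"
      proof (rule image_subsetI)
        fix w assume w: "w \<in> ?W \<inter> {z. 0 < d \<bullet> z}"
        then have "p + vstretch K w \<in> V \<inter> \<Sigma>" by (auto simp: edge_chart_def)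
        moreover have "0 < d \<bullet> (p + vstretch K w - p)" using w sign by simp
        ultimately show "q + w \<in> vstretch K -` (V \<inter> open_Sq)" using inner_side q by auto
      qed
    qed
    show "((\<xi> \<circ> vstretch K) \<circ> (\<lambda>w. q + w)) w = (\<xi> \<circ> L) w" if "w \<in> ?W \<inter> {z. 0 < d \<bullet> z}" for w
      using that by (simp add: q edge_chart_def)
  qed
qed

lemma holomorphic_on_comp_inverse_edge:
  assumes gf: "g \<circ> \<phi> = id" and \<phi>: "sq_conformal K UNIV \<phi>"
    and V: "open V" and \<xi>: "sq_conformal K V \<xi>"
  shows "(\<xi> \<circ> g) holomorphic_on \<phi> ` (V \<inter> \<Sigma>)"
proof -
  have "(\<phi> \<circ> L) holomorphic_on (L -` (V \<inter> \<Sigma>))"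
    using holomorphic_on_comp_L[OF open_UNIV \<phi>] by (rule holomorphic_on_subset) auto
  from holomorphic_on_comp_inverse_via_chart[OF gf open_vimage_L inj_on_subset[OF inj_L] this holomorphic_on_comp_L[OF V \<xi>]]
  show ?thesis unfolding image_vimage_L using V open_\<Sigma> by (simp add: open_Int)
qed

end

text \<open>Off the corners one of six charts applies: the identity, \<open>vstretch K\<close>, or one of the four edge charts. The
  horizontal edges need the scale 1, the vertical ones the scale \<open>K\<close>. The corners are isolated points at which
  the composition is continuous, hence removable.\<close>

theorem holomorphic_on_comp_inverse:
  assumes K: "0 < K" and hom: "homeomorphism UNIV UNIV \<phi> g" and \<phi>: "sq_conformal K UNIV \<phi>"
    and V: "open V" and \<xi>: "sq_conformal K V \<xi>"
  shows "(\<xi> \<circ> g) holomorphic_on \<phi> ` V"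
proof (rule no_isolated_singularity)
  have gf: "g \<circ> \<phi> = id"
    using hom by (auto simp: homeomorphism_def)
  have open_image: "open (\<phi> ` X)" if "open X" for X
    using homeomorphism_imp_open_map[OF hom, of X] that by simp
  show "open (\<phi> ` V)" by (rule open_image[OF V])
  show "finite (\<phi> ` corners)" by (simp add: corners_def)
  have "continuous_on UNIV g" using hom by (auto simp: homeomorphism_def)
  then show "continuous_on (\<phi> ` V) (\<xi> \<circ> g)"
    using \<xi> gf by (intro continuous_on_compose) (auto intro: continuous_on_subset simp: sq_conformal_def image_comp)
  define H where "H = (\<lambda>s :: real. {z. \<bar>Re z\<bar> < 1 \<and> - 1 < s * Im z})"
  define Y where "Y = (\<lambda>s :: real. {z. \<bar>Im z\<bar> < 1 \<and> - 1 < s * Re z})"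
  have outer: "(\<xi> \<circ> g) holomorphic_on \<phi> ` (V - Sq)"
  proof -
    have "(\<xi> \<circ> g) holomorphic_on \<phi> ` id ` (V - Sq)"
      by (rule holomorphic_on_comp_inverse_via_chart[OF gf])
        (use V closed_Sq \<xi> \<phi> in \<open>auto simp: sq_conformal_def open_Diff intro: holomorphic_on_subset\<close>)
    then show ?thesis by simp
  qed
  have inner: "(\<xi> \<circ> g) holomorphic_on \<phi> ` (V \<inter> open_Sq)"
  proof -
    have "(\<xi> \<circ> g) holomorphic_on \<phi> ` vstretch K ` (vstretch K -` (V \<inter> open_Sq))"
    proof (rule holomorphic_on_comp_inverse_via_chart[OF gf])
      show "open (vstretch K -` (V \<inter> open_Sq))"
        by (intro open_vimage_vstretch open_Int V open_open_Sq)
      show "inj_on (vstretch K) (vstretch K -` (V \<inter> open_Sq))"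
        using K by (intro inj_onI) (simp add: complex_eq_iff)
    qed (use \<xi> \<phi> in \<open>auto simp: sq_conformal_def intro: holomorphic_on_subset\<close>)
    moreover have "vstretch K ` (vstretch K -` X) = X" for X
      using K by (metis surjI surj_image_vimage_eq vstretch_inverse(1) less_irrefl)
    ultimately show ?thesis by (simp only:)
  qed
  have s1: "s * (s * x) = x" if "s \<in> {-1, 1}" for s x :: real using that by auto
  have horizontal: "(\<xi> \<circ> g) holomorphic_on \<phi> ` (V \<inter> H s)" if s: "s \<in> {-1, 1}" for s
  proof -
    interpret edge K 1 "Complex 0 s" "Complex 0 (- s)" "H s"
    proof
      show "open (H s)" unfolding H_def
        by (intro open_Collect_conj open_Collect_less continuous_intros)
    qed (use K s in \<open>auto simp: H_def inner_complex_def complex_eq_iff open_Sq_def Sq_def mult_less_0_iff zero_less_mult_iff\<close>)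
    show ?thesis by (rule holomorphic_on_comp_inverse_edge[OF gf \<phi> V \<xi>])
  qed
  have vertical: "(\<xi> \<circ> g) holomorphic_on \<phi> ` (V \<inter> Y s)" if s: "s \<in> {-1, 1}" for s
  proof -
    interpret edge K K "Complex s 0" "Complex (- s) 0" "Y s"
    proof
      show "open (Y s)" unfolding Y_def
        by (intro open_Collect_conj open_Collect_less continuous_intros)
    qed (use K s in \<open>auto simp: Y_def inner_complex_def complex_eq_iff open_Sq_def Sq_def\<close>)
    show ?thesis by (rule holomorphic_on_comp_inverse_edge[OF gf \<phi> V \<xi>])
  qed
  have opens: "open (H s)" "open (Y s)" for s
    unfolding H_def Y_def by (intro open_Collect_conj open_Collect_less continuous_intros)+
  have "(\<xi> \<circ> g) holomorphic_on \<phi> ` (V - Sq) \<union> \<phi> ` (V \<inter> open_Sq) \<union> \<phi> ` (V \<inter> H (-1)) \<union> \<phi> ` (V \<inter> H 1)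
       \<union> \<phi> ` (V \<inter> Y (-1)) \<union> \<phi> ` (V \<inter> Y 1)"
    by (intro holomorphic_on_Un outer inner horizontal vertical open_Un open_image open_Diff open_Int
        V closed_Sq open_open_Sq opens) auto
  moreover have "V - corners \<subseteq> (V - Sq) \<union> (V \<inter> open_Sq) \<union> (V \<inter> H (-1)) \<union> (V \<inter> H 1) \<union> (V \<inter> Y (-1)) \<union> (V \<inter> Y 1)"
  proof
    fix z assume z: "z \<in> V - corners"
    consider "z \<notin> Sq" | "z \<in> open_Sq" | "z \<in> Sq" "z \<notin> open_Sq" "\<bar>Re z\<bar> < 1"
      | "z \<in> Sq" "z \<notin> open_Sq" "\<bar>Im z\<bar> < 1" | "\<bar>Re z\<bar> = 1" "\<bar>Im z\<bar> = 1"
      by (fastforce simp: Sq_def)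
    then show "z \<in> (V - Sq) \<union> (V \<inter> open_Sq) \<union> (V \<inter> H (-1)) \<union> (V \<inter> H 1) \<union> (V \<inter> Y (-1)) \<union> (V \<inter> Y 1)"
    proof cases
      case 3
      then have "Im z = 1 \<or> Im z = -1" by (auto simp: Sq_def open_Sq_def)
      then have "z \<in> H 1 \<or> z \<in> H (-1)" using 3 by (auto simp: H_def)
      then show ?thesis using z by blast
    next
      case 4
      then have "Re z = 1 \<or> Re z = -1" by (auto simp: Sq_def open_Sq_def)
      then have "z \<in> Y 1 \<or> z \<in> Y (-1)" using 4 by (auto simp: Y_def)
      then show ?thesis using z by blast
    next
      case 5
      then have "(Re z = 1 \<or> Re z = -1) \<and> (Im z = 1 \<or> Im z = -1)" by (simp add: abs_if split: if_splits) 
      then have "z \<in> corners" by (auto simp: corners_def complex_eq_iff)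
      then show ?thesis using z by blast
    qed (use z in blast)+
  qed
  then have "\<phi> ` V - \<phi> ` corners \<subseteq> \<phi> ` (V - Sq) \<union> \<phi> ` (V \<inter> open_Sq) \<union> \<phi> ` (V \<inter> H (-1)) \<union> \<phi> ` (V \<inter> H 1)
       \<union> \<phi> ` (V \<inter> Y (-1)) \<union> \<phi> ` (V \<inter> Y 1)"
    by blast
  ultimately show "(\<xi> \<circ> g) holomorphic_on \<phi> ` V - \<phi> ` corners"
    by (rule holomorphic_on_subset)
qed

section \<open>Uniqueness and symmetries of the straightening\<close>

lemma homeomorphism_inverse_at_infinity:
  fixes \<phi> g :: "complex \<Rightarrow> complex"
  assumes hom: "homeomorphism UNIV UNIV \<phi> g"
  shows "filterlim g at_infinity at_infinity"
  unfolding filterlim_at_infinity[OF order_refl] eventually_at_infinity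
proof (intro allI impI)
  fix R :: real assume "0 < R"
  have "compact (\<phi> ` cball 0 R)"
    using hom by (intro compact_continuous_image) (auto simp: homeomorphism_def intro: continuous_on_subset)
  then obtain M where M: "\<And>z. z \<in> cball 0 R \<Longrightarrow> norm (\<phi> z) \<le> M"
    by (meson bounded_iff compact_imp_bounded imageI)
  have "R \<le> norm (g u)" if "M + 1 \<le> norm u" for u
  proof (rule ccontr)
    assume "\<not> R \<le> norm (g u)"
    then have "norm (\<phi> (g u)) \<le> M" by (intro M) auto
    then show False using that hom by (simp add: homeomorphism_def)
  qed
  then show "\<exists>b. \<forall>u. b \<le> norm u \<longrightarrow> R \<le> norm (g u)" by blast
qed

text \<open>\<open>\<phi>1 \<circ> g2\<close> is entire and differs from the identity by a function that tends to 0 at infinity.\<close>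

theorem sq_conformal_unique:
  assumes K: "0 < K"
    and 1: "homeomorphism UNIV UNIV \<phi>1 g1" "sq_conformal K UNIV \<phi>1" "((\<lambda>z. \<phi>1 z - z) \<longlongrightarrow> 0) at_infinity"
    and 2: "homeomorphism UNIV UNIV \<phi>2 g2" "sq_conformal K UNIV \<phi>2" "((\<lambda>z. \<phi>2 z - z) \<longlongrightarrow> 0) at_infinity"
  shows "\<phi>1 = \<phi>2"
proof -
  have inv: "\<phi>2 (g2 u) = u" "g2 (\<phi>2 z) = z" for u z using 2(1) by (auto simp: homeomorphism_def)
  have "(\<phi>1 \<circ> g2) holomorphic_on \<phi>2 ` UNIV"
    by (rule holomorphic_on_comp_inverse[OF K 2(1,2) open_UNIV 1(2)])
  moreover have "range \<phi>2 = UNIV" using inv by (metis surjI)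
  ultimately have "(\<lambda>u. \<phi>1 (g2 u) - u) holomorphic_on UNIV"
    by (intro holomorphic_intros) (simp add: o_def)
  moreover have "((\<lambda>u. \<phi>1 (g2 u) - u) \<longlongrightarrow> 0) at_infinity"
  proof -
    have "((\<lambda>u. (\<phi>1 (g2 u) - g2 u) - (\<phi>2 (g2 u) - g2 u)) \<longlongrightarrow> 0 - 0) at_infinity"
      by (intro tendsto_diff filterlim_compose[OF 1(3)] filterlim_compose[OF 2(3)]
          homeomorphism_inverse_at_infinity[OF 2(1)])
    then show ?thesis by (simp add: inv)
  qed
  ultimately have "\<phi>1 (g2 u) - u = 0" for u by (rule Liouville_weak_0)
  then show ?thesis by (metis eq_iff_diff_eq_0 ext inv(2))
qed

locale sq_straightening =
  fixes K :: real and \<phi> g :: "complex \<Rightarrow> complex"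
  assumes K: "1 < K" and hom: "homeomorphism UNIV UNIV \<phi> g" and conf: "sq_conformal K UNIV \<phi>"
    and asym: "((\<lambda>z. \<phi> z - z) \<longlongrightarrow> 0) at_infinity"
begin

lemma g_\<phi> [simp]: "g (\<phi> z) = z" and \<phi>_g [simp]: "\<phi> (g z) = z"
  using hom by (auto simp: homeomorphism_def)

lemma inj_\<phi>: "inj \<phi>" by (metis g_\<phi> injI)

lemma \<phi>_eq_iff [simp]: "\<phi> z = \<phi> w \<longleftrightarrow> z = w" by (metis g_\<phi>)

lemma continuous_\<phi>: "continuous_on S \<phi>" and continuous_g: "continuous_on S g"
  using hom by (auto simp: homeomorphism_def intro: continuous_on_subset)

lemma open_image_\<phi>: "open X \<Longrightarrow> open (\<phi> ` X)"
  using homeomorphism_imp_open_map[OF hom, of X] by simp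

lemma mem_image_\<phi>: "u \<in> \<phi> ` X \<longleftrightarrow> g u \<in> X"
  by (metis \<phi>_g g_\<phi> image_iff)

text \<open>Conjugating \<open>\<phi>\<close> with an isometric involution \<open>s\<close> gives another normalized solution if it stays conformal for the
  square; uniqueness then makes \<open>\<phi>\<close> commute with \<open>s\<close>.\<close>

lemma symmetric_if:
  assumes s: "continuous_on UNIV s" "\<And>z. s (s z) = z" "\<And>z w. s (z - w) = s z - s w" "\<And>z. norm (s z) = norm z"
    and conf': "sq_conformal K UNIV (s \<circ> \<phi> \<circ> s)"
  shows "\<phi> (s z) = s (\<phi> z)"
proof -
  have hom': "homeomorphism UNIV UNIV (s \<circ> \<phi> \<circ> s) (s \<circ> g \<circ> s)"
    unfolding homeomorphism_def
  proof (intro conjI ballI)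
    show "continuous_on UNIV (s \<circ> \<phi> \<circ> s)" "continuous_on UNIV (s \<circ> g \<circ> s)"
      by (intro continuous_on_compose continuous_\<phi> continuous_g continuous_on_subset[OF s(1)]; simp)+
    show "(s \<circ> \<phi> \<circ> s) ` UNIV = UNIV" by (rule surjI[where f = "s \<circ> g \<circ> s"]) (simp add: s(2))
    show "(s \<circ> g \<circ> s) ` UNIV = UNIV" by (rule surjI[where f = "s \<circ> \<phi> \<circ> s"]) (simp add: s(2))
  qed (simp_all add: s(2))
  have asym': "((\<lambda>z. (s \<circ> \<phi> \<circ> s) z - z) \<longlongrightarrow> 0) at_infinity"
  proof -
    have "filterlim s at_infinity at_infinity"
      unfolding filterlim_at_infinity[OF order_refl] eventually_at_infinity s(4) by blast
    from tendsto_norm_zero[OF filterlim_compose[OF asym this]]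
    have lim: "((\<lambda>z. norm (\<phi> (s z) - s z)) \<longlongrightarrow> 0) at_infinity" .
    have eq: "norm ((s \<circ> \<phi> \<circ> s) z - z) = norm (\<phi> (s z) - s z)" for z
      by (metis comp_apply s(2,3,4))
    show ?thesis by (rule tendsto_norm_zero_cancel) (simp only: eq lim)
  qed
  have "0 < K" using K by simp
  from fun_cong[OF sq_conformal_unique[OF this hom conf asym hom' conf' asym'], of "s z"]
  show ?thesis by (simp add: s(2))
qed

lemma vstretch_cnj: "vstretch c (cnj z) = cnj (vstretch c z)"
  by (simp add: complex_eq_iff)

lemma \<phi>_cnj: "\<phi> (cnj z) = cnj (\<phi> z)"
proof (rule symmetric_if)
  have *: "cnj ` (- Sq) = - Sq" "cnj ` (vstretch K -` open_Sq) = vstretch K -` open_Sq"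
    unfolding image_cnj_conv_vimage_cnj by (auto simp: Sq_def open_Sq_def abs_mult)
  have "cnj \<circ> \<phi> \<circ> cnj holomorphic_on - Sq"
    using conf * by (intro holomorphic_on_compose_cnj_cnj) (auto simp: sq_conformal_def closed_Sq Compl_eq_Diff_UNIV)
  moreover have "cnj \<circ> (\<phi> \<circ> vstretch K) \<circ> cnj holomorphic_on vstretch K -` open_Sq"
    using conf * by (intro holomorphic_on_compose_cnj_cnj open_vimage_vstretch open_open_Sq) (auto simp: sq_conformal_def)
  moreover have "cnj \<circ> (\<phi> \<circ> vstretch K) \<circ> cnj = (cnj \<circ> \<phi> \<circ> cnj) \<circ> vstretch K"
    by (auto simp: fun_eq_iff vstretch_cnj)
  ultimately show "sq_conformal K UNIV (cnj \<circ> \<phi> \<circ> cnj)"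
    unfolding sq_conformal_def by (auto simp: Compl_eq_Diff_UNIV
        intro!: continuous_on_compose continuous_\<phi> continuous_intros continuous_on_compose2[OF continuous_\<phi>])
qed (auto intro: continuous_intros)

lemma vstretch_minus: "vstretch c (- z) = - vstretch c z"
  by (simp add: complex_eq_iff)

lemma \<phi>_minus: "\<phi> (- z) = - \<phi> z"
proof (rule symmetric_if)
  have "uminus \<circ> \<phi> \<circ> uminus holomorphic_on - Sq"
    using conf unfolding o_def
    by (intro holomorphic_on_minus holomorphic_on_compose_gen[of uminus _ \<phi> "- Sq", unfolded o_def] holomorphic_intros)
      (auto simp: sq_conformal_def Sq_def Compl_eq_Diff_UNIV)
  moreover have "uminus \<circ> (\<phi> \<circ> vstretch K) \<circ> uminus holomorphic_on vstretch K -` open_Sq"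
    using conf unfolding o_def
    by (intro holomorphic_on_minus holomorphic_on_compose_gen[of uminus _ "\<lambda>z. \<phi> (vstretch K z)" "vstretch K -` open_Sq", unfolded o_def] holomorphic_intros)
      (auto simp: sq_conformal_def open_Sq_def o_def)
  moreover have "uminus \<circ> (\<phi> \<circ> vstretch K) \<circ> uminus = (uminus \<circ> \<phi> \<circ> uminus) \<circ> vstretch K"
    by (auto simp: fun_eq_iff vstretch_minus)
  ultimately show "sq_conformal K UNIV (uminus \<circ> \<phi> \<circ> uminus)"
    unfolding sq_conformal_def by (auto simp: Compl_eq_Diff_UNIV
        intro!: continuous_on_compose continuous_\<phi> continuous_intros continuous_on_compose2[OF continuous_\<phi>])
qed (auto intro: continuous_intros)

lemma g_cnj: "g (cnj u) = cnj (g u)" and g_minus: "g (- u) = - g u"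
  by (metis \<phi>_cnj \<phi>_g g_\<phi>) (metis \<phi>_minus \<phi>_g g_\<phi>)

lemma \<phi>_0: "\<phi> 0 = 0" and g_0: "g 0 = 0"
  using \<phi>_minus[of 0] g_minus[of 0] by (simp_all add: eq_neg_iff_add_eq_0 flip: mult_2)

text \<open>For \<open>l\<close> the real or imaginary part: \<open>\<phi>\<close> maps a half plane into the complement of its boundary line, and far out, where
  \<open>\<phi>\<close> is close to the identity, it stays on the same side.\<close>

lemma \<phi>_preserves_side:
  assumes l: "bounded_linear l" and fix0: "\<And>z. l (\<phi> z) = 0 \<Longrightarrow> l z = (0 :: real)"
    and e: "l e = 1" and z: "0 < l z"
    and bound: "\<And>z. \<bar>l z\<bar> \<le> norm z"
  shows "0 < l (\<phi> z)"
proof (rule ccontr)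
  assume "\<not> 0 < l (\<phi> z)"
  interpret l: bounded_linear l by fact
  have "convex {z. 0 < l z}"
    by (auto simp: convex_def l.add l.scaleR) (metis add.commute add_0 add_pos_nonneg add_strict_increasing mult_eq_0_iff mult_nonneg_nonneg mult_pos_pos not_less zero_neq_one order.order_iff_strict)
  then have conn: "connected ((l \<circ> \<phi>) ` {z. 0 < l z})"
    by (intro connected_continuous_image continuous_on_compose continuous_\<phi> l.continuous_on continuous_on_id convex_connected)
  have "\<exists>w. 0 < l w \<and> 0 < l (\<phi> w)"
  proof -
    obtain b where b: "\<And>z. b \<le> norm z \<Longrightarrow> norm (\<phi> z - z) < 1"
      using tendstoD[OF asym, of 1] unfolding eventually_at_infinity by (metis dist_0_norm dist_commute zero_less_one)
    have "1 \<le> norm e" using bound[of e] e by simp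
    define t where "t = max 1 \<bar>b\<bar>"
    have "b \<le> t * norm e"
      using mult_mono[of "\<bar>b\<bar>" t 1 "norm e"] \<open>1 \<le> norm e\<close> by (simp add: t_def) linarith
    then have "norm (\<phi> (t *\<^sub>R e) - t *\<^sub>R e) < 1"
      by (intro b) (auto simp: t_def)
    then have "\<bar>l (\<phi> (t *\<^sub>R e)) - t\<bar> < 1"
      using bound[of "\<phi> (t *\<^sub>R e) - t *\<^sub>R e"] e by (simp add: l.diff l.scaleR)
    moreover have "1 \<le> t" by (simp add: t_def)
    ultimately have "0 < l (\<phi> (t *\<^sub>R e))" "0 < l (t *\<^sub>R e)" using e by (auto simp: l.scaleR)
    then show ?thesis by blast
  qed
  then obtain w where w: "0 < l w" "0 < l (\<phi> w)" by blast
  have "l (\<phi> z) \<in> (l \<circ> \<phi>) ` {z. 0 < l z}" "l (\<phi> w) \<in> (l \<circ> \<phi>) ` {z. 0 < l z}"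
    using z w(1) by force+
  from connectedD_interval[OF conn this, of 0] obtain v where "0 < l v" "l (\<phi> v) = 0"
    using \<open>\<not> 0 < l (\<phi> z)\<close> w(2) by force
  then show False using fix0[of v] by simp
qed

lemma \<phi>_upper: "0 < Im z \<Longrightarrow> 0 < Im (\<phi> z)"
proof (rule \<phi>_preserves_side[where l=Im and e=\<i>])
  fix z assume "Im (\<phi> z) = 0"
  then have "cnj (\<phi> z) = \<phi> z" by (simp add: complex_eq_iff)
  then have "cnj z = z" by (simp flip: \<phi>_cnj)
  then show "Im z = 0" by (simp add: complex_eq_iff)
qed (auto simp: bounded_linear_Im abs_Im_le_cmod simp flip: minus_complex.sel)

lemma \<phi>_right: "0 < Re z \<Longrightarrow> 0 < Re (\<phi> z)"
proof (rule \<phi>_preserves_side[where l=Re and e=1])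
  fix z assume "Re (\<phi> z) = 0"
  then have "- cnj (\<phi> z) = \<phi> z" by (simp add: complex_eq_iff)
  then have "- cnj z = z" by (simp flip: \<phi>_cnj \<phi>_minus)
  then show "Re z = 0" by (simp add: complex_eq_iff)
qed (auto simp: bounded_linear_Re abs_Re_le_cmod simp flip: minus_complex.sel)

definition z1 :: complex where "z1 = \<phi> (Complex 1 1)"

lemma z1_quadrant: "0 < Re z1" "0 < Im z1"
  unfolding z1_def by (auto intro!: \<phi>_right \<phi>_upper)

lemma \<phi>_corners: "\<phi> (Complex (-1) 1) = - cnj z1" "\<phi> (Complex (-1) (-1)) = - z1" "\<phi> (Complex 1 (-1)) = cnj z1"
proof -
  have "Complex (-1) 1 = - cnj (Complex 1 1)" "Complex (-1) (-1) = - Complex 1 1" "Complex 1 (-1) = cnj (Complex 1 1)"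
    by (simp_all add: complex_eq_iff)
  then show "\<phi> (Complex (-1) 1) = - cnj z1" "\<phi> (Complex (-1) (-1)) = - z1" "\<phi> (Complex 1 (-1)) = cnj z1"
    by (simp_all only: \<phi>_minus \<phi>_cnj z1_def)
qed

end

section \<open>The developing map and its nonlinearity\<close>

text \<open>The point of \<open>[-1, 1]\<close> nearest to \<open>x\<close>.\<close>

definition clamp1 :: "real \<Rightarrow> real" where
  "clamp1 x = max (-1) (min 1 x)"

text \<open>The continuation of \<open>vstretch (1 / K)\<close> from the square across its four open edges. In the right and left arms of
  the cross it has scale \<open>1 / K\<close> in both directions, in the upper and lower arms scale 1; only in the four
  quadrants beyond the corners does it fail to be conformal.\<close>

definition develop :: "real \<Rightarrow> complex \<Rightarrow> complex" where
  "develop K z = Complex (clamp1 (Re z) + (Re z - clamp1 (Re z)) / K)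
                         (clamp1 (Im z) / K + (Im z - clamp1 (Im z)))"

definition cross :: "complex set" where
  "cross = {z. \<bar>Re z\<bar> < 1 \<or> \<bar>Im z\<bar> < 1}"

lemma open_cross: "open cross"
  unfolding cross_def by (intro open_Collect_disj open_Collect_less continuous_intros)

lemma develop_Sq: "z \<in> Sq \<Longrightarrow> develop K z = vstretch (1 / K) z"
  by (auto simp: Sq_def develop_def clamp1_def complex_eq_iff max_def min_def)

lemma clamp1_minus: "clamp1 (- x) = - clamp1 x"
  by (auto simp: clamp1_def max_def min_def)

lemma develop_minus: "develop K (- z) = - develop K z"
  by (simp add: develop_def clamp1_minus complex_eq_iff diff_divide_distrib)

lemma develop_cnj: "develop K (cnj z) = cnj (develop K z)"
  by (simp add: develop_def clamp1_minus complex_eq_iff)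

lemma develop_0 [simp]: "develop K 0 = 0"
  by (simp add: develop_def clamp1_def complex_eq_iff)

lemma continuous_on_develop: "continuous_on S (develop K)"
proof -
  have "develop K = (\<lambda>z. of_real (clamp1 (Re z) + (Re z - clamp1 (Re z)) / K)
      + \<i> * of_real (clamp1 (Im z) / K + (Im z - clamp1 (Im z))))"
    by (simp add: fun_eq_iff develop_def complex_eq_iff)
  then show ?thesis
    unfolding clamp1_def divide_inverse by (simp only:) (intro continuous_intros)
qed

text \<open>Both coordinates of \<open>develop K z\<close> are strictly increasing functions of one coordinate of \<open>z\<close>.\<close>

lemma inj_develop:
  assumes "0 < K" shows "inj (develop K)"
proof -
  have mono: "clamp1 x + (x - clamp1 x) * k < clamp1 y + (y - clamp1 y) * k" if "x < y" "0 < k" for x y k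
  proof -
    have "clamp1 x \<le> clamp1 y" "x - clamp1 x \<le> y - clamp1 y" "clamp1 x < clamp1 y \<or> x - clamp1 x < y - clamp1 y"
      using that by (auto simp: clamp1_def max_def min_def)
    moreover have "(x - clamp1 x) * k \<le> (y - clamp1 y) * k"
      using calculation that by (intro mult_right_mono) auto
    moreover have "(x - clamp1 x) * k < (y - clamp1 y) * k" if "x - clamp1 x < y - clamp1 y"
      using that \<open>0 < k\<close> by (rule mult_strict_right_mono)
    ultimately show ?thesis by linarith
  qed
  have eq: "x = y" if "clamp1 x + (x - clamp1 x) * k = clamp1 y + (y - clamp1 y) * k" "0 < k" for x y k
    using that mono[of x y k] mono[of y x k] by (cases x y rule: linorder_cases) auto
  show ?thesis
  proof (rule injI)
    fix z w assume "develop K z = develop K w"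
    then have re: "clamp1 (Re z) + (Re z - clamp1 (Re z)) * (1 / K) = clamp1 (Re w) + (Re w - clamp1 (Re w)) * (1 / K)"
      and im: "clamp1 (Im z) / K + (Im z - clamp1 (Im z)) = clamp1 (Im w) / K + (Im w - clamp1 (Im w))"
      by (simp_all add: develop_def)
    have im': "clamp1 (Im z) + (Im z - clamp1 (Im z)) * K = clamp1 (Im w) + (Im w - clamp1 (Im w)) * K"
      using arg_cong[OF im, of "\<lambda>x. K * x"] assms by (simp add: distrib_left mult.commute)
    show "z = w"
      using eq[OF re] eq[OF im'] assms by (simp add: complex_eq_iff)
  qed
qed

text \<open>The arm of the cross in the direction of the unit vector \<open>d\<close>.\<close>

definition arm :: "complex \<Rightarrow> complex set" where
  "arm d = {z. 1 < d \<bullet> z \<and> \<bar>(\<i> * d) \<bullet> z\<bar> < 1}"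

lemma cross_minus_Sq: "cross - Sq = arm 1 \<union> arm (-1) \<union> arm \<i> \<union> arm (- \<i>)"
  by (auto simp: cross_def Sq_def arm_def inner_complex_def)

lemma open_arm: "open (arm d)"
  unfolding arm_def by (intro open_Collect_conj open_Collect_less continuous_intros)

lemma develop_arm:
  assumes "d \<in> {1, -1, \<i>, - \<i>}"
  obtains \<alpha> \<beta> where "\<alpha> \<noteq> 0 \<or> K = 0" "\<And>z. z \<in> arm d \<Longrightarrow> develop K z = \<alpha> * z + \<beta>"
    "d \<in> {\<i>, - \<i>} \<Longrightarrow> \<alpha> = 1"
proof
  define \<alpha> :: complex where "\<alpha> = (if d \<in> {\<i>, - \<i>} then 1 else of_real (1 / K))"
  define \<beta> :: complex where "\<beta> = (if d \<in> {\<i>, - \<i>} then d * of_real (1 / K - 1) else d * of_real (1 - 1 / K))"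
  show "\<alpha> \<noteq> 0 \<or> K = 0" by (simp add: \<alpha>_def)
  show "d \<in> {\<i>, - \<i>} \<Longrightarrow> \<alpha> = 1" by (simp add: \<alpha>_def)
  have nn: "(1 :: complex) \<noteq> \<i>" "(1 :: complex) \<noteq> - \<i>" "- (1 :: complex) \<noteq> \<i>" by (auto simp: complex_eq_iff)
  show "develop K z = \<alpha> * z + \<beta>" if "z \<in> arm d" for z
    using assms that nn
    by (auto simp: \<alpha>_def \<beta>_def arm_def develop_def clamp1_def inner_complex_def complex_eq_iff diff_divide_distrib)
qed

lemma sq_conformal_develop:
  assumes "0 < K" shows "sq_conformal K cross (develop K)"
  unfolding sq_conformal_def
proof (intro conjI)
  have "develop K holomorphic_on arm d" if d: "d \<in> {1, -1, \<i>, - \<i>}" for d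
  proof -
    obtain \<alpha> \<beta> where *: "\<And>z. z \<in> arm d \<Longrightarrow> develop K z = \<alpha> * z + \<beta>" using develop_arm[OF d] by metis
    have "(\<lambda>z. \<alpha> * z + \<beta>) holomorphic_on arm d" by (intro holomorphic_intros)
    then show ?thesis by (rule holomorphic_transform) (simp add: *)
  qed
  then show "develop K holomorphic_on (cross - Sq)"
    unfolding cross_minus_Sq by (intro holomorphic_on_Un open_Un open_arm) auto
  have "(\<lambda>z. z) holomorphic_on vstretch K -` (cross \<inter> open_Sq)" by (intro holomorphic_intros)
  then show "develop K \<circ> vstretch K holomorphic_on vstretch K -` (cross \<inter> open_Sq)"
  proof (rule holomorphic_transform)
    fix z assume "z \<in> vstretch K -` (cross \<inter> open_Sq)"
    then have "vstretch K z \<in> Sq" by (auto simp: open_Sq_def Sq_def)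
    then show "z = (develop K \<circ> vstretch K) z" using assms by (simp add: develop_Sq)
  qed
qed (rule continuous_on_develop)

text \<open>Cauchy's estimate on discs of radius 1.\<close>

lemma deriv_tendsto_0_at_infinity:
  assumes f: "f holomorphic_on {u. R < norm u}" and lim: "(f \<longlongrightarrow> 0) at_infinity"
  shows "(deriv f \<longlongrightarrow> 0) at_infinity"
proof (rule tendstoI)
  fix e :: real assume "0 < e"
  then obtain b where b: "\<And>u. b \<le> norm u \<Longrightarrow> dist (f u) 0 < e / 2"
    using tendstoD[OF lim, of "e / 2"] unfolding eventually_at_infinity by auto
  have "dist (deriv f u) 0 < e" if u: "max R b + 2 \<le> norm u" for u
  proof -
    have *: "max R b < norm w" if "w \<in> cball u 1" for w
      using that u norm_triangle_sub[of u w] by (auto simp: dist_norm)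
    have "norm ((deriv ^^ 1) f u) \<le> fact 1 * (e / 2) / 1 ^ 1"
    proof (rule Cauchy_inequality)
      have "f holomorphic_on cball u 1" by (rule holomorphic_on_subset[OF f]) (use * in fastforce)
      then show "continuous_on (cball u 1) f" "f holomorphic_on ball u 1"
        by (auto intro: holomorphic_on_imp_continuous_on holomorphic_on_subset)
      show "norm (f x) \<le> e / 2" if "norm (u - x) = 1" for x
        using b[of x] *[of x] that by (auto simp: dist_norm)
    qed simp
    then show ?thesis using \<open>0 < e\<close> by simp
  qed
  then show "\<forall>\<^sub>F u in at_infinity. dist (deriv f u) 0 < e"
    unfolding eventually_at_infinity by blast
qed

lemma has_field_derivative_reflect:
  assumes "(f has_field_derivative D) (at u)"
  shows "((\<lambda>u. f (- u)) has_field_derivative - D) (at (- u))"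
proof -
  have "(uminus has_field_derivative - 1) (at (- u))" by (auto intro!: derivative_eq_intros)
  then show ?thesis using DERIV_chain2[of f D uminus "- u" "- 1"] assms by simp
qed

lemma deriv_odd:
  assumes "\<And>u. f (- u) = - f u" "f field_differentiable at u"
  shows "deriv f (- u) = deriv f u"
proof (rule DERIV_imp_deriv)
  have "((\<lambda>u. - f (- u)) has_field_derivative deriv f u) (at (- u))"
    using DERIV_minus[OF has_field_derivative_reflect[OF field_differentiable_derivI[OF assms(2)]]] by simp
  then show "(f has_field_derivative deriv f u) (at (- u))" by (simp add: assms(1))
qed

lemma deriv_even:
  assumes "open S" "\<And>u. u \<in> S \<Longrightarrow> f (- u) = f u" "f field_differentiable at u" "u \<in> S" "\<And>u. u \<in> S \<Longrightarrow> - u \<in> S"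
  shows "deriv f (- u) = - deriv f u"
proof (rule DERIV_imp_deriv)
  have "((\<lambda>u. f (- u)) has_field_derivative - deriv f u) (at (- u))"
    by (rule has_field_derivative_reflect[OF field_differentiable_derivI[OF assms(3)]])
  then show "(f has_field_derivative - deriv f u) (at (- u))"
    by (rule has_field_derivative_transform_within_open[OF _ assms(1)]) (use assms in auto)
qed

lemma deriv_real:
  assumes "open S" "\<And>u. u \<in> S \<Longrightarrow> f (cnj u) = cnj (f u)" "f field_differentiable at u" "u \<in> S" "\<And>u. u \<in> S \<Longrightarrow> cnj u \<in> S"
  shows "deriv f (cnj u) = cnj (deriv f u)"
proof (rule DERIV_imp_deriv)
  have "((cnj \<circ> f \<circ> cnj) has_field_derivative cnj (deriv f u)) (at (cnj u))"
    using assms(3) field_differentiable_derivI[of f u] by (intro has_field_derivative_cnj_cnj) simp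
  then show "(f has_field_derivative cnj (deriv f u)) (at (cnj u))"
    by (rule has_field_derivative_transform_within_open[OF _ assms(1)]) (use assms in auto)
qed

context sq_straightening
begin

definition "\<Omega> = \<phi> ` cross"

definition "dev u = develop K (g u)"

text \<open>The nonlinearity of \<open>dev\<close>, respectively of \<open>g\<close>. It does not change when an affine map is applied to the function,
  which makes the two clauses compatible on the overlap.\<close>

definition "N u = (if u \<in> \<Omega> then deriv (deriv dev) u / deriv dev u else deriv (deriv g) u / deriv g u)"

lemma open_\<Omega>: "open \<Omega>" and open_exterior: "open (\<phi> ` (- Sq))"
  unfolding \<Omega>_def by (auto intro!: open_image_\<phi> open_cross open_Compl closed_Sq)

lemma K_pos: "0 < K" using K by simp

lemma dev_holomorphic: "dev holomorphic_on \<Omega>"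
  using holomorphic_on_comp_inverse[OF K_pos hom conf open_cross sq_conformal_develop[OF K_pos]]
  by (simp add: \<Omega>_def dev_def[abs_def] o_def)

lemma inj_dev: "inj dev"
  using injD[OF inj_develop[OF K_pos]] unfolding dev_def by (metis \<phi>_g injI)

lemma deriv_dev_nonzero: "u \<in> \<Omega> \<Longrightarrow> deriv dev u \<noteq> 0"
  by (rule holomorphic_injective_imp_regular[OF dev_holomorphic open_\<Omega>])
    (auto intro: inj_on_subset[OF inj_dev])

lemma g_holomorphic: "g holomorphic_on \<phi> ` (- Sq)"
proof -
  have "- Sq \<inter> open_Sq = {}" by (auto simp: Sq_def open_Sq_def)
  then have "sq_conformal K (- Sq) id"
    by (auto simp: sq_conformal_def intro: holomorphic_intros)
  from holomorphic_on_comp_inverse[OF K_pos hom conf open_Compl[OF closed_Sq] this]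
  show ?thesis by simp
qed

lemma deriv_g_nonzero: "u \<in> \<phi> ` (- Sq) \<Longrightarrow> deriv g u \<noteq> 0"
  by (rule holomorphic_injective_imp_regular[OF g_holomorphic open_exterior])
    (auto intro: inj_onI)

lemma deriv_dev_arm:
  assumes d: "d \<in> {1, -1, \<i>, - \<i>}"
  obtains \<alpha> where "\<alpha> \<noteq> 0" "\<And>u. u \<in> \<phi> ` arm d \<Longrightarrow> deriv dev u = \<alpha> * deriv g u"
    "\<And>u. u \<in> \<phi> ` arm d \<Longrightarrow> deriv (deriv dev) u = \<alpha> * deriv (deriv g) u"
    "d \<in> {\<i>, - \<i>} \<Longrightarrow> \<alpha> = 1"
proof -
  obtain \<alpha> \<beta> where ab: "\<alpha> \<noteq> 0" "\<And>z. z \<in> arm d \<Longrightarrow> develop K z = \<alpha> * z + \<beta>" "d \<in> {\<i>, - \<i>} \<Longrightarrow> \<alpha> = 1"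
    using develop_arm[OF d, of K] K_pos by (metis less_irrefl)
  have opn: "open (\<phi> ` arm d)" by (intro open_image_\<phi> open_arm)
  have "arm d \<subseteq> cross - Sq" using d unfolding cross_minus_Sq by blast
  then have sub: "\<phi> ` arm d \<subseteq> \<phi> ` (- Sq)" by blast
  have D1: "deriv dev u = \<alpha> * deriv g u" if u: "u \<in> \<phi> ` arm d" for u
  proof -
    have "g field_differentiable (at u)"
      using g_holomorphic u sub open_exterior by (metis holomorphic_on_imp_differentiable_at subsetD)
    then have "((\<lambda>u. \<alpha> * g u + \<beta>) has_field_derivative \<alpha> * deriv g u) (at u)"
      using field_differentiable_derivI by (auto intro!: derivative_eq_intros)
    then have "(dev has_field_derivative \<alpha> * deriv g u) (at u)"
      by (rule has_field_derivative_transform_within_open[OF _ opn u]) (auto simp: dev_def ab(2))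
    then show ?thesis by (rule DERIV_imp_deriv)
  qed
  have D2: "deriv (deriv dev) u = \<alpha> * deriv (deriv g) u" if u: "u \<in> \<phi> ` arm d" for u
  proof -
    have "deriv g holomorphic_on \<phi> ` (- Sq)"
      by (rule holomorphic_deriv[OF g_holomorphic open_exterior])
    then have "deriv g field_differentiable (at u)"
      using u sub open_exterior by (metis holomorphic_on_imp_differentiable_at subsetD)
    then have "((\<lambda>u. \<alpha> * deriv g u) has_field_derivative \<alpha> * deriv (deriv g) u) (at u)"
      using field_differentiable_derivI by (auto intro!: derivative_eq_intros)
    then have "(deriv dev has_field_derivative \<alpha> * deriv (deriv g) u) (at u)"
      by (rule has_field_derivative_transform_within_open[OF _ opn u]) (auto simp: D1)
    then show ?thesis by (rule DERIV_imp_deriv)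
  qed
  show ?thesis by (rule that[OF ab(1) D1 D2 ab(3)])
qed

lemma N_exterior:
  assumes u: "u \<in> \<phi> ` (- Sq)" shows "N u = deriv (deriv g) u / deriv g u"
proof (cases "u \<in> \<Omega>")
  case True
  then have "g u \<in> cross - Sq" using u by (auto simp: \<Omega>_def)
  then obtain d where d: "d \<in> {1, -1, \<i>, - \<i>}" "u \<in> \<phi> ` arm d"
    unfolding cross_minus_Sq mem_image_\<phi> by blast
  from deriv_dev_arm[OF d(1)] d(2) show ?thesis
    using True by (metis N_def mult_divide_mult_cancel_left)
qed (simp add: N_def)

lemma not_corner: "- corners = cross \<union> - Sq"
proof -
  have "z \<in> corners" if "z \<in> Sq" "z \<notin> cross" for z
  proof -
    have "Re z = 1 \<or> Re z = -1" "Im z = 1 \<or> Im z = -1"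
      using that by (auto simp: Sq_def cross_def)
    then show ?thesis by (auto simp: corners_def complex_eq_iff)
  qed
  moreover have "z \<notin> cross" "z \<in> Sq" if "z \<in> corners" for z
    using that by (auto simp: corners_def cross_def Sq_def)
  ultimately show ?thesis by blast
qed

lemma N_domain: "- \<phi> ` corners = \<Omega> \<union> \<phi> ` (- Sq)"
proof (rule set_eqI)
  fix u
  have "u \<in> - \<phi> ` corners \<longleftrightarrow> g u \<in> - corners" by (simp add: mem_image_\<phi>)
  also have "\<dots> \<longleftrightarrow> u \<in> \<Omega> \<union> \<phi> ` (- Sq)" unfolding not_corner by (simp add: \<Omega>_def mem_image_\<phi>)
  finally show "u \<in> - \<phi> ` corners \<longleftrightarrow> u \<in> \<Omega> \<union> \<phi> ` (- Sq)" .
qed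

lemma N_holomorphic: "N holomorphic_on - \<phi> ` corners"
  unfolding N_domain
proof (rule holomorphic_on_Un[OF _ _ open_\<Omega> open_exterior])
  have "(\<lambda>u. deriv (deriv dev) u / deriv dev u) holomorphic_on \<Omega>"
    by (intro holomorphic_intros holomorphic_deriv dev_holomorphic open_\<Omega> deriv_dev_nonzero)
  then show "N holomorphic_on \<Omega>" by (rule holomorphic_transform) (simp add: N_def)
  have "(\<lambda>u. deriv (deriv g) u / deriv g u) holomorphic_on \<phi> ` (- Sq)"
    by (intro holomorphic_intros holomorphic_deriv g_holomorphic open_exterior deriv_g_nonzero)
  then show "N holomorphic_on \<phi> ` (- Sq)" by (rule holomorphic_transform) (simp add: N_exterior)
qed

text \<open>For an odd function that is real on the real axis the first derivative is even and the second one odd.\<close>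

lemma log_deriv_symmetries:
  assumes f: "f holomorphic_on S" and S: "open S" "u \<in> S"
    and sym: "\<And>u. u \<in> S \<Longrightarrow> - u \<in> S" "\<And>u. u \<in> S \<Longrightarrow> cnj u \<in> S"
    and odd: "\<And>u. f (- u) = - f u" and real: "\<And>u. f (cnj u) = cnj (f u)"
  shows "deriv (deriv f) (- u) / deriv f (- u) = - (deriv (deriv f) u / deriv f u)"
    and "deriv (deriv f) (cnj u) / deriv f (cnj u) = cnj (deriv (deriv f) u / deriv f u)"
proof -
  have d: "f field_differentiable (at w)" "deriv f field_differentiable (at w)" if "w \<in> S" for w
    using that f S holomorphic_deriv[OF f S(1)] by (metis holomorphic_on_imp_differentiable_at)+
  have 1: "deriv f (- w) = deriv f w" "deriv f (cnj w) = cnj (deriv f w)" if "w \<in> S" for w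
    using deriv_odd[OF odd d(1)[OF that]] deriv_real[OF S(1) real d(1)[OF that] that sym(2)] by auto
  have "deriv (deriv f) (- u) = - deriv (deriv f) u"
    by (rule deriv_even[OF S(1) _ d(2)[OF S(2)] S(2) sym(1)]) (use 1 in auto)
  moreover have "deriv (deriv f) (cnj u) = cnj (deriv (deriv f) u)"
    by (rule deriv_real[OF S(1) _ d(2)[OF S(2)] S(2) sym(2)]) (use 1 in auto)
  ultimately show "deriv (deriv f) (- u) / deriv f (- u) = - (deriv (deriv f) u / deriv f u)"
     "deriv (deriv f) (cnj u) / deriv f (cnj u) = cnj (deriv (deriv f) u / deriv f u)"
    using 1[OF S(2)] by auto
qed

lemma dev_minus: "dev (- u) = - dev u" and dev_cnj: "dev (cnj u) = cnj (dev u)"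
  by (simp_all add: dev_def g_minus g_cnj develop_minus develop_cnj)

lemma N_symmetries:
  assumes "u \<notin> \<phi> ` corners" shows "N (- u) = - N u" "N (cnj u) = cnj (N u)"
proof -
  have \<Omega>_sym: "- u \<in> \<Omega> \<longleftrightarrow> u \<in> \<Omega>" "cnj u \<in> \<Omega> \<longleftrightarrow> u \<in> \<Omega>" for u
    by (simp_all add: \<Omega>_def mem_image_\<phi> g_minus g_cnj cross_def)
  have E_sym: "- u \<in> \<phi> ` (- Sq) \<longleftrightarrow> u \<in> \<phi> ` (- Sq)" "cnj u \<in> \<phi> ` (- Sq) \<longleftrightarrow> u \<in> \<phi> ` (- Sq)" for u
    by (auto simp: mem_image_\<phi> g_minus g_cnj Sq_def)
  show "N (- u) = - N u" "N (cnj u) = cnj (N u)"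
    using log_deriv_symmetries[OF dev_holomorphic open_\<Omega>, of u]
      log_deriv_symmetries[OF g_holomorphic open_exterior, of u] assms N_domain N_exterior
    by (auto simp: N_def \<Omega>_sym E_sym dev_minus dev_cnj g_minus g_cnj)
qed

lemma exterior_near_infinity:
  obtains R where "{u. R < norm u} \<subseteq> \<phi> ` (- Sq)"
proof -
  have "Sq = cbox (Complex (-1) (-1)) (Complex 1 1)"
    by (auto simp: Sq_def in_cbox_complex_iff)
  then have "compact Sq" by (metis compact_cbox)
  then have "compact (\<phi> ` Sq)"
    by (intro compact_continuous_image continuous_\<phi>)
  then obtain M where "\<And>u. u \<in> \<phi> ` Sq \<Longrightarrow> norm u \<le> M"
    by (meson bounded_iff compact_imp_bounded)
  then have "{u. M < norm u} \<subseteq> \<phi> ` (- Sq)" by (force simp: mem_image_\<phi>)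
  then show ?thesis by (rule that)
qed

lemma g_at_infinity: "((\<lambda>u. g u - u) \<longlongrightarrow> 0) at_infinity"
proof -
  have "((\<lambda>u. \<phi> (g u) - g u) \<longlongrightarrow> 0) at_infinity"
    by (rule filterlim_compose[OF asym homeomorphism_inverse_at_infinity[OF hom]])
  from tendsto_minus[OF this] show ?thesis by simp
qed

lemma deriv_g_at_infinity: "(deriv g \<longlongrightarrow> 1) at_infinity"
  and deriv2_g_at_infinity: "(deriv (deriv g) \<longlongrightarrow> 0) at_infinity"
proof -
  obtain R where R: "{u. R < norm u} \<subseteq> \<phi> ` (- Sq)" using exterior_near_infinity .
  have opn: "open {u :: complex. R < norm u}" by (intro open_Collect_less continuous_intros)
  define f where "f = (\<lambda>u. g u - u)"
  have g: "g holomorphic_on {u. R < norm u}" by (rule holomorphic_on_subset[OF g_holomorphic R])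
  have f: "f holomorphic_on {u. R < norm u}" unfolding f_def by (intro holomorphic_intros g)
  have f1: "deriv f u = deriv g u - 1" if "u \<in> {u. R < norm u}" for u
    using holomorphic_on_imp_differentiable_at[OF g opn that] unfolding f_def by (subst deriv_diff) auto
  have f2: "deriv (deriv f) u = deriv (deriv g) u" if u: "u \<in> {u. R < norm u}" for u
  proof -
    have "deriv (deriv f) u = deriv (\<lambda>u. deriv g u - 1) u"
      by (rule complex_derivative_transform_within_open[OF holomorphic_deriv[OF f opn] _ opn u])
        (auto intro!: holomorphic_intros holomorphic_deriv g opn f1)
    also have "\<dots> = deriv (deriv g) u"
      using holomorphic_on_imp_differentiable_at[OF holomorphic_deriv[OF g opn] opn u] by (subst deriv_diff) auto
    finally show ?thesis .
  qed
  have lim1: "(deriv f \<longlongrightarrow> 0) at_infinity"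
    by (rule deriv_tendsto_0_at_infinity[OF f]) (use g_at_infinity in \<open>simp add: f_def\<close>)
  have lim2: "(deriv (deriv f) \<longlongrightarrow> 0) at_infinity"
    by (rule deriv_tendsto_0_at_infinity[OF holomorphic_deriv[OF f opn] lim1])
  have ev: "\<forall>\<^sub>F u :: complex in at_infinity. R < norm u"
    unfolding eventually_at_infinity by (auto intro!: exI[of _ "R + 1"])
  have "((\<lambda>u. deriv g u - 1) \<longlongrightarrow> 0) at_infinity"
    by (rule Lim_transform_eventually[OF lim1]) (use ev f1 in \<open>auto elim: eventually_mono\<close>)
  moreover have "(deriv (deriv g) \<longlongrightarrow> 0) at_infinity"
    by (rule Lim_transform_eventually[OF lim2]) (use ev f2 in \<open>auto elim: eventually_mono\<close>)
  ultimately have "((\<lambda>u. deriv g u - 1) \<longlongrightarrow> 0) at_infinity" "(deriv (deriv g) \<longlongrightarrow> 0) at_infinity" .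
  then show "(deriv g \<longlongrightarrow> 1) at_infinity" "(deriv (deriv g) \<longlongrightarrow> 0) at_infinity"
    by (auto simp: LIM_zero_iff)
qed

lemma N_at_infinity: "(N \<longlongrightarrow> 0) at_infinity"
proof -
  obtain R where R: "{u. R < norm u} \<subseteq> \<phi> ` (- Sq)" using exterior_near_infinity .
  have "((\<lambda>u. deriv (deriv g) u / deriv g u) \<longlongrightarrow> 0 / 1) at_infinity"
    by (intro tendsto_divide deriv_g_at_infinity deriv2_g_at_infinity) simp
  moreover have "\<forall>\<^sub>F u in at_infinity. deriv (deriv g) u / deriv g u = N u"
    unfolding eventually_at_infinity
  proof (intro exI allI impI)
    fix u :: complex assume "R + 1 \<le> norm u"
    then have "u \<in> \<phi> ` (- Sq)" using R by auto
    then show "deriv (deriv g) u / deriv g u = N u" by (simp add: N_exterior)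
  qed
  ultimately show ?thesis by (simp add: Lim_transform_eventually)
qed

end

section \<open>A chart at the corner of the square\<close>

text \<open>The exponent that makes the corner chart single-valued: once around the corner the logarithm of the
  developing map grows by \<open>2 \<pi> \<i> - ln K\<close>, and the exponent turns this into \<open>2 \<pi> \<i>\<close>.\<close>

definition corner_expo :: "real \<Rightarrow> complex" where
  "corner_expo K = 2 * of_real pi * \<i> / (2 * of_real pi * \<i> - of_real (ln K))"

text \<open>The square as seen from its corner \<open>1 + \<i>\<close>.\<close>

definition quadrant3 :: "complex set" where
  "quadrant3 = {w. Re w \<le> 0 \<and> Im w \<le> 0}"

text \<open>Logarithm of the squeezed square, with imaginary part between \<open>\<pi>\<close> and \<open>3 \<pi> / 2\<close>; \<open>outer_log\<close> is the logarithm on the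
  three remaining quadrants, with imaginary part between \<open>- \<pi> / 2\<close> and \<open>\<pi>\<close>. The factor \<open>1 - \<i>\<close> turns the branch cut of
  \<open>Ln\<close> into the diagonal of the excluded quadrant.\<close>

definition inner_log :: "real \<Rightarrow> complex \<Rightarrow> complex" where
  "inner_log K w = Ln (- vstretch (1 / K) w) + \<i> * of_real pi"

definition outer_log :: "complex \<Rightarrow> complex" where
  "outer_log w = Ln ((1 - \<i>) * w) - Ln (1 - \<i>)"

definition corner_log :: "real \<Rightarrow> complex \<Rightarrow> complex" where
  "corner_log K w = (if w \<in> quadrant3 then inner_log K w else outer_log w)"

definition corner_chart :: "real \<Rightarrow> complex \<Rightarrow> complex" where
  "corner_chart K w = (if w = 0 then 0 else exp (corner_expo K * corner_log K w))"

context
  fixes K :: real assumes K: "1 < K"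
begin

lemma one_minus_i: "(1 - \<i>) \<noteq> 0" by (simp add: complex_eq_iff)

lemma Im_Ln_one_minus_i: "- pi / 2 < Im (Ln (1 - \<i>))" "Im (Ln (1 - \<i>)) < 0"
  using Re_Ln_pos_lt[OF one_minus_i] Im_Ln_pos_lt[OF one_minus_i] Im_Ln_pos_le[OF one_minus_i] 
    Im_Ln_eq_0[OF one_minus_i] by auto

lemma exp_inner_log: "w \<noteq> 0 \<Longrightarrow> exp (inner_log K w) = vstretch (1 / K) w"
  using K by (auto simp: inner_log_def exp_add complex_eq_iff)

lemma exp_outer_log: "w \<noteq> 0 \<Longrightarrow> exp (outer_log w) = w"
  using one_minus_i by (simp add: outer_log_def exp_diff)

lemma Im_inner_log:
  assumes "w \<in> quadrant3" "w \<noteq> 0" shows "pi \<le> Im (inner_log K w)" "Im (inner_log K w) \<le> 3 * pi / 2"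
proof -
  define v where "v = - vstretch (1 / K) w"
  have v: "v \<noteq> 0" "0 \<le> Re v" "0 \<le> Im v"
    using assms K by (auto simp: v_def quadrant3_def complex_eq_iff divide_le_0_iff)
  then show "pi \<le> Im (inner_log K w)" "Im (inner_log K w) \<le> 3 * pi / 2"
    using Im_Ln_pos_le[OF v(1)] Re_Ln_pos_le[OF v(1)] by (auto simp: inner_log_def v_def[symmetric])
qed

lemma sin_cos_neg:
  assumes "- pi \<le> y \<and> y \<le> - pi / 2 \<or> pi \<le> y \<and> y \<le> 3 * pi / 2"
  shows "sin y \<le> 0" "cos y \<le> 0"
proof -
  have *: "sin x \<le> 0 \<and> cos x \<le> 0" if "pi \<le> x" "x \<le> 3 * pi / 2" for x
  proof -
    have "0 \<le> sin (x - pi)" "0 \<le> cos (x - pi)"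
      using that by (intro sin_ge_zero cos_ge_zero; simp)+
    then show ?thesis by simp
  qed
  show "sin y \<le> 0" "cos y \<le> 0"
    using assms *[of y] *[of "y + 2 * pi"] by auto
qed

lemma Im_outer_log:
  assumes w: "w \<notin> quadrant3" shows "- pi / 2 < Im (outer_log w)" "Im (outer_log w) < pi"
proof -
  have w0: "w \<noteq> 0" using w by (auto simp: quadrant3_def)
  have b: "- pi < Im (outer_log w)" "Im (outer_log w) < 3 * pi / 2"
    using mpi_less_Im_Ln[of "(1 - \<i>) * w"] Im_Ln_le_pi[of "(1 - \<i>) * w"] w0 one_minus_i Im_Ln_one_minus_i
    by (auto simp: outer_log_def)
  have "w = exp (outer_log w)" using exp_outer_log[OF w0] by simp
  then have "Re w = exp (Re (outer_log w)) * cos (Im (outer_log w))"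
    "Im w = exp (Re (outer_log w)) * sin (Im (outer_log w))"
    by (metis Re_exp, metis Im_exp)
  then have "\<not> (sin (Im (outer_log w)) \<le> 0 \<and> cos (Im (outer_log w)) \<le> 0)"
    using w by (auto simp: quadrant3_def mult_le_0_iff)
  then show "- pi / 2 < Im (outer_log w)" "Im (outer_log w) < pi"
    using sin_cos_neg[of "Im (outer_log w)"] b by force+
qed

lemma Im_corner_log:
  assumes "w \<noteq> 0"
  shows "- pi / 2 < Im (corner_log K w)" "Im (corner_log K w) \<le> 3 * pi / 2"
    "w \<in> quadrant3 \<longleftrightarrow> pi \<le> Im (corner_log K w)"
  using Im_inner_log[OF _ assms] Im_outer_log[of w] pi_gt_zero
  unfolding corner_log_def atomize_conj by (cases "w \<in> quadrant3"; simp; linarith)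

lemma corner_expo_period: "corner_expo K * (2 * of_real pi * \<i> - of_real (ln K)) = 2 * of_real pi * \<i>"
  and corner_expo_nonzero: "corner_expo K \<noteq> 0"
  and corner_expo_Re: "0 < Re (corner_expo K)"
  and corner_expo_inverse: "1 / corner_expo K - 1 = - (of_real (ln K) / (2 * \<i> * of_real pi))"
proof -
  have nz: "2 * of_real pi * \<i> - of_real (ln K) \<noteq> (0 :: complex)" by (simp add: complex_eq_iff)
  then show "corner_expo K * (2 * of_real pi * \<i> - of_real (ln K)) = 2 * of_real pi * \<i>"
    by (simp add: corner_expo_def)
  show "corner_expo K \<noteq> 0" using nz by (simp add: corner_expo_def)
  show "0 < Re (corner_expo K)"
    using K by (simp add: corner_expo_def Re_divide power2_eq_square add_nonneg_pos)
  show "1 / corner_expo K - 1 = - (of_real (ln K) / (2 * \<i> * of_real pi))"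
    using nz by (simp add: corner_expo_def field_simps)
qed

text \<open>Two points with the same image have logarithms that differ by a multiple of \<open>2 \<pi> \<i> - ln K\<close>. The imaginary parts
  of \<open>corner_log\<close> lie in a half-open interval of length \<open>2 \<pi>\<close>, so the multiple is 0.\<close>

lemma inj_corner_chart: "inj (corner_chart K)"
proof (rule injI)
  fix w w' assume eq: "corner_chart K w = corner_chart K w'"
  show "w = w'"
  proof (cases "w = 0 \<or> w' = 0")
    case True
    then show ?thesis using eq by (auto simp: corner_chart_def split: if_splits)
  next
    case False
    define D where "D = corner_log K w - corner_log K w'"
    have "exp (corner_expo K * corner_log K w) = exp (corner_expo K * corner_log K w')"
      using eq False by (simp add: corner_chart_def)
    then obtain n :: int where "corner_expo K * corner_log K w = corner_expo K * corner_log K w' + of_int (2 * n) * of_real pi * \<i>"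
      unfolding exp_eq by (auto simp: mult_ac)
    then have "corner_expo K * D = of_int n * (corner_expo K * (2 * of_real pi * \<i> - of_real (ln K)))"
      unfolding corner_expo_period by (simp add: D_def algebra_simps)
    then have D: "D = of_int n * (2 * of_real pi * \<i> - of_real (ln K))"
      using corner_expo_nonzero by (simp add: mult.left_commute)
    have "\<bar>Im D\<bar> < 2 * pi" using Im_corner_log[of w] Im_corner_log[of w'] False by (simp add: D_def)
    moreover have "Im D = 2 * pi * of_int n" by (simp add: D)
    ultimately have "\<bar>real_of_int n\<bar> < 1" by (simp add: abs_mult)
    then have "n = 0" by linarith
    then have logs: "corner_log K w = corner_log K w'" using D by (simp add: D_def)
    then have "w \<in> quadrant3 \<longleftrightarrow> w' \<in> quadrant3" using Im_corner_log(3) False by metis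
    then have "vstretch (1 / K) w = vstretch (1 / K) w' \<or> w = w'"
      using logs False exp_inner_log exp_outer_log by (metis corner_log_def)
    then show ?thesis using K by (auto simp: complex_eq_iff)
  qed
qed

lemma outer_log_holomorphic: "outer_log holomorphic_on {w. 0 < Re w \<or> 0 < Im w \<or> Re w \<noteq> Im w}"
proof -
  have "(1 - \<i>) * w \<notin> \<real>\<^sub>\<le>\<^sub>0" if "0 < Re w \<or> 0 < Im w \<or> Re w \<noteq> Im w" for w
    using that by (auto simp: complex_nonpos_Reals_iff)
  then show ?thesis
    unfolding outer_log_def[abs_def] by (auto intro!: holomorphic_intros)
qed

text \<open>On the upper edge the two logarithms agree. On the right edge they differ by exactly \<open>2 \<pi> \<i> - ln K\<close>, because squeezing
  divides that edge by \<open>K\<close>; this difference is invisible after multiplication by \<open>corner_expo K\<close> and exponentiation. At the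
  corner itself the positive real part of the exponent forces the limit 0.\<close>

lemma continuous_corner_chart: "continuous_on UNIV (corner_chart K)"
proof -
  \<comment> \<open>near the corner the modulus is at most a constant times a positive power of the distance\<close>
  have zero: "isCont (corner_chart K) 0"
  proof -
    define k where "k = corner_expo K"
    have bound: "norm (corner_chart K w) \<le> exp (Re k * ln (norm w) + \<bar>Im k\<bar> * (2 * pi))" if w: "w \<noteq> 0" for w
    proof -
      have im: "\<bar>Im (corner_log K w)\<bar> \<le> 2 * pi" using Im_corner_log[OF w] pi_gt_zero by linarith
      have "norm (vstretch (1 / K) w) \<le> norm w"
      proof -
        have "\<bar>Im w / K\<bar> \<le> \<bar>Im w\<bar>" using K by (simp add: divide_le_eq mult_le_cancel_left1)
        then have "(Im w / K)\<^sup>2 \<le> (Im w)\<^sup>2" by (rule abs_le_square_iff[THEN iffD1])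
        then show ?thesis by (simp add: cmod_def)
      qed
      then have "norm (exp (corner_log K w)) \<le> norm w"
        using exp_inner_log[OF w] exp_outer_log[OF w] by (simp add: corner_log_def del: norm_exp_eq_Re)
      then have "exp (Re (corner_log K w)) \<le> exp (ln (norm w))" using w by (simp add: norm_exp_eq_Re)
      then have re: "Re (corner_log K w) \<le> ln (norm w)" by simp
      have "Re (k * corner_log K w) \<le> Re k * ln (norm w) + \<bar>Im k\<bar> * (2 * pi)"
      proof -
        have "Re k * Re (corner_log K w) \<le> Re k * ln (norm w)"
          using re corner_expo_Re by (simp add: k_def)
        moreover have "- (Im k * Im (corner_log K w)) \<le> \<bar>Im k\<bar> * (2 * pi)"
          using mult_left_mono[OF im, of "\<bar>Im k\<bar>"] by (simp add: abs_mult[symmetric]) 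
        ultimately show ?thesis by simp
      qed
      then show ?thesis using w by (simp add: corner_chart_def norm_exp_eq_Re k_def)
    qed
    have "filterlim (\<lambda>w :: complex. norm w) (at_right 0) (at 0)"
      by (auto simp: filterlim_at eventually_at_filter intro!: tendsto_eq_intros)
    then have "filterlim (\<lambda>w :: complex. ln (norm w)) at_bot (at 0)"
      by (rule filterlim_compose[OF ln_at_0])
    then have "filterlim (\<lambda>w :: complex. Re k * ln (norm w) + \<bar>Im k\<bar> * (2 * pi)) at_bot (at 0)"
      using corner_expo_Re unfolding k_def[symmetric] add.commute[of "Re k * _"]
      by (intro filterlim_tendsto_add_at_bot_iff[OF tendsto_const, THEN iffD2]
          filterlim_tendsto_pos_mult_at_bot[OF tendsto_const])
    then have "((\<lambda>w :: complex. exp (Re k * ln (norm w) + \<bar>Im k\<bar> * (2 * pi))) \<longlongrightarrow> 0) (at 0)"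
      by (rule filterlim_compose[OF exp_at_bot])
    then have "(corner_chart K \<longlongrightarrow> 0) (at 0)"
      by (rule Lim_null_comparison[rotated]) (use bound in \<open>auto simp: eventually_at_filter\<close>)
    then show ?thesis by (simp add: isCont_def corner_chart_def)
  qed
  \<comment> \<open>the two formulas on the common edges of the quadrants\<close>
  have agree: "exp (corner_expo K * inner_log K w) = exp (corner_expo K * outer_log w)"
    if w: "w \<noteq> 0" "w \<in> quadrant3" "Re w = 0 \<or> Im w = 0" for w
  proof -
    define D where "D = inner_log K w - outer_log w"
    have "(1 - \<i>) * w \<noteq> 0" using w one_minus_i by simp
    note im = Im_inner_log[OF w(2,1)] Im_Ln_one_minus_i Re_Ln_pos_lt[OF this] Re_Ln_pos_le[OF this] 
       Im_Ln_pos_lt[OF this] Im_Ln_pos_le[OF this] Im_Ln_le_pi[OF this] mpi_less_Im_Ln[OF this]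
    have expD: "exp D = vstretch (1 / K) w / w"
      using w by (simp add: D_def exp_diff exp_inner_log exp_outer_log)
    show ?thesis
    proof (cases "Im w = 0")
      case True
      then have neg: "Re w < 0" using w by (auto simp: quadrant3_def complex_eq_iff less_le)
      have "vstretch (1 / K) w = w" using True by (simp add: complex_eq_iff)
      then have "exp D = 1" using w(1) expD by simp
      then obtain n :: int where "Re D = 0" "Im D = of_int (2 * n) * pi"
        unfolding exp_eq_1 by blast
      then have n: "D = of_int (2 * n) * of_real pi * \<i>" by (simp add: complex_eq_iff)
      then have "Im D = 2 * pi * of_int n" by simp
      moreover have "Im (Ln ((1 - \<i>) * w)) \<ge> pi / 2" "Im (Ln ((1 - \<i>) * w)) \<le> pi"
        using im True neg by (auto simp: abs_if split: if_splits)
      \<comment> \<open>the upper edge: the imaginary parts are too close for a nonzero multiple of the period\<close>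
      then have "\<bar>Im D\<bar> < 2 * pi"
        using im by (auto simp: D_def outer_log_def)
      ultimately have "\<bar>real_of_int n\<bar> < 1" by (simp add: abs_mult)
      then have "n = 0" by linarith
      then have "D = 0" using n by simp
      then show ?thesis by (simp add: D_def)
    next
      case False
      then have Im: "Re w = 0" "Im w < 0" using w by (auto simp: quadrant3_def)
      then have "vstretch (1 / K) w = of_real (1 / K) * w" by (simp add: complex_eq_iff)
      then have "exp D = of_real (1 / K)" using w expD by simp
      also have "\<dots> = exp (- of_real (ln K))" using K by (simp add: exp_minus exp_of_real inverse_eq_divide)
      finally obtain n :: int where n: "D = - of_real (ln K) + of_int (2 * n) * of_real pi * \<i>"
        unfolding exp_eq by auto
      then have "Im D = 2 * pi * of_int n" by simp
      moreover have "Im (Ln ((1 - \<i>) * w)) \<le> - pi / 2"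
        using im Im by (auto simp: abs_if split: if_splits)
      \<comment> \<open>the right edge: exactly one period apart\<close>
      then have "0 < Im D" "Im D < 2 * pi * 2"
        using im Im by (auto simp: D_def outer_log_def)
      ultimately have "0 < real_of_int n" "real_of_int n < 2" by (auto simp: zero_less_mult_iff)
      then have "n = 1" by linarith
      then have "corner_expo K * D = corner_expo K * (2 * of_real pi * \<i> - of_real (ln K))" using n by simp
      then have "corner_expo K * inner_log K w = corner_expo K * outer_log w + 2 * of_real pi * \<i>"
        unfolding corner_expo_period by (simp add: D_def algebra_simps)
      then show ?thesis by (simp add: exp_add)
    qed
  qed
  have "continuous_on ((quadrant3 - {0}) \<union> ({w. 0 \<le> Re w \<or> 0 \<le> Im w} - {0})) (\<lambda>w. if w \<in> quadrant3 then exp (corner_expo K * inner_log K w)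
      else exp (corner_expo K * outer_log w))" (is "continuous_on (?Q \<union> ?P) ?f")
  proof (rule continuous_on_cases_local)
    have cl: "closed quadrant3" "closed {w. 0 \<le> Re w \<or> 0 \<le> Im w}"
      unfolding quadrant3_def
      by (intro closed_Collect_conj closed_Collect_disj closed_Collect_le continuous_intros)+
    have PQ: "?Q \<union> ?P = - {0}" by (auto simp: quadrant3_def)
    show "closedin (top_of_set (?Q \<union> ?P)) ?Q" "closedin (top_of_set (?Q \<union> ?P)) ?P"
      unfolding PQ closedin_closed using cl by blast+
    have "- vstretch (1 / K) w \<notin> \<real>\<^sub>\<le>\<^sub>0" if "w \<in> ?Q" for w
      using that K by (auto simp: complex_nonpos_Reals_iff quadrant3_def complex_eq_iff)
    then show "continuous_on ?Q (\<lambda>w. exp (corner_expo K * inner_log K w))"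
      unfolding inner_log_def by (intro continuous_intros) auto
    have "continuous_on ?P outer_log"
      by (rule continuous_on_subset[OF holomorphic_on_imp_continuous_on[OF outer_log_holomorphic]])
        (auto simp: complex_eq_iff)
    then show "continuous_on ?P (\<lambda>w. exp (corner_expo K * outer_log w))"
      by (intro continuous_intros)
    show "exp (corner_expo K * inner_log K w) = exp (corner_expo K * outer_log w)"
      if "w \<in> ?Q \<and> w \<notin> quadrant3 \<or> w \<in> ?P \<and> w \<in> quadrant3" for w
      using agree[of w] that by (auto simp: quadrant3_def)
  qed
  moreover have "?Q \<union> ?P = - {0}" by (auto simp: quadrant3_def)
  ultimately have "continuous_on (- {0}) ?f" by simp
  then have "continuous_on (- {0}) (corner_chart K)"
    by (rule continuous_on_eq) (auto simp: corner_chart_def corner_log_def)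
  then have "isCont (corner_chart K) w" if "w \<noteq> 0" for w
    using that by (simp add: continuous_on_eq_continuous_at open_Compl)
  with zero show ?thesis by (metis continuous_at_imp_continuous_on)
qed

end

section \<open>The nonlinearity as a rational function\<close>

context sq_straightening
begin

definition corner_nbhd :: "complex set" where
  "corner_nbhd = ball (Complex 1 1) 1"

text \<open>The corner chart, read as a function of the image point. It is holomorphic and injective near \<open>z1\<close>, which it maps to 0.\<close>

definition "Z u = corner_chart K (g u - Complex 1 1)"

definition a :: complex where "a = of_real (ln K) / (2 * \<i> * of_real pi)"

lemma corner_nbhd_bounds:
  assumes "z \<in> corner_nbhd" shows "0 < Re z" "0 < Im z"
  using assms abs_Re_le_cmod[of "Complex 1 1 - z"] abs_Im_le_cmod[of "Complex 1 1 - z"]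
  by (auto simp: corner_nbhd_def dist_norm abs_le_iff simp del: abs_Re_le_cmod)

lemma open_corner_nbhd: "open corner_nbhd" by (simp add: corner_nbhd_def)

lemma corner_nbhd_Sq: "z \<in> corner_nbhd \<Longrightarrow> z \<in> Sq \<longleftrightarrow> z - Complex 1 1 \<in> quadrant3"
  using corner_nbhd_bounds[of z] by (auto simp: Sq_def quadrant3_def)

lemma inner_chart:
  assumes "z \<in> open_Sq"
  shows "corner_chart K (z - Complex 1 1) = exp (corner_expo K * (Ln (vstretch (1 / K) (Complex 1 1) - vstretch (1 / K) z) + \<i> * of_real pi))"
    and "vstretch (1 / K) (Complex 1 1) - vstretch (1 / K) z \<notin> \<real>\<^sub>\<le>\<^sub>0"
proof -
  have "z - Complex 1 1 \<in> quadrant3" "z - Complex 1 1 \<noteq> 0"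
    using assms by (auto simp: open_Sq_def quadrant3_def complex_eq_iff)
  moreover have "- vstretch (1 / K) (z - Complex 1 1) = vstretch (1 / K) (Complex 1 1) - vstretch (1 / K) z"
    by (simp add: complex_eq_iff diff_divide_distrib)
  ultimately show "corner_chart K (z - Complex 1 1) = exp (corner_expo K * (Ln (vstretch (1 / K) (Complex 1 1) - vstretch (1 / K) z) + \<i> * of_real pi))"
    by (simp add: corner_chart_def corner_log_def inner_log_def)
  show "vstretch (1 / K) (Complex 1 1) - vstretch (1 / K) z \<notin> \<real>\<^sub>\<le>\<^sub>0"
    using assms by (auto simp: complex_nonpos_Reals_iff open_Sq_def)
qed

lemma sq_conformal_corner_chart: "sq_conformal K corner_nbhd (\<lambda>z. corner_chart K (z - Complex 1 1))"
  unfolding sq_conformal_def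
proof (intro conjI)
  show "continuous_on corner_nbhd (\<lambda>z. corner_chart K (z - Complex 1 1))"
    by (rule continuous_on_compose2[OF continuous_corner_chart[OF K]]) (auto intro!: continuous_intros)
  have outer: "z - Complex 1 1 \<notin> quadrant3" if "z \<in> corner_nbhd - Sq" for z
    using corner_nbhd_Sq[of z] that by simp
  have "(\<lambda>z. outer_log (z - Complex 1 1)) holomorphic_on (corner_nbhd - Sq)"
  proof (rule holomorphic_on_compose_gen[OF _ outer_log_holomorphic[OF K], unfolded o_def])
    show "(\<lambda>z. z - Complex 1 1) ` (corner_nbhd - Sq) \<subseteq> {w. 0 < Re w \<or> 0 < Im w \<or> Re w \<noteq> Im w}"
    proof (rule image_subsetI)
      fix z assume "z \<in> corner_nbhd - Sq"
      from outer[OF this] show "z - Complex 1 1 \<in> {w. 0 < Re w \<or> 0 < Im w \<or> Re w \<noteq> Im w}"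
        unfolding quadrant3_def mem_Collect_eq by linarith
    qed
  qed (intro holomorphic_intros)
  then have "(\<lambda>z. exp (corner_expo K * outer_log (z - Complex 1 1))) holomorphic_on (corner_nbhd - Sq)"
    by (intro holomorphic_intros)
  then show "(\<lambda>z. corner_chart K (z - Complex 1 1)) holomorphic_on (corner_nbhd - Sq)"
  proof (rule holomorphic_transform)
    fix z assume "z \<in> corner_nbhd - Sq"
    from outer[OF this] show "exp (corner_expo K * outer_log (z - Complex 1 1)) = corner_chart K (z - Complex 1 1)"
      by (auto simp: corner_chart_def corner_log_def quadrant3_def)
  qed
  define c where "c = vstretch (1 / K) (Complex 1 1)"
  have "(\<lambda>w. exp (corner_expo K * (Ln (c - w) + \<i> * of_real pi))) holomorphic_on (vstretch K -` (corner_nbhd \<inter> open_Sq))"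
    using inner_chart(2) K_pos by (intro holomorphic_intros) (fastforce simp: c_def)
  then show "(\<lambda>z. corner_chart K (z - Complex 1 1)) \<circ> vstretch K holomorphic_on (vstretch K -` (corner_nbhd \<inter> open_Sq))"
    by (rule holomorphic_transform) (use inner_chart(1) K_pos in \<open>auto simp: c_def\<close>)
qed

abbreviation "W1 \<equiv> \<phi> ` corner_nbhd"

lemma open_W1: "open W1" by (intro open_image_\<phi> open_corner_nbhd)

lemma z1_in_W1: "z1 \<in> W1" by (auto simp: z1_def corner_nbhd_def)

lemma Z_holomorphic: "Z holomorphic_on W1"
  using holomorphic_on_comp_inverse[OF K_pos hom conf open_corner_nbhd sq_conformal_corner_chart]
  by (simp add: Z_def[abs_def] o_def)

lemma Z_eq_iff: "Z u = Z v \<longleftrightarrow> u = v"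
proof
  assume "Z u = Z v"
  then have "g u - Complex 1 1 = g v - Complex 1 1"
    unfolding Z_def by (rule injD[OF inj_corner_chart[OF K]])
  then show "u = v" by (metis \<phi>_g diff_add_cancel)
qed simp

lemma Z_z1: "Z z1 = 0" by (simp add: Z_def z1_def corner_chart_def)

lemma Z_nonzero: "u \<noteq> z1 \<Longrightarrow> Z u \<noteq> 0" using Z_eq_iff[of u z1] by (simp add: Z_z1)

lemma deriv_Z_nonzero: "u \<in> W1 \<Longrightarrow> deriv Z u \<noteq> 0"
  by (rule holomorphic_injective_imp_regular[OF Z_holomorphic open_W1]) (auto simp: inj_on_def Z_eq_iff)

text \<open>Inside the square \<open>Z\<close> is a constant multiple of a branch of \<open>c - dev\<close> to the power \<open>k\<close>, with \<open>c\<close> the image of the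
  corner. This gives \<open>k dev' Z = (dev - c) Z'\<close>. Differentiating once more expresses the nonlinearity by \<open>Z\<close>.\<close>

lemma N_inner_corner:
  assumes u: "u \<in> \<phi> ` (corner_nbhd \<inter> open_Sq)"
  shows "N u = - a * (deriv Z u / Z u) + deriv (deriv Z) u / deriv Z u"
proof -
  let ?I = "\<phi> ` (corner_nbhd \<inter> open_Sq)"
  define k where "k = corner_expo K"
  define c where "c = vstretch (1 / K) (Complex 1 1)"
  have opn: "open ?I" by (intro open_image_\<phi> open_Int open_corner_nbhd open_open_Sq)
  have I\<Omega>: "?I \<subseteq> \<Omega>" by (auto simp: \<Omega>_def cross_def open_Sq_def)
  have IW: "?I \<subseteq> W1" by auto
  have Zeq: "Z v = exp (k * (Ln (c - dev v) + \<i> * of_real pi))" and nonpos: "c - dev v \<notin> \<real>\<^sub>\<le>\<^sub>0" if "v \<in> ?I" for v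
  proof -
    have v: "g v \<in> open_Sq" "g v \<in> Sq" using that by (auto simp: open_Sq_def Sq_def)
    then have "dev v = vstretch (1 / K) (g v)" by (simp add: dev_def develop_Sq)
    then show "Z v = exp (k * (Ln (c - dev v) + \<i> * of_real pi))" "c - dev v \<notin> \<real>\<^sub>\<le>\<^sub>0"
      using inner_chart[OF v(1)] by (simp_all add: Z_def k_def c_def)
  qed
  have d: "(dev has_field_derivative deriv dev v) (at v)" "(deriv dev has_field_derivative deriv (deriv dev) v) (at v)"
    "(Z has_field_derivative deriv Z v) (at v)" "(deriv Z has_field_derivative deriv (deriv Z) v) (at v)" if "v \<in> ?I" for v
    using that I\<Omega> IW dev_holomorphic Z_holomorphic open_\<Omega> open_W1
      holomorphic_deriv[OF dev_holomorphic open_\<Omega>] holomorphic_deriv[OF Z_holomorphic open_W1]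
    by (meson holomorphic_derivI subsetD)+
  have rel: "k * deriv dev v * Z v = (dev v - c) * deriv Z v" if v: "v \<in> ?I" for v
  proof -
    have "((\<lambda>v. exp (k * (Ln (c - dev v) + \<i> * of_real pi))) has_field_derivative
        exp (k * (Ln (c - dev v) + \<i> * of_real pi)) * (k * (- deriv dev v / (c - dev v)))) (at v)"
      using nonpos[OF v] by (auto intro!: derivative_eq_intros d(1)[OF v] simp: divide_inverse mult_ac)
    then have "(Z has_field_derivative Z v * (k * (- deriv dev v / (c - dev v)))) (at v)"
      unfolding Zeq[OF v, symmetric]
      by (rule has_field_derivative_transform_within_open[OF _ opn v]) (simp add: Zeq)
    then have "deriv Z v = Z v * (k * (- deriv dev v / (c - dev v)))" by (rule DERIV_imp_deriv)
    moreover have "c - dev v \<noteq> 0" using nonpos[OF v] by auto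
    ultimately show ?thesis by (simp add: field_simps)
  qed
  have "((\<lambda>v. k * deriv dev v * Z v) has_field_derivative
      k * deriv (deriv dev) u * Z u + k * deriv dev u * deriv Z u) (at u)"
    using d[OF u] by (auto intro!: derivative_eq_intros)
  moreover have "((\<lambda>v. (dev v - c) * deriv Z v) has_field_derivative
      deriv dev u * deriv Z u + (dev u - c) * deriv (deriv Z) u) (at u)"
    using d[OF u] by (auto intro!: derivative_eq_intros)
  then have "((\<lambda>v. k * deriv dev v * Z v) has_field_derivative
      deriv dev u * deriv Z u + (dev u - c) * deriv (deriv Z) u) (at u)"
    by (rule has_field_derivative_transform_within_open[OF _ opn u]) (simp add: rel)
  ultimately have rel2: "k * deriv (deriv dev) u * Z u + k * deriv dev u * deriv Z u
      = deriv dev u * deriv Z u + (dev u - c) * deriv (deriv Z) u"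
    by (rule DERIV_unique)
  have k0: "k \<noteq> 0" using corner_expo_nonzero[OF K] by (simp add: k_def)
  have nz: "deriv dev u \<noteq> 0" "deriv Z u \<noteq> 0" "Z u \<noteq> 0"
    using u I\<Omega> IW deriv_dev_nonzero deriv_Z_nonzero Zeq[OF u] by auto
  have "dev u - c = k * deriv dev u * Z u / deriv Z u" using rel[OF u] nz by (simp add: field_simps)
  then have "k * deriv (deriv dev) u * Z u = (1 - k) * (deriv dev u * deriv Z u)
      + k * deriv dev u * Z u / deriv Z u * deriv (deriv Z) u"
    using rel2 by (simp add: algebra_simps)
  then have "deriv (deriv dev) u / deriv dev u = (1 / k - 1) * (deriv Z u / Z u) + deriv (deriv Z) u / deriv Z u"
    using k0 nz by (simp add: field_simps)
  moreover have "1 / k - 1 = - a" using corner_expo_inverse[OF K] by (simp add: k_def a_def)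
  ultimately show ?thesis using u I\<Omega> by (auto simp: N_def)
qed

text \<open>Both sides are holomorphic on the punctured neighbourhood, and they agree on the part inside the square.\<close>

lemma N_near_corner:
  assumes u: "u \<in> W1 - {z1}"
  shows "N u = - a * (deriv Z u / Z u) + deriv (deriv Z) u / deriv Z u"
proof (rule analytic_continuation_open[of "\<phi> ` (corner_nbhd \<inter> open_Sq)" "W1 - {z1}" N
      "\<lambda>u. - a * (deriv Z u / Z u) + deriv (deriv Z) u / deriv Z u"])
  show "open (\<phi> ` (corner_nbhd \<inter> open_Sq))" "open (W1 - {z1})"
    by (intro open_image_\<phi> open_Int open_corner_nbhd open_open_Sq open_Diff open_W1; simp)+
  have "Complex (1/2) (1/2) \<in> corner_nbhd \<inter> open_Sq"
    by (auto simp: corner_nbhd_def open_Sq_def dist_norm cmod_def power2_eq_square real_less_lsqrt)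
  then show "\<phi> ` (corner_nbhd \<inter> open_Sq) \<noteq> {}" by blast
  have "connected (corner_nbhd - {Complex 1 1})"
    unfolding corner_nbhd_def by (rule connected_punctured_ball) simp
  then have "connected (\<phi> ` (corner_nbhd - {Complex 1 1}))"
    by (rule connected_continuous_image[OF continuous_\<phi>])
  moreover have "\<phi> ` (corner_nbhd - {Complex 1 1}) = W1 - {z1}" by (auto simp: z1_def)
  ultimately show "connected (W1 - {z1})" by simp
  show "\<phi> ` (corner_nbhd \<inter> open_Sq) \<subseteq> W1 - {z1}" by (auto simp: z1_def open_Sq_def)
  have "z \<notin> corners" if "z \<in> corner_nbhd" "z \<noteq> Complex 1 1" for z
    using corner_nbhd_bounds[OF that(1)] that(2) by (auto simp: corners_def)
  then have "W1 - {z1} \<subseteq> - \<phi> ` corners" by (auto simp: z1_def)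
  then show "N holomorphic_on W1 - {z1}" by (rule holomorphic_on_subset[OF N_holomorphic])
  have sub: "Z holomorphic_on W1 - {z1}" "open (W1 - {z1})"
    using holomorphic_on_subset[OF Z_holomorphic] open_W1 by (auto simp: open_Diff)
  show "(\<lambda>u. - a * (deriv Z u / Z u) + deriv (deriv Z) u / deriv Z u) holomorphic_on W1 - {z1}"
    using Z_nonzero deriv_Z_nonzero by (intro holomorphic_intros holomorphic_deriv sub) auto
qed (use N_inner_corner u in auto)

text \<open>\<open>Z\<close> has a simple zero at \<open>z1\<close>, so \<open>Z' / Z\<close> has a simple pole with residue 1.\<close>

lemma N_residue:
  obtains l where "((\<lambda>u. N u + a / (u - z1)) \<longlongrightarrow> l) (at z1)"
proof -
  define h where "h = (\<lambda>u. if u = z1 then deriv Z z1 else (Z u - Z z1) / (u - z1))"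
  have h: "h holomorphic_on W1"
    unfolding h_def by (rule pole_lemma[OF Z_holomorphic]) (simp add: interior_open[OF open_W1] z1_in_W1)
  have Zh: "Z u = (u - z1) * h u" for u by (simp add: h_def Z_z1)
  have hnz: "h u \<noteq> 0" if "u \<in> W1" for u
    using that Z_nonzero[of u] deriv_Z_nonzero[OF z1_in_W1] by (auto simp: h_def Z_z1)
  define F where "F = (\<lambda>u. - a * (deriv h u / h u) + deriv (deriv Z) u / deriv Z u)"
  have "F holomorphic_on W1"
    unfolding F_def using hnz deriv_Z_nonzero
    by (intro holomorphic_intros holomorphic_deriv h Z_holomorphic open_W1) auto
  then have "isCont F z1"
    using open_W1 z1_in_W1 holomorphic_on_imp_continuous_on continuous_on_eq_continuous_at by blast
  then have "(F \<longlongrightarrow> F z1) (at z1)" by (simp add: isCont_def)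
  moreover have "\<forall>\<^sub>F u in at z1. F u = N u + a / (u - z1)"
    unfolding eventually_at_topological
  proof (intro exI[of _ W1] conjI ballI impI open_W1 z1_in_W1)
    fix u assume u: "u \<in> W1" "u \<noteq> z1"
    have "(Z has_field_derivative deriv Z u) (at u)"
      using Z_holomorphic open_W1 u by (meson holomorphic_derivI)
    moreover have "(Z has_field_derivative (u - z1) * deriv h u + h u) (at u)"
      unfolding Zh[abs_def] using h open_W1 u by (auto intro!: derivative_eq_intros holomorphic_derivI)
    ultimately have "deriv Z u = (u - z1) * deriv h u + h u" by (rule DERIV_unique)
    then have "deriv Z u / Z u = deriv h u / h u + 1 / (u - z1)"
      using hnz[OF u(1)] u(2) by (simp add: Zh field_simps)
    moreover have "N u = - a * (deriv Z u / Z u) + deriv (deriv Z) u / deriv Z u"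
      using N_near_corner u by simp
    ultimately show "F u = N u + a / (u - z1)"
      by (simp add: F_def algebra_simps)
  qed
  ultimately have "((\<lambda>u. N u + a / (u - z1)) \<longlongrightarrow> F z1) (at z1)"
    by (rule Lim_transform_eventually)
  then show ?thesis by (rule that)
qed

text \<open>The nonlinearity minus the principal parts that it should have.\<close>

definition H :: "complex \<Rightarrow> complex" where
  "H u = N u - a * (1 / (u + cnj z1) + 1 / (u - cnj z1) - 1 / (u - z1) - 1 / (u + z1))"

lemma corners_image: "\<phi> ` corners = {z1, - cnj z1, - z1, cnj z1}"
  by (simp add: corners_def \<phi>_corners z1_def[symmetric])

lemma corner_images_distinct: "z1 \<noteq> - cnj z1" "z1 \<noteq> - z1" "z1 \<noteq> cnj z1" "- cnj z1 \<noteq> - z1" "- cnj z1 \<noteq> cnj z1" "- z1 \<noteq> cnj z1"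
  using z1_quadrant by (auto simp: complex_eq_iff)

lemma H_symmetries:
  assumes "u \<notin> \<phi> ` corners" shows "H (- u) = - H u" "H (cnj u) = cnj (H u)"
proof -
  have eq: "1 / (- u + cnj z1) = - (1 / (u - cnj z1))" "1 / (- u - cnj z1) = - (1 / (u + cnj z1))"
    "1 / (- u - z1) = - (1 / (u + z1))" "1 / (- u + z1) = - (1 / (u - z1))"
    by (metis minus_diff_eq minus_divide_right uminus_add_conv_diff add_uminus_conv_diff minus_add_distrib diff_minus_eq_add)+
  show "H (- u) = - H u"
    using N_symmetries[OF assms] unfolding H_def eq by (simp add: algebra_simps)
  have "cnj a = - a" by (simp add: a_def)
  then show "H (cnj u) = cnj (H u)"
    using N_symmetries[OF assms] by (simp add: H_def algebra_simps)
qed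

lemma H_holomorphic: "H holomorphic_on - \<phi> ` corners"
  unfolding H_def[abs_def] by (intro holomorphic_intros N_holomorphic)
    (auto simp: corners_image eq_neg_iff_add_eq_0[symmetric])

text \<open>The limit at \<open>z1\<close> is known from the corner chart. The symmetries of \<open>H\<close> carry it to the three other points; conjugation
  reverses the sign of the residue because \<open>a\<close> is purely imaginary.\<close>

lemma H_limit:
  assumes "p \<in> \<phi> ` corners" obtains l where "(H \<longlongrightarrow> l) (at p)"
proof -
  obtain l0 where l0: "((\<lambda>u. N u + a / (u - z1)) \<longlongrightarrow> l0) (at z1)" using N_residue .
  define l where "l = l0 - a * (1 / (z1 + cnj z1) + 1 / (z1 - cnj z1) - 1 / (z1 + z1))"
  have "((\<lambda>u. (N u + a / (u - z1)) - a * (1 / (u + cnj z1) + 1 / (u - cnj z1) - 1 / (u + z1))) \<longlongrightarrow> l) (at z1)"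
    unfolding l_def using corner_images_distinct
    by (intro tendsto_intros l0) (simp_all only: eq_neg_iff_add_eq_0 eq_iff_diff_eq_0[of z1 "cnj z1"] not_False_eq_True)
  then have H1: "(H \<longlongrightarrow> l) (at z1)"
    by (simp add: H_def[abs_def] algebra_simps)
  \<comment> \<open>\<open>s\<close> moves the point, \<open>t\<close> the value; both are involutions\<close>
  have transfer: "(H \<longlongrightarrow> t l') (at (s q))"
    if lim: "(H \<longlongrightarrow> l') (at q)" and s: "isCont s (s q)" "\<And>u. s (s u) = u"
      and t: "isCont t l'" and sym: "\<And>u. u \<notin> \<phi> ` corners \<Longrightarrow> H (s u) = t (H u)"
      and tt: "\<And>z. t (t z) = z" and sc: "\<And>u. s u \<in> \<phi> ` corners \<longleftrightarrow> u \<in> \<phi> ` corners" for l' q s t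
  proof -
    have "filterlim s (at q) (at (s q))"
      unfolding filterlim_at
    proof
      show "\<forall>\<^sub>F u in at (s q). s u \<in> UNIV \<and> s u \<noteq> q"
        by (auto simp: eventually_at_filter s(2) intro!: always_eventually)
      show "(s \<longlongrightarrow> q) (at (s q))" using s(1) unfolding isCont_def s(2) .
    qed
    from filterlim_compose[OF lim this] have "((\<lambda>u. H (s u)) \<longlongrightarrow> l') (at (s q))" .
    from isCont_tendsto_compose[OF t this] have "((\<lambda>u. t (H (s u))) \<longlongrightarrow> t l') (at (s q))" .
    moreover have "\<forall>\<^sub>F u in at (s q). t (H (s u)) = H u"
    proof -
      have "\<forall>\<^sub>F u in at (s q). u \<notin> \<phi> ` corners"
      proof -
        have "open (- (\<phi> ` corners - {s q}))"
          by (intro open_Compl finite_imp_closed) (simp add: corners_def)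
        then show ?thesis unfolding eventually_at_topological by blast
      qed
      then show ?thesis by eventually_elim (metis sym tt)
    qed
    ultimately show ?thesis by (rule Lim_transform_eventually)
  qed
  have neg: "- u \<in> \<phi> ` corners \<longleftrightarrow> u \<in> \<phi> ` corners" and cn: "cnj u \<in> \<phi> ` corners \<longleftrightarrow> u \<in> \<phi> ` corners" for u
    unfolding corners_image by (auto simp: complex_eq_iff)
  have H3: "(H \<longlongrightarrow> - l) (at (- z1))"
    by (rule transfer[OF H1, where s=uminus and t=uminus]) (auto simp: H_symmetries neg)
  have H4: "(H \<longlongrightarrow> cnj l) (at (cnj z1))"
    by (rule transfer[OF H1, where s=cnj and t=cnj]) (auto simp: H_symmetries cn)
  have H2: "(H \<longlongrightarrow> - cnj l) (at (- cnj z1))"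
    by (rule transfer[OF H4, where s=uminus and t=uminus]) (auto simp: H_symmetries neg)
  show ?thesis using assms H1 H2 H3 H4 that unfolding corners_image by blast
qed

text \<open>After removal of its singularities \<open>H\<close> is entire and vanishes at infinity.\<close>

theorem N_eq:
  assumes u: "u \<notin> \<phi> ` corners"
  shows "N u = a * (1 / (u + cnj z1) + 1 / (u - cnj z1) - 1 / (u - z1) - 1 / (u + z1))"
proof -
  define H' where "H' = remove_sings H"
  have opn: "open (- \<phi> ` corners)"
    by (intro open_Compl finite_imp_closed) (simp add: corners_def)
  have eq: "H' v = H v" if "v \<notin> \<phi> ` corners" for v
    unfolding H'_def
    by (rule remove_sings_at_analytic) (use H_holomorphic opn that in \<open>auto simp: analytic_at\<close>)
  have "H' analytic_on {v}" for v
  proof -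
    have "isolated_singularity_at H v"
    proof -
      have "open (- (\<phi> ` corners - {v}))"
        by (intro open_Compl finite_imp_closed) (simp add: corners_def)
      then obtain r where "0 < r" "ball v r \<subseteq> - (\<phi> ` corners - {v})"
        by (metis Compl_iff Diff_iff insertI1 openE)
      then have "0 < r" "H holomorphic_on ball v r - {v}"
        by (auto intro: holomorphic_on_subset[OF H_holomorphic])
      then show ?thesis unfolding isolated_singularity_at_def
        by (metis analytic_on_open open_ball open_delete)
    qed
    moreover have "\<exists>l. (H \<longlongrightarrow> l) (at v)"
    proof (cases "v \<in> \<phi> ` corners")
      case True then show ?thesis using H_limit by metis
    next
      case False
      then have "isCont H v"
        using H_holomorphic opn by (metis ComplI continuous_on_eq_continuous_at holomorphic_on_imp_continuous_on)
      then show ?thesis by (auto simp: isCont_def)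
    qed
    ultimately show ?thesis unfolding H'_def using remove_sings_analytic_at by metis
  qed
  then have "H' analytic_on UNIV" using analytic_on_analytic_at by blast
  then have "H' holomorphic_on UNIV" by (rule analytic_imp_holomorphic)
  moreover have "(H' \<longlongrightarrow> 0) at_infinity"
  proof -
    have inv: "((\<lambda>u. 1 / (u + c)) \<longlongrightarrow> 0) at_infinity" for c :: complex
      by (intro tendsto_divide_0[OF tendsto_const] tendsto_add_filterlim_at_infinity'[OF filterlim_ident tendsto_const])
    have "(H \<longlongrightarrow> 0 - a * (0 + 0 - 0 - 0)) at_infinity"
      unfolding H_def[abs_def]
      using inv[of "cnj z1"] inv[of "- cnj z1"] inv[of "- z1"] inv[of z1]
      by (intro tendsto_intros N_at_infinity) simp_all
    moreover obtain R where "{u. R < norm u} \<subseteq> \<phi> ` (- Sq)" using exterior_near_infinity .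
    then have "H u = H' u" if "R + 1 \<le> norm u" for u
    proof -
      have "u \<in> \<phi> ` (- Sq)" using that \<open>{u. R < norm u} \<subseteq> \<phi> ` (- Sq)\<close> by auto
      then have "u \<notin> \<phi> ` corners" using N_domain by blast
      then show ?thesis by (simp add: eq)
    qed
    then have "\<forall>\<^sub>F u in at_infinity. H u = H' u"
      unfolding eventually_at_infinity by blast
    ultimately show ?thesis by (simp add: Lim_transform_eventually)
  qed
  ultimately have "H' u = 0" by (rule Liouville_weak_0)
  then show ?thesis using eq[OF u] by (simp add: H_def)
qed

end

section \<open>Continuous logarithms and primitives along a homotopy\<close>

lemma constant_on_if_discrete:
  fixes f :: "'a :: topological_space \<Rightarrow> complex"
  assumes "connected S" "continuous_on S f" "0 < r"
    and int: "\<And>x. x \<in> S \<Longrightarrow> \<exists>n :: int. f x = of_int n * of_real r"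
  shows "f constant_on S"
proof (rule continuous_discrete_range_constant[OF assms(1,2)])
  fix x assume x: "x \<in> S"
  have "r \<le> norm (f y - f x)" if y: "y \<in> S" "f y \<noteq> f x" for y
  proof -
    obtain n m :: int where nm: "f x = of_int n * of_real r" "f y = of_int m * of_real r"
      using int[OF x] int[OF y(1)] by blast
    then have "m \<noteq> n" using y(2) by auto
    then have "1 \<le> \<bar>real_of_int (m - n)\<bar>" by linarith
    moreover have "f y - f x = of_real (real_of_int (m - n) * r)"
      unfolding nm by (simp add: algebra_simps)
    then have "norm (f y - f x) = \<bar>real_of_int (m - n)\<bar> * r"
      using \<open>0 < r\<close> by (simp only: norm_of_real abs_mult abs_of_pos)
    ultimately show ?thesis using \<open>0 < r\<close> by (simp add: mult_le_cancel_right1)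
  qed
  then show "\<exists>e>0. \<forall>y. y \<in> S \<and> f y \<noteq> f x \<longrightarrow> e \<le> norm (f y - f x)"
    using \<open>0 < r\<close> by blast
qed

lemma continuous_logs_differ_by_constant:
  fixes L M :: "'a :: topological_space \<Rightarrow> complex"
  assumes S: "connected S" and L: "continuous_on S L" and M: "continuous_on S M"
    and eq: "\<And>x. x \<in> S \<Longrightarrow> exp (L x) = exp (M x)"
  obtains n :: int where "\<And>x. x \<in> S \<Longrightarrow> L x = M x + of_int n * (2 * of_real pi * \<i>)"
proof (cases "S = {}")
  case False
  then obtain s where s: "s \<in> S" by blast
  have n: "\<exists>n :: int. L x = M x + of_int n * (2 * of_real pi * \<i>)" if "x \<in> S" for x
    using eq[OF that] unfolding exp_eq by (auto simp: mult_ac)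
  then have "(\<lambda>x. (L x - M x) / \<i>) constant_on S"
    by (intro constant_on_if_discrete[OF S, of _ "2 * pi"] continuous_intros L M)
      (fastforce simp: algebra_simps)+
  then obtain c where c: "\<And>x. x \<in> S \<Longrightarrow> (L x - M x) / \<i> = c"
    unfolding constant_on_def by blast
  obtain n :: int where "L s = M s + of_int n * (2 * of_real pi * \<i>)" using n[OF s] ..
  moreover have "L x - M x = L s - M s" if "x \<in> S" for x
    using c[OF s] c[OF that] by (metis complex_i_not_zero divide_cancel_right)
  ultimately have "L x = M x + of_int n * (2 * of_real pi * \<i>)" if "x \<in> S" for x
    using that by (simp add: algebra_simps)
  then show ?thesis by (rule that)
qed (use that in blast)

lemma continuous_logs_eq:
  fixes L M :: "'a :: topological_space \<Rightarrow> complex"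
  assumes "connected S" "continuous_on S L" "continuous_on S M"
    "\<And>x. x \<in> S \<Longrightarrow> exp (L x) = exp (M x)" "s \<in> S" "L s = M s" "x \<in> S"
  shows "L x = M x"
  using continuous_logs_differ_by_constant[OF assms(1-4)] assms(5-7)
  by (metis add_cancel_right_right)

text \<open>Additivity of \<open>W\<close> on all small triangles suffices for a primitive on a convex set: sum \<open>W\<close> along \<open>n\<close> equal steps of the segment
  from \<open>x0\<close> to \<open>x\<close>. For two nearby end points the difference of the sums telescopes, as each step
  contributes two thin triangles.\<close>

lemma discrete_primitive:
  fixes Q :: "'a :: real_normed_vector set" and W :: "'a \<Rightarrow> 'a \<Rightarrow> complex"
  assumes Q: "convex Q" "bounded Q" "x0 \<in> Q" and \<delta>: "0 < \<delta>"
    and W: "\<And>x y z. x \<in> Q \<Longrightarrow> y \<in> Q \<Longrightarrow> z \<in> Q \<Longrightarrow> dist x y < \<delta> \<Longrightarrow> dist y z < \<delta> \<Longrightarrow> dist x z < \<delta> \<Longrightarrow>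
      W x y + W y z = W x z"
  obtains J where "\<And>x y. x \<in> Q \<Longrightarrow> y \<in> Q \<Longrightarrow> dist x y < \<delta> / 2 \<Longrightarrow> J x - J y = W x y"
proof -
  obtain M where M: "\<And>x. x \<in> Q \<Longrightarrow> dist x0 x \<le> M"
    using Q(2) bounded_any_center[of Q x0] by metis
  have "0 \<le> M" using M[OF Q(3)] by simp
  obtain n :: nat where n: "M < of_nat n * (\<delta> / 2)"
    using reals_Archimedean3[of "\<delta> / 2"] \<delta> by auto
  with \<open>0 \<le> M\<close> \<delta> have "0 < n" by (cases n) auto
  define p where "p = (\<lambda>x k. x0 + (real k / real n) *\<^sub>R (x - x0))"
  have p_in: "p x k \<in> Q" if "x \<in> Q" "k \<le> n" for x k
  proof -
    have "p x k = (1 - real k / real n) *\<^sub>R x0 + (real k / real n) *\<^sub>R x" by (simp add: p_def algebra_simps)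
    then show ?thesis using that Q(1,3) \<open>0 < n\<close> by (auto intro!: convexD_alt)
  qed
  have step: "dist (p x (Suc k)) (p x k) < \<delta> / 2" if "x \<in> Q" for x k
  proof -
    have "p x (Suc k) - p x k = (1 / real n) *\<^sub>R (x - x0)"
      by (simp add: p_def scaleR_left_diff_distrib[symmetric] diff_divide_distrib[symmetric])
    then have "dist (p x (Suc k)) (p x k) = dist x0 x / real n"
      by (simp add: dist_norm norm_minus_commute)
    also have "\<dots> \<le> M / real n" using M[OF that] by (simp add: divide_right_mono)
    also have "\<dots> < \<delta> / 2" using n \<open>0 < n\<close> by (simp add: field_simps)
    finally show ?thesis .
  qed
  have close: "dist (p x k) (p y k) \<le> dist x y" if "k \<le> n" for x y k
  proof -
    have "p x k - p y k = (real k / real n) *\<^sub>R (x - y)" by (simp add: p_def algebra_simps)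
    then have "dist (p x k) (p y k) = (real k / real n) * dist x y" by (simp add: dist_norm)
    also have "\<dots> \<le> 1 * dist x y" using that \<open>0 < n\<close> by (intro mult_right_mono) auto
    finally show ?thesis by simp
  qed
  define J where "J = (\<lambda>x. \<Sum>k<n. W (p x (Suc k)) (p x k))"
  have "J x - J y = W x y" if xy: "x \<in> Q" "y \<in> Q" "dist x y < \<delta> / 2" for x y
  proof -
    have zero: "W x0 x0 = 0" using W[OF Q(3,3,3)] \<delta> by simp
    have "W (p x (Suc k)) (p x k) - W (p y (Suc k)) (p y k)
        = W (p x (Suc k)) (p y (Suc k)) - W (p x k) (p y k)" if k: "k < n" for k
    proof -
      have d: "dist (p x k) (p y k) < \<delta> / 2" "dist (p x (Suc k)) (p y (Suc k)) < \<delta> / 2"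
        using close[of k x y] close[of "Suc k" x y] k xy(3) by auto
      have diag: "dist (p x (Suc k)) (p y k) < \<delta>"
        using dist_triangle[of "p x (Suc k)" "p y k" "p x k"] step[OF xy(1), of k] d by linarith
      have "W (p x (Suc k)) (p x k) + W (p x k) (p y k) = W (p x (Suc k)) (p y k)"
        using xy k d step[OF xy(1), of k] diag \<delta> by (intro W p_in) auto
      moreover have "W (p x (Suc k)) (p y (Suc k)) + W (p y (Suc k)) (p y k) = W (p x (Suc k)) (p y k)"
        using xy k d step[OF xy(2), of k] diag \<delta> by (intro W p_in) auto
      ultimately show ?thesis by (simp add: algebra_simps)
    qed
    then have "J x - J y = (\<Sum>k<n. W (p x (Suc k)) (p y (Suc k)) - W (p x k) (p y k))"
      unfolding J_def sum_subtractf[symmetric] by (intro sum.cong) auto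
    also have "\<dots> = W (p x n) (p y n) - W (p x 0) (p y 0)"
      by (rule sum_lessThan_telescope)
    also have "\<dots> = W x y" using zero \<open>0 < n\<close> by (simp add: p_def)
    finally show ?thesis .
  qed
  then show ?thesis by (rule that)
qed

lemma local_branch_and_primitive:
  assumes "0 < r" and sub: "ball v r \<subseteq> X" and f: "f holomorphic_on X" and nz: "\<And>u. u \<in> X \<Longrightarrow> f u \<noteq> 0"
    and T: "T holomorphic_on X" and l: "exp l = f v"
  obtains \<Lambda> \<Phi> where "\<Lambda> holomorphic_on ball v r" "\<And>u. u \<in> ball v r \<Longrightarrow> exp (\<Lambda> u) = f u" "\<Lambda> v = l"
    "\<And>u. u \<in> ball v r \<Longrightarrow> (\<Phi> has_field_derivative exp (a * \<Lambda> u) * T u) (at u)" "\<Phi> v = 0"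
proof -
  have sc: "simply_connected (ball v r)" by (simp add: convex_imp_simply_connected)
  have fT: "f holomorphic_on ball v r" "T holomorphic_on ball v r"
    using f T sub by (auto intro: holomorphic_on_subset)
  then obtain \<Lambda>0 where \<Lambda>0: "\<Lambda>0 holomorphic_on ball v r" "\<And>u. u \<in> ball v r \<Longrightarrow> f u = exp (\<Lambda>0 u)"
    using simply_connected_eq_holomorphic_log[OF open_ball, THEN iffD1, OF sc] nz sub by blast
  define \<Lambda> where "\<Lambda> = (\<lambda>u. \<Lambda>0 u + (l - \<Lambda>0 v))"
  have v: "v \<in> ball v r" using \<open>0 < r\<close> by simp
  have "exp (l - \<Lambda>0 v) = 1" using l \<Lambda>0(2)[OF v] nz[of v] v sub by (auto simp: exp_diff)
  then have expL: "exp (\<Lambda> u) = f u" if "u \<in> ball v r" for u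
    using \<Lambda>0(2)[OF that] by (simp add: \<Lambda>_def exp_add)
  have hol: "\<Lambda> holomorphic_on ball v r" unfolding \<Lambda>_def by (intro holomorphic_intros \<Lambda>0)
  then have "(\<lambda>u. exp (a * \<Lambda> u) * T u) holomorphic_on ball v r" by (intro holomorphic_intros fT)
  then obtain \<Phi>0 where \<Phi>0: "\<And>u. u \<in> ball v r \<Longrightarrow> (\<Phi>0 has_field_derivative exp (a * \<Lambda> u) * T u) (at u)"
    using simply_connected_eq_global_primitive[OF open_ball, THEN iffD1, OF sc] by blast
  show ?thesis
  proof (rule that[OF hol expL])
    show "((\<lambda>u. \<Phi>0 u - \<Phi>0 v) has_field_derivative exp (a * \<Lambda> u) * T u) (at u)" if "u \<in> ball v r" for u
      using \<Phi>0[OF that] by (auto intro!: derivative_eq_intros)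
  qed (auto simp: \<Lambda>_def)
qed

text \<open>The form \<open>exp (a log f) T\<close> is multivalued on \<open>X\<close>, but \<open>L\<close> selects a branch of the logarithm at every parameter. On discs of a common
  radius \<open>r\<close> around the points \<open>h y\<close> this gives branches \<open>\<Lambda> y\<close> and primitives \<open>\<Phi> y\<close>. Those of nearby parameters differ by
  constants, so the increments \<open>\<Phi> y (h x)\<close> are additive on small triangles and \<open>discrete_primitive\<close> applies.\<close>

theorem primitive_along_homotopy:
  fixes Q :: "'a :: real_normed_vector set" and h :: "'a \<Rightarrow> complex"
  assumes Q: "convex Q" "compact Q" "x0 \<in> Q" and X: "open X"
    and f: "f holomorphic_on X" and nz: "\<And>u. u \<in> X \<Longrightarrow> f u \<noteq> 0" and T: "T holomorphic_on X"
    and h: "continuous_on Q h" "h ` Q \<subseteq> X"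
    and L: "continuous_on Q L" "\<And>x. x \<in> Q \<Longrightarrow> exp (L x) = f (h x)"
  obtains J \<delta> r \<Lambda> \<Phi> where "0 < \<delta>" "0 < r"
    "\<And>y. y \<in> Q \<Longrightarrow> ball (h y) r \<subseteq> X"
    "\<And>y. y \<in> Q \<Longrightarrow> \<Lambda> y holomorphic_on ball (h y) r"
    "\<And>y u. y \<in> Q \<Longrightarrow> u \<in> ball (h y) r \<Longrightarrow> exp (\<Lambda> y u) = f u"
    "\<And>y u. y \<in> Q \<Longrightarrow> u \<in> ball (h y) r \<Longrightarrow> (\<Phi> y has_field_derivative exp (a * \<Lambda> y u) * T u) (at u)"
    "\<And>x y. y \<in> Q \<Longrightarrow> x \<in> Q \<Longrightarrow> dist x y < \<delta> \<Longrightarrow> h x \<in> ball (h y) r"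
    "\<And>x y. y \<in> Q \<Longrightarrow> x \<in> Q \<Longrightarrow> dist x y < \<delta> \<Longrightarrow> \<Lambda> y (h x) = L x"
    "\<And>x y. y \<in> Q \<Longrightarrow> x \<in> Q \<Longrightarrow> dist x y < \<delta> \<Longrightarrow> J x - J y = \<Phi> y (h x)"
proof -
  have "compact (h ` Q)" by (intro compact_continuous_image h Q)
  then obtain r where r: "0 < r" "\<And>v. v \<in> h ` Q \<Longrightarrow> ball v r \<subseteq> X"
    using compact_subset_open_imp_ball_epsilon_subset[OF _ X h(2)] by (metis UN_subset_iff)
  have "\<exists>\<Lambda> \<Phi>. \<Lambda> holomorphic_on ball (h y) r \<and> (\<forall>u\<in>ball (h y) r. exp (\<Lambda> u) = f u) \<and> \<Lambda> (h y) = L y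
    \<and> (\<forall>u\<in>ball (h y) r. (\<Phi> has_field_derivative exp (a * \<Lambda> u) * T u) (at u)) \<and> \<Phi> (h y) = 0" if "y \<in> Q" for y
    using local_branch_and_primitive[OF r(1) r(2) f nz T L(2)] that by (metis imageI)
  then have "\<forall>y. \<exists>F. y \<in> Q \<longrightarrow> fst F holomorphic_on ball (h y) r \<and> (\<forall>u\<in>ball (h y) r. exp (fst F u) = f u)
      \<and> fst F (h y) = L y \<and> (\<forall>u\<in>ball (h y) r. (snd F has_field_derivative exp (a * fst F u) * T u) (at u))
      \<and> snd F (h y) = 0"
    by (metis fst_conv snd_conv)
  from choice[OF this] obtain F where F: "\<And>y. y \<in> Q \<Longrightarrow> fst (F y) holomorphic_on ball (h y) r
      \<and> (\<forall>u\<in>ball (h y) r. exp (fst (F y) u) = f u) \<and> fst (F y) (h y) = L y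
      \<and> (\<forall>u\<in>ball (h y) r. (snd (F y) has_field_derivative exp (a * fst (F y) u) * T u) (at u))
      \<and> snd (F y) (h y) = 0" by blast
  define \<Lambda> where "\<Lambda> = (\<lambda>y. fst (F y))"
  define \<Phi> where "\<Phi> = (\<lambda>y. snd (F y))"
  have \<Lambda>: "\<And>y. y \<in> Q \<Longrightarrow> \<Lambda> y holomorphic_on ball (h y) r" "\<And>y u. y \<in> Q \<Longrightarrow> u \<in> ball (h y) r \<Longrightarrow> exp (\<Lambda> y u) = f u"
      "\<And>y. y \<in> Q \<Longrightarrow> \<Lambda> y (h y) = L y"
    and \<Phi>: "\<And>y u. y \<in> Q \<Longrightarrow> u \<in> ball (h y) r \<Longrightarrow> (\<Phi> y has_field_derivative exp (a * \<Lambda> y u) * T u) (at u)"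
      "\<And>y. y \<in> Q \<Longrightarrow> \<Phi> y (h y) = 0"
    using F by (auto simp: \<Lambda>_def \<Phi>_def)
  have "uniformly_continuous_on Q h" by (rule compact_uniformly_continuous[OF h(1) Q(2)])
  then obtain \<delta> where \<delta>: "0 < \<delta>" "\<And>x y. x \<in> Q \<Longrightarrow> y \<in> Q \<Longrightarrow> dist x y < \<delta> \<Longrightarrow> dist (h x) (h y) < r"
    using r(1) unfolding uniformly_continuous_on_def by metis
  have near: "h x \<in> ball (h y) r" if "y \<in> Q" "x \<in> Q" "dist x y < \<delta>" for x y
    using \<delta>(2)[OF that(2,1,3)] by (simp add: dist_commute)
  have \<Lambda>L: "\<Lambda> y (h x) = L x" if y: "y \<in> Q" and x: "x \<in> Q" "dist x y < \<delta>" for x y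
  proof (rule continuous_logs_eq[where S = "Q \<inter> ball y \<delta>" and s = y])
    show "connected (Q \<inter> ball y \<delta>)" by (intro convex_connected convex_Int Q) simp
    have sub: "h ` (Q \<inter> ball y \<delta>) \<subseteq> ball (h y) r" using near[OF y] by (auto simp: dist_commute)
    show "continuous_on (Q \<inter> ball y \<delta>) (\<lambda>x. \<Lambda> y (h x))"
      by (rule continuous_on_compose2[OF holomorphic_on_imp_continuous_on[OF \<Lambda>(1)[OF y]] _ sub])
        (auto intro: continuous_on_subset[OF h(1)])
    show "continuous_on (Q \<inter> ball y \<delta>) L" by (auto intro: continuous_on_subset[OF L(1)])
    show "exp (\<Lambda> y (h w)) = exp (L w)" if "w \<in> Q \<inter> ball y \<delta>" for w
    proof -
      have "h w \<in> ball (h y) r" using that sub by blast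
      then show ?thesis using that \<Lambda>(2)[OF y, of "h w"] L(2)[of w] by auto
    qed
  qed (use y x \<delta>(1) \<Lambda>(3) in \<open>auto simp: dist_commute\<close>)
  have add: "\<Phi> y (h x) + \<Phi> z (h y) = \<Phi> z (h x)"
    if Qs: "x \<in> Q" "y \<in> Q" "z \<in> Q" and d: "dist x y < \<delta>" "dist y z < \<delta>" "dist x z < \<delta>" for x y z
  proof -
    define S where "S = ball (h y) r \<inter> ball (h z) r"
    have S: "connected S" "open S" by (auto simp: S_def intro!: convex_connected convex_Int)
    have hy: "h y \<in> S" using near[OF Qs(2,2)] near[OF Qs(3,2) d(2)] \<delta>(1) by (simp add: S_def)
    have hx: "h x \<in> S" using near[OF Qs(2,1) d(1)] near[OF Qs(3,1) d(3)] by (simp add: S_def)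
    have \<Lambda>eq: "\<Lambda> y u = \<Lambda> z u" if "u \<in> S" for u
    proof (rule continuous_logs_eq[OF S(1) _ _ _ hy _ that])
      show "continuous_on S (\<Lambda> y)" "continuous_on S (\<Lambda> z)"
        using \<Lambda>(1)[OF Qs(2)] \<Lambda>(1)[OF Qs(3)] 
        by (auto simp: S_def intro: continuous_on_subset dest!: holomorphic_on_imp_continuous_on)
      show "\<Lambda> y (h y) = \<Lambda> z (h y)" using \<Lambda>L[OF Qs(3,2) d(2)] \<Lambda>(3)[OF Qs(2)] by simp
    qed (auto simp: S_def \<Lambda>(2) Qs)
    have "((\<lambda>u. \<Phi> y u - \<Phi> z u) has_field_derivative 0) (at u)" if "u \<in> S" for u
      using \<Phi>(1)[OF Qs(2), of u] \<Phi>(1)[OF Qs(3), of u] \<Lambda>eq[OF that] that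
      by (auto simp: S_def intro!: derivative_eq_intros)
    then have "(\<lambda>u. \<Phi> y u - \<Phi> z u) constant_on S"
      by (intro has_field_derivative_0_imp_constant_on[OF _ S]) auto
    then have "\<Phi> y (h x) - \<Phi> z (h x) = \<Phi> y (h y) - \<Phi> z (h y)"
      using hx hy unfolding constant_on_def by metis
    then show ?thesis using \<Phi>(2)[OF Qs(2)] by (simp add: algebra_simps)
  qed
  obtain J where J: "\<And>x y. x \<in> Q \<Longrightarrow> y \<in> Q \<Longrightarrow> dist x y < \<delta> / 2 \<Longrightarrow> J x - J y = \<Phi> y (h x)"
    by (rule discrete_primitive[OF Q(1) compact_imp_bounded[OF Q(2)] Q(3) \<delta>(1), of "\<lambda>x y. \<Phi> y (h x)"])
      (use add in auto)
  show ?thesis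
    by (rule that[of "\<delta> / 2" r \<Lambda> \<Phi> J]) (use \<delta>(1) r \<Lambda> \<Phi> near \<Lambda>L J in auto)
qed

section \<open>The derivative of the developing map\<close>

context sq_straightening
begin

definition R :: "complex \<Rightarrow> complex" where
  "R u = ((u + cnj z1) * (u - cnj z1)) / ((u - z1) * (u + z1))"

lemma \<Omega>_no_corner: "\<Omega> \<inter> \<phi> ` corners = {}"
  using N_domain by blast

lemma R_factors_nonzero:
  assumes "u \<notin> \<phi> ` corners"
  shows "u + cnj z1 \<noteq> 0" "u - cnj z1 \<noteq> 0" "u - z1 \<noteq> 0" "u + z1 \<noteq> 0"
  using assms by (auto simp: corners_image eq_neg_iff_add_eq_0)

lemma R_nonzero: "u \<notin> \<phi> ` corners \<Longrightarrow> R u \<noteq> 0"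
  using R_factors_nonzero by (simp add: R_def)

lemma R_has_derivative:
  assumes "u \<notin> \<phi> ` corners"
  shows "(R has_field_derivative R u * (1 / (u + cnj z1) + 1 / (u - cnj z1) - 1 / (u - z1) - 1 / (u + z1))) (at u)"
proof -
  note nz = R_factors_nonzero[OF assms]
  have n: "((\<lambda>u. (u + cnj z1) * (u - cnj z1)) has_field_derivative (u - cnj z1) + (u + cnj z1)) (at u)"
    by (auto intro!: derivative_eq_intros)
  have d: "((\<lambda>u. (u - z1) * (u + z1)) has_field_derivative (u + z1) + (u - z1)) (at u)"
    by (auto intro!: derivative_eq_intros)
  have quot: "((p + q) * (r * s) - p * q * (s + r)) / ((r * s) * (r * s)) = (p * q) / (r * s) * (1 / p + 1 / q - 1 / r - 1 / s)"
    if "p \<noteq> 0" "q \<noteq> 0" "r \<noteq> 0" "s \<noteq> 0" for p q r s :: complex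
    using that by (simp add: field_simps)
  have "(R has_field_derivative (((u - cnj z1) + (u + cnj z1)) * ((u - z1) * (u + z1))
     - (u + cnj z1) * (u - cnj z1) * ((u + z1) + (u - z1))) / (((u - z1) * (u + z1)) * ((u - z1) * (u + z1)))) (at u)"
    unfolding R_def[abs_def] by (rule DERIV_divide[OF n d]) (use nz in simp)
  then show ?thesis
    unfolding R_def using quot[OF nz] by (simp add: add.commute)
qed

lemma simply_connected_\<Omega>: "simply_connected \<Omega>"
proof -
  have "starlike cross"
    unfolding starlike_def
  proof (intro bexI[of _ 0] ballI subsetI)
    fix z w assume z: "z \<in> cross" and "w \<in> closed_segment 0 z"
    then obtain t where t: "0 \<le> t" "t \<le> 1" "w = t *\<^sub>R z" by (auto simp: closed_segment_def)
    have "\<bar>t * x\<bar> \<le> \<bar>x\<bar>" for x using t by (simp add: abs_mult mult_left_le_one_le)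
    then show "w \<in> cross" using z unfolding t(3) cross_def
      by (metis (mono_tags, lifting) mem_Collect_eq order_le_less_trans scaleR_complex.sel)
  qed (simp add: cross_def)
  then have "simply_connected cross" by (rule starlike_imp_simply_connected)
  moreover have "homeomorphism cross \<Omega> \<phi> g"
    unfolding homeomorphism_def using continuous_\<phi> continuous_g by (auto simp: \<Omega>_def image_image)
  ultimately show ?thesis using homeomorphic_simply_connected homeomorphic_def by blast
qed

lemma \<Omega>_imaginary_axis: "\<i> * of_real y \<in> \<Omega>" and Re_g_imaginary_axis: "Re (g (\<i> * of_real y)) = 0"
proof -
  have "- cnj (\<i> * of_real y) = \<i> * of_real y" by simp
  then have "- cnj (g (\<i> * of_real y)) = g (\<i> * of_real y)" by (metis g_cnj g_minus)
  then show Re0: "Re (g (\<i> * of_real y)) = 0" by (auto simp: complex_eq_iff)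
  show "\<i> * of_real y \<in> \<Omega>" by (simp add: \<Omega>_def mem_image_\<phi> cross_def Re0)
qed

text \<open>\<open>dev'\<close> and the branch \<open>exp (a \<tau>)\<close> have the same logarithmic derivative \<open>a R' / R = N\<close> on the connected set \<open>\<Omega>\<close>.\<close>

lemma deriv_dev_eq_branch:
  obtains \<tau> c where "\<tau> holomorphic_on \<Omega>" "\<And>u. u \<in> \<Omega> \<Longrightarrow> exp (\<tau> u) = R u"
    "\<And>u. u \<in> \<Omega> \<Longrightarrow> deriv dev u = c * exp (a * \<tau> u)"
proof -
  have R_hol: "R holomorphic_on \<Omega>"
    unfolding holomorphic_on_def field_differentiable_def
    using R_has_derivative has_field_derivative_at_within \<Omega>_no_corner by blast
  obtain \<tau> where \<tau>: "\<tau> holomorphic_on \<Omega>" "\<And>u. u \<in> \<Omega> \<Longrightarrow> R u = exp (\<tau> u)"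
    using simply_connected_eq_holomorphic_log[OF open_\<Omega>, THEN iffD1, OF simply_connected_\<Omega>] R_hol R_nonzero \<Omega>_no_corner
    by (metis disjoint_iff)
  define P where "P = (\<lambda>u. deriv dev u * exp (- a * \<tau> u))"
  have dP: "(P has_field_derivative 0) (at u)" if u: "u \<in> \<Omega>" for u
  proof -
    have nc: "u \<notin> \<phi> ` corners" using u \<Omega>_no_corner by blast
    have d\<tau>: "(\<tau> has_field_derivative deriv \<tau> u) (at u)" using \<tau>(1) open_\<Omega> u by (rule holomorphic_derivI)
    have "((\<lambda>u. exp (\<tau> u)) has_field_derivative exp (\<tau> u) * deriv \<tau> u) (at u)"
      by (rule DERIV_chain2[OF DERIV_exp d\<tau>])
    then have "(R has_field_derivative R u * deriv \<tau> u) (at u)"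
      unfolding \<tau>(2)[OF u, symmetric]
      by (rule has_field_derivative_transform_within_open[OF _ open_\<Omega> u]) (simp add: \<tau>(2))
    from DERIV_unique[OF this R_has_derivative[OF nc]]
    have "deriv \<tau> u = 1 / (u + cnj z1) + 1 / (u - cnj z1) - 1 / (u - z1) - 1 / (u + z1)"
      using R_nonzero[OF nc] by simp
    then have "N u = a * deriv \<tau> u" using N_eq[OF nc] by simp
    then have dd: "deriv (deriv dev) u = a * deriv \<tau> u * deriv dev u"
      using u deriv_dev_nonzero[OF u] by (simp add: N_def field_simps)
    have "(deriv dev has_field_derivative deriv (deriv dev) u) (at u)"
      using holomorphic_deriv[OF dev_holomorphic open_\<Omega>] open_\<Omega> u by (rule holomorphic_derivI)
    then show ?thesis unfolding P_def by (auto intro!: derivative_eq_intros d\<tau> simp: dd)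
  qed
  have "P constant_on \<Omega>"
    by (rule has_field_derivative_0_imp_constant_on[OF dP _ open_\<Omega>])
      (auto intro: simply_connected_imp_connected simply_connected_\<Omega>)
  then obtain c where c: "\<And>u. u \<in> \<Omega> \<Longrightarrow> P u = c" unfolding constant_on_def by blast
  show ?thesis
  proof (rule that[OF \<tau>(1), of c])
    show "deriv dev u = c * exp (a * \<tau> u)" if "u \<in> \<Omega>" for u
      using c[OF that] by (simp add: P_def exp_minus field_simps)
  qed (simp add: \<tau>(2))
qed

text \<open>On the imaginary axis \<open>R\<close> is the quotient of the conjugate of \<open>s\<close> by \<open>s\<close>, and \<open>s\<close> stays in the upper half plane, where \<open>Ln\<close> is
  continuous.\<close>

definition s :: "real \<Rightarrow> complex" where "s y = of_real (y\<^sup>2) + z1\<^sup>2"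

lemma Im_s: "0 < Im (s y)"
  using z1_quadrant by (simp add: s_def power2_eq_square)

lemma R_imaginary_axis: "R (\<i> * of_real y) = cnj (s y) / s y"
proof -
  have "(\<i> * of_real y + cnj z1) * (\<i> * of_real y - cnj z1) = - cnj (s y)"
    "(\<i> * of_real y - z1) * (\<i> * of_real y + z1) = - s y"
    by (simp_all add: s_def power2_eq_square algebra_simps)
  then show ?thesis unfolding R_def by (simp only: minus_divide_divide)
qed

text \<open>The logarithm of \<open>R\<close> along the imaginary axis that tends to 0 at infinity.\<close>

definition axis_log :: "real \<Rightarrow> complex" where
  "axis_log y = - 2 * \<i> * of_real (Im (Ln (s y)))"

lemma exp_axis_log: "exp (axis_log y) = R (\<i> * of_real y)"
proof -
  have s0: "s y \<noteq> 0" using Im_s[of y] by auto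
  have "axis_log y = cnj (Ln (s y)) - Ln (s y)" by (simp add: axis_log_def complex_eq_iff)
  then have "exp (axis_log y) = cnj (exp (Ln (s y))) / exp (Ln (s y))" by (simp add: exp_diff exp_cnj)
  then show ?thesis using s0 by (simp add: R_imaginary_axis)
qed

lemma continuous_axis_log: "continuous_on S axis_log"
proof -
  have "s y \<notin> \<real>\<^sub>\<le>\<^sub>0" for y using Im_s[of y] by (auto simp: complex_nonpos_Reals_iff)
  moreover have "continuous_on S s" unfolding s_def by (intro continuous_intros)
  ultimately show ?thesis unfolding axis_log_def by (intro continuous_intros) auto
qed

lemma axis_log_0: "axis_log 0 = - 4 * \<i> * of_real (Arg z1)"
proof -
  have z0: "z1 \<noteq> 0" using z1_quadrant by auto
  have th: "0 < Im (Ln z1)" "Im (Ln z1) < pi / 2"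
    using Im_Ln_pos_lt_imp[of z1] Re_Ln_pos_lt[OF z0] z1_quadrant by auto
  have "Ln (z1\<^sup>2) = 2 * Ln z1"
    by (rule Ln_unique) (use th z0 in \<open>auto simp: exp_double\<close>)
  then show ?thesis using z0 by (simp add: axis_log_def s_def Arg_eq_Im_Ln)
qed

lemma axis_log_at_infinity: "(axis_log \<longlongrightarrow> 0) at_top"
proof -
  have "((\<lambda>y. 1 + z1\<^sup>2 / of_real (y\<^sup>2)) \<longlongrightarrow> 1 + 0) at_top"
  proof (intro tendsto_intros)
    have "filterlim (\<lambda>y. of_real (y\<^sup>2) :: complex) at_infinity at_top"
      by (rule filterlim_compose[OF filterlim_of_real_at_infinity]) (intro filterlim_pow_at_top filterlim_ident; simp)
    then show "((\<lambda>y. z1\<^sup>2 / of_real (y\<^sup>2)) \<longlongrightarrow> 0) at_top"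
      by (rule tendsto_divide_0[OF tendsto_const])
  qed
  then have "((\<lambda>y. Ln (1 + z1\<^sup>2 / of_real (y\<^sup>2))) \<longlongrightarrow> Ln 1) at_top"
    by (intro tendsto_Ln) auto
  from tendsto_mult[OF tendsto_const[of "- 2 * \<i>"] tendsto_of_real[OF tendsto_Im[OF this]]]
  have "((\<lambda>y. - 2 * \<i> * of_real (Im (Ln (1 + z1\<^sup>2 / of_real (y\<^sup>2))))) \<longlongrightarrow> - 2 * \<i> * of_real (Im (Ln 1))) at_top" .
  moreover have "\<forall>\<^sub>F y in at_top. - 2 * \<i> * of_real (Im (Ln (1 + z1\<^sup>2 / of_real (y\<^sup>2)))) = axis_log y"
    using eventually_gt_at_top[of 0]
  proof eventually_elim
    case (elim y)
    have "s y = of_real (y\<^sup>2) * (1 + z1\<^sup>2 / of_real (y\<^sup>2))" using elim by (simp add: s_def field_simps)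
    moreover have "1 + z1\<^sup>2 / of_real (y\<^sup>2) \<noteq> 0" using calculation Im_s[of y]
      by (metis less_irrefl mult_zero_right zero_complex.sel(2))
    ultimately have "Ln (s y) = Ln (of_real (y\<^sup>2)) + Ln (1 + z1\<^sup>2 / of_real (y\<^sup>2))"
      using elim by (simp add: Ln_times_of_real del: of_real_power)
    then have "Im (Ln (s y)) = Im (Ln (1 + z1\<^sup>2 / of_real (y\<^sup>2)))"
      using elim by (simp add: Ln_of_real del: of_real_power)
    then show ?case by (simp add: axis_log_def)
  qed
  ultimately show ?thesis by (simp add: Lim_transform_eventually)
qed

lemma deriv_dev_axis_at_infinity: "((\<lambda>y. deriv dev (\<i> * of_real y)) \<longlongrightarrow> 1) at_top"
proof -
  have inf: "filterlim (\<lambda>y. \<i> * of_real y :: complex) at_infinity at_top"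
    by (intro tendsto_mult_filterlim_at_infinity[OF tendsto_const] filterlim_of_real_at_infinity) simp
  have "((\<lambda>y. deriv g (\<i> * of_real y)) \<longlongrightarrow> 1) at_top"
    by (rule filterlim_compose[OF deriv_g_at_infinity inf])
  moreover have "\<forall>\<^sub>F y in at_top. deriv g (\<i> * of_real y) = deriv dev (\<i> * of_real y)"
  proof -
    have "\<forall>\<^sub>F y in at_top. dist (g (\<i> * of_real y) - \<i> * of_real y) 0 < 1"
      by (rule tendstoD[OF filterlim_compose[OF g_at_infinity inf]]) simp
    moreover have "\<forall>\<^sub>F y in at_top. (2 :: real) < y" by (rule eventually_gt_at_top)
    ultimately show ?thesis
    proof eventually_elim
      case (elim y)
      then have "\<bar>Im (g (\<i> * of_real y)) - y\<bar> < 1"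
        using abs_Im_le_cmod[of "g (\<i> * of_real y) - \<i> * of_real y"] by simp
      then have "\<i> * of_real y \<in> \<phi> ` arm \<i>"
        using elim Re_g_imaginary_axis[of y] by (simp add: mem_image_\<phi> arm_def inner_complex_def)
      then show ?case using deriv_dev_arm[of \<i>] by (metis insertI1 insertI2 mult_1)
    qed
  qed
  ultimately show ?thesis by (rule Lim_transform_eventually)
qed

text \<open>Correct the logarithm by a multiple of \<open>2 \<pi> \<i>\<close> such that it extends \<open>axis_log\<close>. The constant factor of
  \<open>dev'\<close> is then its limit 1 at infinity along the axis.\<close>

theorem deriv_dev_eq_normalized_branch:
  obtains \<tau> where "\<tau> holomorphic_on \<Omega>" "\<And>u. u \<in> \<Omega> \<Longrightarrow> exp (\<tau> u) = R u"
    "\<And>u. u \<in> \<Omega> \<Longrightarrow> deriv dev u = exp (a * \<tau> u)" "\<tau> 0 = - 4 * \<i> * of_real (Arg z1)"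
proof -
  obtain \<tau>0 c where \<tau>0: "\<tau>0 holomorphic_on \<Omega>" "\<And>u. u \<in> \<Omega> \<Longrightarrow> exp (\<tau>0 u) = R u"
    "\<And>u. u \<in> \<Omega> \<Longrightarrow> deriv dev u = c * exp (a * \<tau>0 u)" by (rule deriv_dev_eq_branch) blast
  have "continuous_on UNIV (\<lambda>y. \<tau>0 (\<i> * of_real y))"
    by (rule continuous_on_compose2[OF holomorphic_on_imp_continuous_on[OF \<tau>0(1)]])
      (use \<Omega>_imaginary_axis in \<open>auto intro!: continuous_intros\<close>)
  then obtain n :: int where n: "\<And>y. \<tau>0 (\<i> * of_real y) = axis_log y + of_int n * (2 * of_real pi * \<i>)"
    using continuous_logs_differ_by_constant[OF connected_UNIV _ continuous_axis_log, of "\<lambda>y. \<tau>0 (\<i> * of_real y)"]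
      \<tau>0(2) \<Omega>_imaginary_axis exp_axis_log by (metis UNIV_I)
  define p where "p = of_int n * (2 * of_real pi * \<i>)"
  define \<tau> where "\<tau> = (\<lambda>u. \<tau>0 u - p)"
  have axis: "\<tau> (\<i> * of_real y) = axis_log y" for y by (simp add: \<tau>_def p_def n)
  have deriv: "deriv dev u = c * exp (a * p) * exp (a * \<tau> u)" if "u \<in> \<Omega>" for u
    using \<tau>0(3)[OF that] by (simp add: \<tau>_def right_diff_distrib exp_diff)
  have "((\<lambda>y. c * exp (a * p) * exp (a * axis_log y)) \<longlongrightarrow> c * exp (a * p) * exp (a * 0)) at_top"
    by (intro tendsto_intros axis_log_at_infinity)
  then have "((\<lambda>y. deriv dev (\<i> * of_real y)) \<longlongrightarrow> c * exp (a * p)) at_top"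
    using deriv \<Omega>_imaginary_axis by (simp add: axis)
  then have c1: "c * exp (a * p) = 1"
    using deriv_dev_axis_at_infinity tendsto_unique trivial_limit_at_top_linorder by blast
  show ?thesis
  proof (rule that)
    show "\<tau> holomorphic_on \<Omega>" unfolding \<tau>_def by (intro holomorphic_intros \<tau>0(1))
    have "exp p = 1" using exp_integer_2pi[of "of_int n"] by (simp add: p_def mult_ac)
    then show "exp (\<tau> u) = R u" if "u \<in> \<Omega>" for u
      using \<tau>0(2)[OF that] by (simp add: \<tau>_def exp_diff)
    show "deriv dev u = exp (a * \<tau> u)" if "u \<in> \<Omega>" for u using deriv[OF that] c1 by simp
    show "\<tau> 0 = - 4 * \<i> * of_real (Arg z1)" using axis[of 0] by (simp add: axis_log_0)
  qed
qed

end

section \<open>Branches along paths and homotopies on the sphere\<close>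

text \<open>Two branches of the power differ by a factor in the powers of \<open>K\<close>, which form a discrete set; by continuity the factor
  keeps its initial value 1.\<close>

lemma power_branch_unique:
  fixes L B w :: "real \<Rightarrow> complex"
  assumes K: "1 < K" and a: "a = of_real (ln K) / (2 * \<i> * of_real pi)"
    and L: "continuous_on {0..1} L" "\<And>t. t \<in> {0..1} \<Longrightarrow> exp (L t) = w t"
    and B: "continuous_on {0..1} B" "\<And>t. t \<in> {0..1} \<Longrightarrow> B t \<in> power_branches (w t) a"
    and start: "B 0 = exp (a * L 0)" and t: "t \<in> {0..1}"
  shows "B t = exp (a * L t)"
proof -
  define \<rho> where "\<rho> = (\<lambda>t. B t / exp (a * L t))"
  have lnK: "0 < ln K" using K by simp
  have powers: "\<exists>n :: int. \<rho> t = of_real (exp (of_int n * ln K))" if t: "t \<in> {0..1}" for t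
  proof -
    obtain l where l: "B t = exp (a * l)" "exp l = w t"
      using B(2)[OF t] by (auto simp: power_branches_def)
    then have "exp l = exp (L t)" using L(2)[OF t] by simp
    then obtain n :: int where n: "l = L t + of_real (of_int (2 * n) * pi) * \<i>"
      unfolding exp_eq by blast
    have "a * (of_real (of_int (2 * n) * pi) * \<i>) = of_real (of_int n * ln K)"
      by (simp add: a field_simps)
    then have "a * l = a * L t + of_real (of_int n * ln K)"
      unfolding n distrib_left by simp
    then have "\<rho> t = exp (of_real (of_int n * ln K))"
      by (simp add: \<rho>_def l(1) exp_add)
    then show ?thesis by (intro exI[of _ n]) (simp only: exp_of_real)
  qed
  have Ln_powers: "\<exists>n :: int. Ln (\<rho> t) = of_int n * of_real (ln K)" if t: "t \<in> {0..1}" for t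
  proof -
    obtain n :: int where "\<rho> t = of_real (exp (of_int n * ln K))" using powers[OF t] ..
    then have "Ln (\<rho> t) = of_real (of_int n * ln K)" by (simp add: Ln_of_real del: of_real_mult)
    then show ?thesis by auto
  qed
  have "(\<lambda>t. Ln (\<rho> t)) constant_on {0..1}"
  proof (rule constant_on_if_discrete[OF _ _ lnK Ln_powers])
    have "continuous_on {0..1} \<rho>"
      unfolding \<rho>_def by (intro continuous_intros B(1) L(1)) auto
    moreover have "\<rho> t \<notin> \<real>\<^sub>\<le>\<^sub>0" if "t \<in> {0..1}" for t
      using powers[OF that] by (auto simp: not_le)
    ultimately show "continuous_on {0..1} (\<lambda>t. Ln (\<rho> t))" by (intro continuous_intros) auto
  qed auto
  then have "Ln (\<rho> t) = Ln (\<rho> 0)" using t unfolding constant_on_def by (metis atLeastAtMost_iff order_refl zero_le_one)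
  then have "Ln (\<rho> t) = 0" by (simp add: \<rho>_def start)
  moreover have "\<rho> t \<noteq> 0" using powers[OF t] by auto
  ultimately have "\<rho> t = 1" by (metis exp_Ln exp_zero)
  then show ?thesis by (simp add: \<rho>_def)
qed

text \<open>The coordinate \<open>1 / (u - p)\<close> of the sphere without \<open>p\<close>.\<close>

definition mobius :: "complex \<Rightarrow> complex option \<Rightarrow> complex" where
  "mobius p x = (case x of None \<Rightarrow> 0 | Some u \<Rightarrow> 1 / (u - p))"

lemma continuous_map_mobius:
  assumes "p \<in> P"
  shows "continuous_map (subtopology riemann_sphere (- (Some ` P))) euclidean (mobius p)"
  unfolding continuous_map_def
proof (intro conjI allI impI)
  fix U :: "complex set" assume "openin euclidean U"
  then have U: "open U" by simp
  define V where "V = {u. u \<noteq> p \<and> 1 / (u - p) \<in> U}"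
  have "open ((\<lambda>u. 1 / (u - p)) -` U \<inter> - {p})"
  proof -
    have "continuous_on (- {p}) (\<lambda>u. 1 / (u - p))" by (auto intro!: continuous_intros)
    from continuous_open_preimage[OF this _ U] show ?thesis by (simp add: Int_commute open_Compl)
  qed
  moreover have "(\<lambda>u. 1 / (u - p)) -` U \<inter> - {p} = V" by (auto simp: V_def)
  ultimately have V: "open V" by simp
  define W where "W = (if 0 \<in> U then insert None (Some ` V) else Some ` V)"
  have "openin riemann_sphere W"
  proof (cases "0 \<in> U")
    case True
    then obtain e where e: "0 < e" "ball 0 e \<subseteq> U" using U by (meson openE)
    have "- V \<subseteq> cball p (1 / e)"
    proof
      fix u assume u: "u \<in> - V"
      show "u \<in> cball p (1 / e)"
      proof (rule ccontr)
        assume far: "u \<notin> cball p (1 / e)"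
        then have "1 / e < norm (u - p)" by (simp add: dist_norm norm_minus_commute)
        moreover from this have "u \<noteq> p" using e(1) by (auto simp: divide_less_0_iff)
        ultimately have "norm (1 / (u - p)) < e" using e(1) by (simp add: norm_divide field_simps)
        then have "1 / (u - p) \<in> U" using e(2) by (auto simp: dist_norm)
        then show False using u \<open>u \<noteq> p\<close> by (simp add: V_def)
      qed
    qed
    then have "compact (- V)"
      using V by (meson bounded_cball bounded_subset closed_Compl compact_eq_bounded_closed)
    then have "compactin euclidean (- V)" "closedin euclidean (- V)" using V by auto
    moreover have "W = insert None (Some ` (topspace euclidean - (- V)))"
      using True by (simp add: W_def)
    ultimately show ?thesis
      unfolding riemann_sphere_def openin_Alexandroff_compactification by blast
  next
    case False
    then show ?thesis
      unfolding riemann_sphere_def openin_Alexandroff_compactification W_def using V by auto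
  qed
  moreover have "{x \<in> topspace (subtopology riemann_sphere (- (Some ` P))). mobius p x \<in> U} = W \<inter> - (Some ` P)"
  proof (rule set_eqI)
    fix x show "x \<in> {x \<in> topspace (subtopology riemann_sphere (- (Some ` P))). mobius p x \<in> U} \<longleftrightarrow> x \<in> W \<inter> - (Some ` P)"
      using assms by (cases x) (auto simp: riemann_sphere_def mobius_def W_def V_def)
  qed
  ultimately show "openin (subtopology riemann_sphere (- (Some ` P)))
     {x \<in> topspace (subtopology riemann_sphere (- (Some ` P))). mobius p x \<in> U}"
    by (auto simp: openin_subtopology)
qed auto

lemma sphere_homotopy_in_chart:
  assumes hom: "sphere_homotopic_paths P \<gamma> \<delta>" and p: "p \<in> P"
  obtains h :: "real \<times> real \<Rightarrow> complex" where "continuous_on ({0..1} \<times> {0..1}) h"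
    "\<And>x. x \<in> {0..1} \<times> {0..1} \<Longrightarrow> h x \<in> insert 0 ((\<lambda>u. 1 / (u - p)) ` (- P))"
    "\<And>t. t \<in> {0..1} \<Longrightarrow> h (0, t) = 1 / (\<gamma> t - p)" "\<And>t. t \<in> {0..1} \<Longrightarrow> h (1, t) = 1 / (\<delta> t - p)"
    "\<And>s. s \<in> {0..1} \<Longrightarrow> h (s, 0) = 1 / (\<gamma> 0 - p)" "\<And>s. s \<in> {0..1} \<Longrightarrow> h (s, 1) = 1 / (\<gamma> 1 - p)"
    "\<And>t. t \<in> {0..1} \<Longrightarrow> \<gamma> t \<notin> P" "\<And>t. t \<in> {0..1} \<Longrightarrow> \<delta> t \<notin> P"
proof -
  let ?S = "subtopology riemann_sphere (- (Some ` P))"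
  obtain k :: "real \<times> real \<Rightarrow> complex option"
    where k: "continuous_map (prod_topology (top_of_set {0..1}) (top_of_set {0..1})) ?S k"
      "\<forall>t. k (0, t) = (Some \<circ> \<gamma>) t" "\<forall>t. k (1, t) = (Some \<circ> \<delta>) t"
      "\<forall>s\<in>{0..1}. k (s, 0) = Some (pathstart \<gamma>) \<and> k (s, 1) = Some (pathfinish \<gamma>)"
    using hom unfolding sphere_homotopic_paths_def homotopic_with_def by blast
  have prod: "prod_topology (top_of_set {0..1}) (top_of_set {0..1}) = top_of_set ({0..1 :: real} \<times> {0..1 :: real})"
    by (simp add: prod_topology_subtopology_eu)
  have mem: "k x \<in> - (Some ` P)" if "x \<in> {0..1} \<times> {0..1}" for x
  proof -
    have "k ` ({0..1} \<times> {0..1}) \<subseteq> topspace ?S"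
      using continuous_map_image_subset_topspace[OF k(1)[unfolded prod]]
      unfolding topspace_euclidean_subtopology .
    then have "k x \<in> topspace ?S" using that by blast
    then show ?thesis unfolding topspace_subtopology by blast
  qed
  have "continuous_map (top_of_set ({0..1} \<times> {0..1})) euclidean (mobius p \<circ> k)"
    using continuous_map_compose[OF k(1) continuous_map_mobius[OF p]] unfolding prod .
  then have cont: "continuous_on ({0..1} \<times> {0..1}) (\<lambda>x. mobius p (k x))"
    by (simp add: o_def)
  show ?thesis
  proof (rule that[OF cont])
    show "mobius p (k x) \<in> insert 0 ((\<lambda>u. 1 / (u - p)) ` (- P))" if "x \<in> {0..1} \<times> {0..1}" for x
      using mem[OF that] by (cases "k x") (auto simp: mobius_def)
    show "\<gamma> t \<notin> P" "\<delta> t \<notin> P" if "t \<in> {0..1}" for t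
      using mem[of "(0, t)"] mem[of "(1, t)"] k(2,3) that by auto
  qed (use k in \<open>auto simp: mobius_def pathstart_def pathfinish_def\<close>)
qed

section \<open>Integrals along homotopic paths\<close>

context sq_straightening
begin

abbreviation "Ca \<equiv> z1 + cnj z1"
abbreviation "Cb \<equiv> z1 - cnj z1"
abbreviation "Cc \<equiv> 2 * z1"

text \<open>The plane of \<open>v = 1 / (u - z1)\<close> without the images of the three other points. \<open>chart_R\<close> is \<open>R\<close> in this coordinate.\<close>

definition chart_domain :: "complex set" where
  "chart_domain = {v. 1 + Ca * v \<noteq> 0 \<and> 1 + Cb * v \<noteq> 0 \<and> 1 + Cc * v \<noteq> 0}"

definition chart_R :: "complex \<Rightarrow> complex" where
  "chart_R v = ((1 + Ca * v) * (1 + Cb * v)) / (1 + Cc * v)"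

text \<open>This is \<open>a chart_R' / (v chart_R)\<close> in a form that shows its regularity at \<open>v = 0\<close>; the apparent pole cancels
  because \<open>Ca + Cb = Cc\<close>.\<close>

definition chart_form :: "complex \<Rightarrow> complex" where
  "chart_form v = a * (Cc\<^sup>2 / (1 + Cc * v) - Ca\<^sup>2 / (1 + Ca * v) - Cb\<^sup>2 / (1 + Cb * v))"

lemma open_chart_domain: "open chart_domain"
  unfolding chart_domain_def by (intro open_Collect_conj open_Collect_neq continuous_intros)

lemma chart_R_holomorphic: "chart_R holomorphic_on chart_domain"
  and chart_form_holomorphic: "chart_form holomorphic_on chart_domain"
  unfolding chart_R_def[abs_def] chart_form_def[abs_def]
  by (intro holomorphic_intros; simp add: chart_domain_def)+

lemma chart_R_nonzero: "v \<in> chart_domain \<Longrightarrow> chart_R v \<noteq> 0"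
  by (simp add: chart_R_def chart_domain_def)

lemma chart_factors:
  assumes "u \<noteq> z1"
  shows "1 + Ca * (1 / (u - z1)) = (u + cnj z1) / (u - z1)" "1 + Cb * (1 / (u - z1)) = (u - cnj z1) / (u - z1)"
    "1 + Cc * (1 / (u - z1)) = (u + z1) / (u - z1)"
  using assms by (auto simp: field_simps)

lemma chart_point:
  assumes "u \<notin> \<phi> ` corners"
  shows "1 / (u - z1) \<in> chart_domain" "chart_R (1 / (u - z1)) = R u"
proof -
  note nz = R_factors_nonzero[OF assms]
  have u: "u \<noteq> z1" using nz by simp
  show "1 / (u - z1) \<in> chart_domain"
    unfolding chart_domain_def mem_Collect_eq chart_factors[OF u] using nz by simp
  show "chart_R (1 / (u - z1)) = R u"
  proof -
    have "(p / m * (q / m)) / (r / m) = (p * q) / (m * r)" if "m \<noteq> 0" "r \<noteq> 0" for p q r m :: complex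
      using that by (simp add: field_simps)
    from this[OF nz(3,4)] show ?thesis unfolding chart_R_def chart_factors[OF u] R_def .
  qed
qed

lemma chart_log_derivative:
  assumes v: "v \<in> chart_domain" and \<Lambda>: "(\<Lambda> has_field_derivative D) (at v)"
    and S: "open S" "v \<in> S" "\<And>w. w \<in> S \<Longrightarrow> exp (\<Lambda> w) = chart_R w"
  shows "a * D = v * chart_form v"
proof -
  have nz: "1 + Ca * v \<noteq> 0" "1 + Cb * v \<noteq> 0" "1 + Cc * v \<noteq> 0" using v by (auto simp: chart_domain_def)
  have "((\<lambda>w. exp (\<Lambda> w)) has_field_derivative exp (\<Lambda> v) * D) (at v)"
    by (rule DERIV_chain2[OF DERIV_exp \<Lambda>])
  then have 1: "(chart_R has_field_derivative chart_R v * D) (at v)"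
    unfolding S(3)[OF S(2), symmetric]
    by (rule has_field_derivative_transform_within_open[OF _ S(1,2)]) (simp add: S(3))
  have lin: "((\<lambda>w. 1 + c * w) has_field_derivative c) (at v)" for c :: complex
    by (auto intro!: derivative_eq_intros)
  have quot: "((\<alpha> * q + \<beta> * p) * r - p * q * \<gamma>) / (r * r) = p * q / r * (\<alpha> / p + \<beta> / q - \<gamma> / r)"
    if "p \<noteq> 0" "q \<noteq> 0" "r \<noteq> 0" for p q r \<alpha> \<beta> \<gamma> :: complex
    using that by (simp add: field_simps)
  have 2: "(chart_R has_field_derivative chart_R v * (Ca / (1 + Ca * v) + Cb / (1 + Cb * v) - Cc / (1 + Cc * v))) (at v)"
    unfolding chart_R_def[abs_def]
    by (rule DERIV_cong[OF DERIV_divide[OF DERIV_mult[OF lin lin] lin nz(3)]]) (rule quot[OF nz])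
  have D: "D = Ca / (1 + Ca * v) + Cb / (1 + Cb * v) - Cc / (1 + Cc * v)"
    using DERIV_unique[OF 1 2] chart_R_nonzero[OF v] by simp
  have split: "v * (c\<^sup>2 / (1 + c * v)) = c - c / (1 + c * v)" if "1 + c * v \<noteq> 0" for c
    using that by (simp add: field_simps power2_eq_square)
  have "v * chart_form v = a * (v * (Cc\<^sup>2 / (1 + Cc * v)) - v * (Ca\<^sup>2 / (1 + Ca * v)) - v * (Cb\<^sup>2 / (1 + Cb * v)))"
    by (simp add: chart_form_def algebra_simps)
  also have "\<dots> = a * D"
    unfolding split[OF nz(1)] split[OF nz(2)] split[OF nz(3)] D by (simp add: algebra_simps)
  finally show ?thesis by simp
qed

text \<open>The branch in the variable \<open>u\<close> is recovered as the derivative of \<open>(u - z1)\<close> times the branch minus the regular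
  primitive \<open>\<Phi>\<close>.\<close>

lemma branch_primitive_in_chart:
  assumes X: "ball v0 r \<subseteq> chart_domain" and \<Lambda>: "\<Lambda> holomorphic_on ball v0 r" "\<And>v. v \<in> ball v0 r \<Longrightarrow> exp (\<Lambda> v) = chart_R v"
    and \<Phi>: "\<And>v. v \<in> ball v0 r \<Longrightarrow> (\<Phi> has_field_derivative exp (a * \<Lambda> v) * chart_form v) (at v)"
    and u: "u \<noteq> z1" "1 / (u - z1) \<in> ball v0 r"
  shows "((\<lambda>u. exp (a * \<Lambda> (1 / (u - z1))) * (u - z1) - \<Phi> (1 / (u - z1)))
    has_field_derivative exp (a * \<Lambda> (1 / (u - z1)))) (at u)"
proof -
  define v where "v = 1 / (u - z1)"
  have v: "v \<in> ball v0 r" "v \<noteq> 0" "v * (u - z1) = 1" using u by (auto simp: v_def)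
  have dv: "((\<lambda>u. 1 / (u - z1)) has_field_derivative - (v * v)) (at u)"
    using u(1) by (auto intro!: derivative_eq_intros simp: v_def)
  obtain D where D: "(\<Lambda> has_field_derivative D) (at v)"
    using \<Lambda>(1) v(1) by (meson holomorphic_derivI open_ball)
  have aD: "a * D = v * chart_form v"
    by (rule chart_log_derivative[OF _ D open_ball v(1) \<Lambda>(2)]) (use v(1) X in auto)
  have d\<Lambda>: "((\<lambda>u. \<Lambda> (1 / (u - z1))) has_field_derivative D * - (v * v)) (at u)"
    using DERIV_chain2[OF _ dv, of \<Lambda> D] D by (simp add: v_def)
  have d\<Phi>: "((\<lambda>u. \<Phi> (1 / (u - z1))) has_field_derivative (exp (a * \<Lambda> v) * chart_form v) * - (v * v)) (at u)"
    using DERIV_chain2[OF _ dv, of \<Phi> "exp (a * \<Lambda> v) * chart_form v"] \<Phi>[OF v(1)] by (simp add: v_def)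
  have dE: "((\<lambda>u. exp (a * \<Lambda> (1 / (u - z1)))) has_field_derivative exp (a * \<Lambda> v) * (a * (D * - (v * v)))) (at u)"
    using DERIV_chain2[OF DERIV_exp DERIV_cmult[OF d\<Lambda>, of a]] by (simp add: v_def)
  have deriv: "((\<lambda>u. exp (a * \<Lambda> (1 / (u - z1))) * (u - z1) - \<Phi> (1 / (u - z1))) has_field_derivative
      (exp (a * \<Lambda> v) * (a * (D * - (v * v))) * (u - z1) + 1 * exp (a * \<Lambda> (1 / (u - z1))))
      - (exp (a * \<Lambda> v) * chart_form v) * - (v * v)) (at u)"
    by (intro DERIV_diff DERIV_mult dE d\<Phi>) (auto intro!: derivative_eq_intros)
  have "exp (a * \<Lambda> v) * (a * (D * - (v * v))) * (u - z1)
      = - (exp (a * \<Lambda> v) * (a * D) * v * (v * (u - z1)))" by (simp add: algebra_simps)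
  also have "\<dots> = (exp (a * \<Lambda> v) * chart_form v) * - (v * v)"
    unfolding aD v(3) by simp
  finally have eq: "exp (a * \<Lambda> v) * (a * (D * - (v * v))) * (u - z1) = (exp (a * \<Lambda> v) * chart_form v) * - (v * v)" .
  show ?thesis
    by (rule DERIV_cong[OF deriv]) (simp only: eq mult_1 add_diff_cancel_left')
qed

text \<open>The function \<open>P\<close> below is \<open>(u - z1)\<close> times the branch minus the regular primitive along the homotopy. On the side of \<open>\<delta>\<close> it
  differs from \<open>dev\<close> by a constant, on the side of \<open>\<gamma>\<close> its derivative is the integrand, and on the two remaining sides, where
  the homotopy stands still, nothing changes.\<close>

theorem integral_along_homotopic_path:
  assumes \<gamma>: "valid_path \<gamma>" and \<delta>: "path \<delta>" "\<And>t. t \<in> {0..1} \<Longrightarrow> \<delta> t \<in> \<Omega>"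
    and hom: "sphere_homotopic_paths (\<phi> ` corners) \<gamma> \<delta>"
    and \<tau>: "\<tau> holomorphic_on \<Omega>" "\<And>u. u \<in> \<Omega> \<Longrightarrow> exp (\<tau> u) = R u" "\<And>u. u \<in> \<Omega> \<Longrightarrow> deriv dev u = exp (a * \<tau> u)"
  obtains L where "continuous_on {0..1} L" "\<And>t. t \<in> {0..1} \<Longrightarrow> exp (L t) = R (\<gamma> t)" "L 0 = \<tau> (\<delta> 0)"
    "((\<lambda>t. exp (a * L t) * vector_derivative \<gamma> (at t within {0..1})) has_integral (dev (\<delta> 1) - dev (\<delta> 0))) {0..1}"
proof -
  have z1c: "z1 \<in> \<phi> ` corners" by (simp add: corners_image)
  obtain h :: "real \<times> real \<Rightarrow> complex" where h: "continuous_on ({0..1} \<times> {0..1}) h"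
    and hmem: "\<And>x. x \<in> {0..1} \<times> {0..1} \<Longrightarrow> h x \<in> insert 0 ((\<lambda>u. 1 / (u - z1)) ` (- \<phi> ` corners))"
    and h0: "\<And>t. t \<in> {0..1} \<Longrightarrow> h (0, t) = 1 / (\<gamma> t - z1)" and h1: "\<And>t. t \<in> {0..1} \<Longrightarrow> h (1, t) = 1 / (\<delta> t - z1)"
    and hs0: "\<And>s. s \<in> {0..1} \<Longrightarrow> h (s, 0) = 1 / (\<gamma> 0 - z1)" and hs1: "\<And>s. s \<in> {0..1} \<Longrightarrow> h (s, 1) = 1 / (\<gamma> 1 - z1)"
    and \<gamma>c: "\<And>t. t \<in> {0..1} \<Longrightarrow> \<gamma> t \<notin> \<phi> ` corners" and \<delta>c: "\<And>t. t \<in> {0..1} \<Longrightarrow> \<delta> t \<notin> \<phi> ` corners"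
    by (rule sphere_homotopy_in_chart[OF hom z1c]) blast
  define Q where "Q = {0..1 :: real} \<times> {0..1 :: real}"
  have Q: "convex Q" "compact Q" "(0, 0) \<in> Q" by (auto simp: Q_def compact_Times convex_Times)
  have Qm: "(s, t) \<in> Q" if "s \<in> {0..1}" "t \<in> {0..1}" for s t using that by (simp add: Q_def)
  have hX: "h ` Q \<subseteq> chart_domain"
  proof (rule image_subsetI)
    fix x assume "x \<in> Q"
    then consider "h x = 0" | u where "u \<notin> \<phi> ` corners" "h x = 1 / (u - z1)"
      using hmem[of x] by (auto simp: Q_def)
    then show "h x \<in> chart_domain"
      by cases (use chart_point(1) in \<open>auto simp: chart_domain_def\<close>)
  qed
  have hQ: "continuous_on Q h" using h by (simp add: Q_def)
  obtain L0 where L0: "continuous_on Q L0" "\<And>x. x \<in> Q \<Longrightarrow> chart_R (h x) = exp (L0 x)"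
  proof (rule continuous_logarithm_on_contractible[of Q "\<lambda>x. chart_R (h x)"])
    show "continuous_on Q (\<lambda>x. chart_R (h x))"
      by (rule continuous_on_compose2[OF holomorphic_on_imp_continuous_on[OF chart_R_holomorphic] hQ hX])
    show "contractible Q" by (rule convex_imp_contractible[OF Q(1)])
    show "chart_R (h x) \<noteq> 0" if "x \<in> Q" for x using that hX chart_R_nonzero by blast
  qed blast
  \<comment> \<open>start the logarithm at the value of the given branch\<close>
  define L where "L = (\<lambda>x. L0 x + (\<tau> (\<delta> 0) - L0 (0, 0)))"
  have "exp (\<tau> (\<delta> 0)) = chart_R (h (0, 0))"
    using \<tau>(2)[OF \<delta>(2)[of 0]] hs0[of 1] hs0[of 0] h1[of 0] chart_point(2)[OF \<delta>c[of 0]] by simp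
  then have "exp (\<tau> (\<delta> 0) - L0 (0, 0)) = 1" using L0(2)[OF Q(3)] by (simp add: exp_diff)
  then have L: "continuous_on Q L" "\<And>x. x \<in> Q \<Longrightarrow> exp (L x) = chart_R (h x)" "L (0, 0) = \<tau> (\<delta> 0)"
    using L0 by (auto simp: L_def exp_add intro!: continuous_intros)
  obtain J d r \<Lambda> \<Phi> where J: "0 < d" "0 < r"
    "\<And>y. y \<in> Q \<Longrightarrow> ball (h y) r \<subseteq> chart_domain"
    "\<And>y. y \<in> Q \<Longrightarrow> \<Lambda> y holomorphic_on ball (h y) r"
    "\<And>y u. y \<in> Q \<Longrightarrow> u \<in> ball (h y) r \<Longrightarrow> exp (\<Lambda> y u) = chart_R u"
    "\<And>y u. y \<in> Q \<Longrightarrow> u \<in> ball (h y) r \<Longrightarrow> (\<Phi> y has_field_derivative exp (a * \<Lambda> y u) * chart_form u) (at u)"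
    "\<And>x y. y \<in> Q \<Longrightarrow> x \<in> Q \<Longrightarrow> dist x y < d \<Longrightarrow> h x \<in> ball (h y) r"
    "\<And>x y. y \<in> Q \<Longrightarrow> x \<in> Q \<Longrightarrow> dist x y < d \<Longrightarrow> \<Lambda> y (h x) = L x"
    "\<And>x y. y \<in> Q \<Longrightarrow> x \<in> Q \<Longrightarrow> dist x y < d \<Longrightarrow> J x - J y = \<Phi> y (h x)"
    by (rule primitive_along_homotopy[OF Q open_chart_domain chart_R_holomorphic chart_R_nonzero
          chart_form_holomorphic hQ hX L(1,2), of a]) blast+
  \<comment> \<open>primitives of the branch in the variable \<open>u\<close>\<close>
  define \<Psi> where "\<Psi> = (\<lambda>y u. exp (a * \<Lambda> y (1 / (u - z1))) * (u - z1) - \<Phi> y (1 / (u - z1)))"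
  have d\<Psi>: "(\<Psi> y has_field_derivative exp (a * \<Lambda> y (1 / (u - z1)))) (at u)"
    if "y \<in> Q" "u \<noteq> z1" "1 / (u - z1) \<in> ball (h y) r" for y u
    unfolding \<Psi>_def using branch_primitive_in_chart[OF J(3)[OF that(1)] J(4)[OF that(1)] J(5)[OF that(1)] J(6)[OF that(1)] that(2,3)] .
  define P where "P = (\<lambda>x u. exp (a * L x) * (u - z1) - J x)"
  have P\<Psi>: "P x u = \<Psi> y u - J y" if "x \<in> Q" "y \<in> Q" "dist x y < d" "h x = 1 / (u - z1)" for x y u
    using J(8)[OF that(2,1,3)] J(9)[OF that(2,1,3)] that(4) by (simp add: P_def \<Psi>_def algebra_simps)
  have dist_eq: "dist (s, t) (s, t') = dist t t'" "dist (s, t) (s', t) = dist s s'" for s t s' t' :: real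
    by (simp_all add: dist_prod_def)
  have corner: "u \<noteq> z1" if "u \<notin> \<phi> ` corners" for u using that z1c by blast
  \<comment> \<open>along an edge of the parameter square on which the homotopy stands still, the logarithm and the primitive are constant\<close>
  have side: "L (s, t) = L (0, t) \<and> J (s, t) = J (0, t)"
    if t: "t \<in> {0..1}" and const: "\<And>s. s \<in> {0..1} \<Longrightarrow> h (s, t) = h (0, t)" and s: "s \<in> {0..1}" for s t
  proof
    show "L (s, t) = L (0, t)"
    proof (rule continuous_logs_eq[of "{0..1}" "\<lambda>s. L (s, t)" "\<lambda>s. L (0, t)" 0])
      show "continuous_on {0..1} (\<lambda>s. L (s, t))"
        by (rule continuous_on_compose2[OF L(1)]) (use t in \<open>auto intro!: continuous_intros simp: Q_def\<close>)
      show "exp (L (s, t)) = exp (L (0, t))" if "s \<in> {0..1}" for s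
        using L(2)[OF Qm[OF that t]] L(2)[OF Qm[OF _ t, of 0]] const[OF that] by simp
    qed (use s in auto)
    have "(\<lambda>s. J (s, t)) constant_on {0..1}"
    proof (rule locally_constant_imp_constant)
      fix s :: real assume s: "s \<in> {0..1}"
      have "J (s', t) = J (s, t)" if s': "s' \<in> {0..1} \<inter> ball s d" for s'
      proof -
        have "J (s', t) - J (s, t) = \<Phi> (s, t) (h (s', t))"
          using s s' t by (intro J(9) Qm) (auto simp: dist_eq dist_commute)
        also have "h (s', t) = h (s, t)" using const[OF s] const[of s'] s' by (metis IntD1)
        also have "\<Phi> (s, t) (h (s, t)) = J (s, t) - J (s, t)"
          using s t J(1) by (intro J(9)[symmetric] Qm) auto
        finally show ?thesis by simp
      qed
      moreover have "openin (top_of_set {0..1}) ({0..1} \<inter> ball s d)" by (rule openin_open_Int) simp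
      moreover have "s \<in> {0..1} \<inter> ball s d" using s J(1) by simp
      ultimately show "\<exists>T. openin (top_of_set {0..1}) T \<and> s \<in> T \<and> (\<forall>x\<in>T. J (x, t) = J (s, t))"
        by blast
    qed simp
    then show "J (s, t) = J (0, t)"
      using s unfolding constant_on_def by (metis atLeastAtMost_iff order_refl zero_le_one)
  qed
  have "h (s, 0) = h (0, 0)" "h (s, 1) = h (0, 1)" if "s \<in> {0..1}" for s
    using hs0[OF that] hs0[of 0] hs1[OF that] hs1[of 0] by simp_all
  from side[of 0 1, OF _ this(1)] side[of 1 1, OF _ this(2)]
  have sides: "L (1, 0) = L (0, 0)" "J (1, 0) = J (0, 0)" "L (1, 1) = L (0, 1)" "J (1, 1) = J (0, 1)"
    by simp_all
  have ends: "\<gamma> 0 = \<delta> 0" "\<gamma> 1 = \<delta> 1"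
  proof -
    have "1 / (\<gamma> 0 - z1) = 1 / (\<delta> 0 - z1)" "1 / (\<gamma> 1 - z1) = 1 / (\<delta> 1 - z1)"
      using hs0[of 1] hs1[of 1] h1[of 0] h1[of 1] by simp_all
    then show "\<gamma> 0 = \<delta> 0" "\<gamma> 1 = \<delta> 1" by simp_all
  qed
  have c\<delta>: "continuous_on {0..1} \<delta>" using \<delta>(1) by (simp add: path_def)
  have c\<gamma>: "continuous_on {0..1} \<gamma>" using valid_path_imp_path[OF \<gamma>] by (simp add: path_def)
  have L1: "L (1, t) = \<tau> (\<delta> t)" if "t \<in> {0..1}" for t
  proof (rule continuous_logs_eq[of "{0..1}" "\<lambda>t. L (1, t)" "\<lambda>t. \<tau> (\<delta> t)" 0])
    show "continuous_on {0..1} (\<lambda>t. L (1, t))"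
      by (rule continuous_on_compose2[OF L(1)]) (auto intro!: continuous_intros simp: Q_def)
    show "continuous_on {0..1} (\<lambda>t. \<tau> (\<delta> t))"
      by (rule continuous_on_compose2[OF holomorphic_on_imp_continuous_on[OF \<tau>(1)] c\<delta>]) (use \<delta>(2) in auto)
    show "exp (L (1, t)) = exp (\<tau> (\<delta> t))" if "t \<in> {0..1}" for t
      using L(2)[OF Qm[of 1 t]] h1[OF that] chart_point(2)[OF \<delta>c[OF that]] \<tau>(2)[OF \<delta>(2)[OF that]] that by simp
    show "L (1, 0) = \<tau> (\<delta> 0)" using sides(1) L(3) by simp
  qed (use that in auto)
  \<comment> \<open>on the side of \<open>\<delta>\<close> the local primitives agree with \<open>dev\<close> up to constants, since both have the branch as derivative\<close>
  have "(\<lambda>t. P (1, t) (\<delta> t) - dev (\<delta> t)) constant_on {0..1}"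
  proof (rule locally_constant_imp_constant)
    fix t :: real assume t: "t \<in> {0..1}"
    define y where "y = (1 :: real, t)"
    have y: "y \<in> Q" using t by (simp add: y_def Q_def)
    define S where "S = \<Omega> \<inter> {u \<in> - {z1}. 1 / (u - z1) \<in> ball (h y) r}"
    have "open {u \<in> - {z1}. 1 / (u - z1) \<in> ball (h y) r}"
    proof -
      have "continuous_on (- {z1}) (\<lambda>u. 1 / (u - z1))" by (auto intro!: continuous_intros)
      from continuous_open_preimage[OF this open_Compl[OF closed_singleton] open_ball]
      show ?thesis by (simp add: vimage_def Int_def)
    qed
    then have "open S" unfolding S_def by (intro open_Int open_\<Omega>)
    moreover have "\<delta> t \<in> S" using \<delta>(2)[OF t] corner[OF \<delta>c[OF t]] h1[OF t] J(2) by (auto simp: S_def y_def)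
    ultimately obtain e where e: "0 < e" "ball (\<delta> t) e \<subseteq> S" by (meson openE)
    have log_eq: "\<Lambda> y (1 / (u - z1)) = \<tau> u" if u: "u \<in> ball (\<delta> t) e" for u
    proof (rule continuous_logs_eq[of "ball (\<delta> t) e" "\<lambda>u. \<Lambda> y (1 / (u - z1))" \<tau> "\<delta> t"])
      have sub: "ball (\<delta> t) e \<subseteq> \<Omega>" using e(2) by (auto simp: S_def)
      show "continuous_on (ball (\<delta> t) e) \<tau>"
        using holomorphic_on_imp_continuous_on[OF \<tau>(1)] sub by (rule continuous_on_subset)
      show "continuous_on (ball (\<delta> t) e) (\<lambda>u. \<Lambda> y (1 / (u - z1)))"
        by (rule continuous_on_compose2[OF holomorphic_on_imp_continuous_on[OF J(4)[OF y]]])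
          (use e(2) in \<open>auto simp: S_def intro!: continuous_intros\<close>)
      show "exp (\<Lambda> y (1 / (w - z1))) = exp (\<tau> w)" if "w \<in> ball (\<delta> t) e" for w
      proof -
        have w: "w \<in> \<Omega>" "1 / (w - z1) \<in> ball (h y) r" using that e(2) by (auto simp: S_def)
        then have "w \<notin> \<phi> ` corners" using \<Omega>_no_corner by blast
        then show ?thesis using J(5)[OF y w(2)] \<tau>(2)[OF w(1)] chart_point(2) by simp
      qed
      show "\<Lambda> y (1 / (\<delta> t - z1)) = \<tau> (\<delta> t)"
        using J(8)[OF y y] J(1) L1[OF t] h1[OF t] by (simp add: y_def)
    qed (use u e in auto)
    have "(\<lambda>u. \<Psi> y u - dev u) constant_on ball (\<delta> t) e"
    proof (rule has_field_derivative_0_imp_constant_on)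
      fix u assume u: "u \<in> ball (\<delta> t) e"
      then have "u \<in> S" using e(2) by blast
      then have uS: "u \<in> \<Omega>" "u \<noteq> z1" "1 / (u - z1) \<in> ball (h y) r" by (auto simp: S_def)
      have "(dev has_field_derivative exp (a * \<tau> u)) (at u)"
        using holomorphic_derivI[OF dev_holomorphic open_\<Omega> uS(1)] \<tau>(3)[OF uS(1)] by simp
      from DERIV_diff[OF d\<Psi>[OF y uS(2,3)] this]
      show "((\<lambda>u. \<Psi> y u - dev u) has_field_derivative 0) (at u)"
        using log_eq[OF u] by simp
    qed auto
    then have \<Psi>dev: "\<Psi> y u - dev u = \<Psi> y (\<delta> t) - dev (\<delta> t)" if "u \<in> ball (\<delta> t) e" for u
      using that e(1) unfolding constant_on_def by (metis centre_in_ball)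
    obtain e' where e': "0 < e'" "\<And>t'. t' \<in> {0..1} \<Longrightarrow> dist t' t < e' \<Longrightarrow> dist (\<delta> t') (\<delta> t) < e"
      using c\<delta> t e(1) unfolding continuous_on_iff by metis
    have "P (1, t') (\<delta> t') - dev (\<delta> t') = P (1, t) (\<delta> t) - dev (\<delta> t)" if t': "t' \<in> {0..1} \<inter> ball t (min d e')" for t'
    proof -
      have t'1: "t' \<in> {0..1}" "dist t' t < d" "dist t' t < e'" using t' by (auto simp: dist_commute)
      have p1: "P (1, t') (\<delta> t') = \<Psi> y (\<delta> t') - J y"
        by (rule P\<Psi>) (use t'1 y h1 in \<open>auto simp: y_def Q_def dist_eq\<close>)
      have p2: "P (1, t) (\<delta> t) = \<Psi> y (\<delta> t) - J y"
        by (rule P\<Psi>) (use t y h1 J(1) in \<open>auto simp: y_def Q_def dist_eq\<close>)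
      have "\<delta> t' \<in> ball (\<delta> t) e" using e'(2)[OF t'1(1,3)] by (simp add: dist_commute)
      note same = \<Psi>dev[OF this]
      have "P (1, t') (\<delta> t') - dev (\<delta> t') = \<Psi> y (\<delta> t') - dev (\<delta> t') - J y"
        unfolding p1 by (simp add: algebra_simps)
      also have "\<dots> = P (1, t) (\<delta> t) - dev (\<delta> t)"
        unfolding same p2 by (simp add: algebra_simps)
      finally show ?thesis .
    qed
    moreover have "openin (top_of_set {0..1}) ({0..1} \<inter> ball t (min d e'))" by (rule openin_open_Int) simp
    moreover have "t \<in> {0..1} \<inter> ball t (min d e')" using t J(1) e'(1) by simp
    ultimately show "\<exists>T. openin (top_of_set {0..1}) T \<and> t \<in> T \<and> (\<forall>x\<in>T. P (1, x) (\<delta> x) - dev (\<delta> x) = P (1, t) (\<delta> t) - dev (\<delta> t))"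
      by blast
  qed simp
  then have P1: "P (1, 1) (\<delta> 1) - dev (\<delta> 1) = P (1, 0) (\<delta> 0) - dev (\<delta> 0)"
    unfolding constant_on_def by (metis atLeastAtMost_iff order_refl zero_le_one)
  define p where "p = (\<lambda>t. P (0, t) (\<gamma> t))"
  have p_local: "p t' = \<Psi> (0, t) (\<gamma> t') - J (0, t)" if "t \<in> {0..1}" "t' \<in> {0..1}" "dist t' t < d" for t t'
    unfolding p_def by (rule P\<Psi>) (use that h0 in \<open>auto simp: Q_def dist_eq\<close>)
  have d\<Psi>\<gamma>: "(\<Psi> (0, t) has_field_derivative exp (a * L (0, t))) (at (\<gamma> t))" if t: "t \<in> {0..1}" for t
  proof -
    have y: "(0, t) \<in> Q" using t by (simp add: Q_def)
    have "\<Lambda> (0, t) (1 / (\<gamma> t - z1)) = L (0, t)" using J(8)[OF y y] J(1) h0[OF t] by simp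
    then show ?thesis using d\<Psi>[OF y corner[OF \<gamma>c[OF t]]] h0[OF t] J(2) by simp
  qed
  have cont_p: "continuous_on {0..1} p"
    unfolding continuous_on_eq_continuous_within
  proof
    fix t :: real assume t: "t \<in> {0..1}"
    have "isCont (\<Psi> (0, t)) (\<gamma> t)" using d\<Psi>\<gamma>[OF t] by (rule DERIV_isCont)
    moreover have "continuous (at t within {0..1}) \<gamma>"
      using c\<gamma> t by (simp add: continuous_on_eq_continuous_within)
    ultimately have "continuous (at t within {0..1}) (\<lambda>t'. \<Psi> (0, t) (\<gamma> t'))"
      by (rule continuous_within_compose3)
    then have "continuous (at t within {0..1}) (\<lambda>t'. \<Psi> (0, t) (\<gamma> t') - J (0, t))"
      by (intro continuous_diff continuous_const)
    then show "continuous (at t within {0..1}) p"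
      by (rule continuous_transform_within[OF _ J(1) t]) (simp add: p_local[OF t])
  qed
  obtain E where E: "finite E" "\<gamma> C1_differentiable_on ({0..1} - E)"
    using \<gamma> by (auto simp: valid_path_def piecewise_C1_differentiable_on_def)
  have "((\<lambda>t. exp (a * L (0, t)) * vector_derivative \<gamma> (at t within {0..1})) has_integral (p 1 - p 0)) {0..1}"
  proof (rule fundamental_theorem_of_calculus_interior_strong[OF E(1) zero_le_one _ cont_p])
    fix t :: real assume t: "t \<in> {0<..<1} - E"
    then have t01: "t \<in> {0..1}" by auto
    have at_eq: "at t within {0..1} = at t" using t by (intro at_within_interior) auto
    have "\<gamma> differentiable at t" using E(2) t by (auto simp: C1_differentiable_on_eq)
    then have "(\<gamma> has_vector_derivative vector_derivative \<gamma> (at t)) (at t)"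
      by (simp add: vector_derivative_works)
    from field_vector_diff_chain_at[OF this d\<Psi>\<gamma>[OF t01]]
    have "((\<lambda>t'. \<Psi> (0, t) (\<gamma> t') - J (0, t)) has_vector_derivative vector_derivative \<gamma> (at t) * exp (a * L (0, t))) (at t)"
      unfolding o_def by (auto intro!: derivative_eq_intros)
    then have "(p has_vector_derivative vector_derivative \<gamma> (at t) * exp (a * L (0, t))) (at t)"
    proof (rule has_vector_derivative_transform_within_open)
      show "open ({0<..<1} \<inter> ball t d)" by (intro open_Int) simp_all
      show "t \<in> {0<..<1} \<inter> ball t d" using t J(1) by simp
      show "\<Psi> (0, t) (\<gamma> t') - J (0, t) = p t'" if "t' \<in> {0<..<1} \<inter> ball t d" for t'
        using p_local[OF t01, of t'] that by (simp add: dist_commute)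
    qed
    then show "(p has_vector_derivative exp (a * L (0, t)) * vector_derivative \<gamma> (at t within {0..1})) (at t)"
      unfolding at_eq by (simp add: mult.commute)
  qed
  moreover have "p 1 - p 0 = dev (\<delta> 1) - dev (\<delta> 0)"
    using P1 by (simp add: p_def P_def ends sides algebra_simps)
  ultimately have int: "((\<lambda>t. exp (a * L (0, t)) * vector_derivative \<gamma> (at t within {0..1})) has_integral (dev (\<delta> 1) - dev (\<delta> 0))) {0..1}"
    by simp
  show ?thesis
  proof (rule that[of "\<lambda>t. L (0, t)"])
    show "continuous_on {0..1} (\<lambda>t. L (0, t))"
      by (rule continuous_on_compose2[OF L(1)]) (auto intro!: continuous_intros simp: Q_def)
    show "exp (L (0, t)) = R (\<gamma> t)" if "t \<in> {0..1}" for t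
      using L(2)[OF Qm[of 0 t]] h0[OF that] chart_point(2)[OF \<gamma>c[OF that]] that by simp
  qed (use L(3) int in auto)
qed

end

section \<open>The inverse of the straightening as an integral\<close>

context sq_straightening
begin

lemma vstretch_dev: "g u \<in> Sq \<Longrightarrow> vstretch K (dev u) = g u"
  using K_pos by (simp add: dev_def develop_Sq)

lemma edge_region_subset_\<Omega>: "\<phi> ` (Sq - corners) \<subseteq> \<Omega>"
proof -
  have "Sq - corners \<subseteq> cross" using not_corner by blast
  then show ?thesis unfolding \<Omega>_def by blast
qed

text \<open>Pull back the segment from 0 to \<open>dev z\<close>. Under \<open>g\<close> it is the segment from 0 to \<open>g z\<close>, which stays in the square and meets no
  corner.\<close>

lemma joining_path_exists:
  assumes z: "z \<in> \<phi> ` (Sq - corners)"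
  obtains \<gamma> where "valid_path \<gamma>" "pathstart \<gamma> = 0" "pathfinish \<gamma> = z" "path_image \<gamma> \<subseteq> \<phi> ` (Sq - corners)"
proof -
  obtain G where G: "G holomorphic_on dev ` \<Omega>" "\<And>u. u \<in> \<Omega> \<Longrightarrow> G (dev u) = u"
    using holomorphic_has_inverse[OF dev_holomorphic open_\<Omega> inj_on_subset[OF inj_dev subset_UNIV]] by metis
  have opn: "open (dev ` \<Omega>)"
    by (rule open_mapping_thm3[OF dev_holomorphic open_\<Omega> inj_on_subset[OF inj_dev subset_UNIV]])
  have gz: "g z \<in> Sq - corners" using z by auto
  define q where "q = (\<lambda>t. \<phi> (t *\<^sub>R g z))"
  have q: "q t \<in> \<phi> ` (Sq - corners)" "dev (q t) = t *\<^sub>R dev z" if t: "0 \<le> t" "t \<le> 1" for t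
  proof -
    have le: "\<bar>t * x\<bar> \<le> t" if "\<bar>x\<bar> \<le> 1" for x
      using that t mult_left_mono[of "\<bar>x\<bar>" 1 t] by (simp add: abs_mult)
    have sq: "\<bar>Re (g z)\<bar> \<le> 1" "\<bar>Im (g z)\<bar> \<le> 1" using gz by (auto simp: Sq_def)
    then have tSq: "t *\<^sub>R g z \<in> Sq" using le[OF sq(1)] le[OF sq(2)] t by (auto simp: Sq_def)
    have "t *\<^sub>R g z \<notin> corners"
    proof
      assume "t *\<^sub>R g z \<in> corners"
      then have "\<bar>t * Re (g z)\<bar> = 1" by (auto simp: corners_def complex_eq_iff)
      then have "t = 1" using le[OF sq(1)] t by simp
      then show False using gz \<open>t *\<^sub>R g z \<in> corners\<close> by simp
    qed
    then show "q t \<in> \<phi> ` (Sq - corners)" using tSq by (simp add: q_def)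
    show "dev (q t) = t *\<^sub>R dev z"
      using tSq gz by (simp add: q_def dev_def develop_Sq complex_eq_iff)
  qed
  define \<gamma> where "\<gamma> = G \<circ> linepath 0 (dev z)"
  have line: "linepath 0 (dev z) t = dev (q t)" if "t \<in> {0..1}" for t
    using q(2)[of t] that by (simp add: linepath_def)
  have \<gamma>q: "\<gamma> t = q t" if "t \<in> {0..1}" for t
    using line[OF that] q(1)[of t] that G(2)[of "q t"] edge_region_subset_\<Omega> by (auto simp: \<gamma>_def)
  have "path_image (linepath 0 (dev z)) \<subseteq> dev ` \<Omega>"
    unfolding path_image_def using line q(1) edge_region_subset_\<Omega> by fastforce
  then have "valid_path \<gamma>"
    unfolding \<gamma>_def by (intro valid_path_compose_holomorphic[OF _ G(1) opn]) auto
  moreover have "pathstart \<gamma> = 0" "pathfinish \<gamma> = z"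
    using \<gamma>q[of 0] \<gamma>q[of 1] by (simp_all add: pathstart_def pathfinish_def q_def \<phi>_0)
  moreover have "path_image \<gamma> \<subseteq> \<phi> ` (Sq - corners)"
    unfolding path_image_def using \<gamma>q q(1) by auto
  ultimately show ?thesis by (rule that)
qed

lemma sphere_homotopic_paths_refl:
  assumes "path \<gamma>" "path_image \<gamma> \<inter> P = {}"
  shows "sphere_homotopic_paths P \<gamma> \<gamma>"
proof -
  have "continuous_map (top_of_set {0..1}) euclidean \<gamma>"
    using assms(1) by (simp add: path_def)
  then have "continuous_map (top_of_set {0..1}) riemann_sphere (Some \<circ> \<gamma>)"
    unfolding riemann_sphere_def by (rule continuous_map_compose[OF _ continuous_map_Some])
  then have "continuous_map (top_of_set {0..1}) (subtopology riemann_sphere (- (Some ` P))) (Some \<circ> \<gamma>)"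
    using assms(2) by (auto simp: continuous_map_in_subtopology path_image_def)
  then show ?thesis
    unfolding sphere_homotopic_paths_def by (simp add: pathstart_def pathfinish_def)
qed

lemma Arg_z1: "(THE \<theta>. \<theta> \<in> {0<..<pi/2} \<and> is_Arg z1 \<theta>) = Arg z1"
proof (rule the_equality)
  have z0: "z1 \<noteq> 0" using z1_quadrant by auto
  have "0 < Im (Ln z1)" "Im (Ln z1) < pi / 2"
    using Im_Ln_pos_lt_imp[of z1] Re_Ln_pos_lt[OF z0] z1_quadrant by auto
  moreover have is_Arg: "is_Arg z1 (Arg z1)" using is_Arg_Arg[OF z0] .
  ultimately show A: "Arg z1 \<in> {0<..<pi/2} \<and> is_Arg z1 (Arg z1)" using z0 by (simp add: Arg_eq_Im_Ln)
  show "\<theta> = Arg z1" if "\<theta> \<in> {0<..<pi/2} \<and> is_Arg z1 \<theta>" for \<theta>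
    by (rule is_Arg_eqI[of z1]) (use that A z0 in auto)
qed

text \<open>A path inside the image of the square is homotopic to itself, so both cases are covered by
  \<open>integral_along_homotopic_path\<close>.\<close>

theorem inverse_eq_branch_integral:
  assumes z: "z \<in> \<phi> ` (Sq - corners)" and b: "b = of_real (exp (- 2 * Arg z1 * ln K / pi))"
    and \<gamma>: "valid_path \<gamma>" "pathstart \<gamma> = 0" "pathfinish \<gamma> = z"
    and hom: "path_image \<gamma> \<subseteq> \<phi> ` (Sq - corners) \<or>
         (\<exists>\<delta>. path \<delta> \<and> pathstart \<delta> = 0 \<and> pathfinish \<delta> = z \<and> path_image \<delta> \<subseteq> \<phi> ` (Sq - corners) \<and>
              sphere_homotopic_paths (\<phi> ` corners) \<gamma> \<delta>)"
  shows "\<exists>B. branch_along \<gamma> R a b B"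
    and "branch_along \<gamma> R a b B \<Longrightarrow>
      ((\<lambda>t. B t * vector_derivative \<gamma> (at t within {0..1})) has_integral dev z) {0..1}"
proof -
  obtain \<delta> where \<delta>: "path \<delta>" "pathstart \<delta> = 0" "pathfinish \<delta> = z" "path_image \<delta> \<subseteq> \<phi> ` (Sq - corners)"
    "sphere_homotopic_paths (\<phi> ` corners) \<gamma> \<delta>"
  proof (cases "path_image \<gamma> \<subseteq> \<phi> ` (Sq - corners)")
    case True
    then have "sphere_homotopic_paths (\<phi> ` corners) \<gamma> \<gamma>"
      by (intro sphere_homotopic_paths_refl valid_path_imp_path \<gamma>) (auto simp: mem_image_\<phi>)
    then show ?thesis using that[of \<gamma>] \<gamma> True by (simp add: valid_path_imp_path)
  next
    case False
    then show ?thesis using hom that by blast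
  qed
  have \<delta>\<Omega>: "\<delta> t \<in> \<Omega>" if "t \<in> {0..1}" for t
    using \<delta>(4) edge_region_subset_\<Omega> that unfolding path_image_def by blast
  obtain \<tau> where \<tau>: "\<tau> holomorphic_on \<Omega>" "\<And>u. u \<in> \<Omega> \<Longrightarrow> exp (\<tau> u) = R u"
    "\<And>u. u \<in> \<Omega> \<Longrightarrow> deriv dev u = exp (a * \<tau> u)" "\<tau> 0 = - 4 * \<i> * of_real (Arg z1)"
    by (rule deriv_dev_eq_normalized_branch) blast
  have ends: "\<delta> 0 = 0" "\<delta> 1 = z" using \<delta> by (auto simp: pathstart_def pathfinish_def)
  obtain L where L: "continuous_on {0..1} L" "\<And>t. t \<in> {0..1} \<Longrightarrow> exp (L t) = R (\<gamma> t)" "L 0 = \<tau> (\<delta> 0)"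
    "((\<lambda>t. exp (a * L t) * vector_derivative \<gamma> (at t within {0..1})) has_integral (dev (\<delta> 1) - dev (\<delta> 0))) {0..1}"
    by (rule integral_along_homotopic_path[OF \<gamma>(1) \<delta>(1) \<delta>\<Omega> \<delta>(5) \<tau>(1-3)]) blast+
  have dev0: "dev 0 = 0" by (simp add: dev_def g_0)
  have "a * (- 4 * \<i> * of_real (Arg z1)) = of_real (- 2 * Arg z1 * ln K / pi)"
    by (simp add: a_def field_simps)
  then have start: "b = exp (a * L 0)"
    unfolding b L(3) ends \<tau>(4) by (simp only: exp_of_real)
  have "branch_along \<gamma> R a b (\<lambda>t. exp (a * L t))"
    unfolding branch_along_def power_branches_def
    using L(1,2) start by (auto intro!: continuous_intros)
  then show "\<exists>B. branch_along \<gamma> R a b B"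
    by (rule exI[where x = "\<lambda>t. exp (a * L t)"])
  assume B: "branch_along \<gamma> R a b B"
  have B_eq: "B t = exp (a * L t)" if "t \<in> {0..1}" for t
    by (rule power_branch_unique[OF K a_def L(1,2) _ _ _ that])
      (use B start in \<open>auto simp: branch_along_def\<close>)
  have "((\<lambda>t. exp (a * L t) * vector_derivative \<gamma> (at t within {0..1})) has_integral dev z) {0..1}"
    using L(4) unfolding ends dev0 by simp
  then show "((\<lambda>t. B t * vector_derivative \<gamma> (at t within {0..1})) has_integral dev z) {0..1}"
    by (rule has_integral_eq[rotated]) (simp add: B_eq)
qed

end

theorem proposition3:
  fixes K \<theta>\<^sub>1 :: real and \<phi> R :: "complex \<Rightarrow> complex"
    and z\<^sub>1 z\<^sub>2 z\<^sub>3 z\<^sub>4 a b :: complex and U\<^sub>2 :: "complex set"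
  assumes "K > 1"
    and "straightening (Sq_beltrami K) \<phi>"
  defines "z\<^sub>1 \<equiv> \<phi> (Complex 1 1)" and "z\<^sub>2 \<equiv> \<phi> (Complex (-1) 1)"
    and "z\<^sub>3 \<equiv> \<phi> (Complex (-1) (-1))" and "z\<^sub>4 \<equiv> \<phi> (Complex 1 (-1))"
    and "U\<^sub>2 \<equiv> \<phi> ` (Sq - {Complex 1 1, Complex (-1) 1, Complex (-1) (-1), Complex 1 (-1)})"
    and "\<theta>\<^sub>1 \<equiv> (THE \<theta>. \<theta> \<in> {0<..<pi/2} \<and> is_Arg z\<^sub>1 \<theta>)"
    and "R \<equiv> (\<lambda>u. ((u - z\<^sub>2) * (u - z\<^sub>4)) / ((u - z\<^sub>1) * (u - z\<^sub>3)))"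
    and "a \<equiv> of_real (ln K) / (2 * \<i> * of_real pi)"
    and "b \<equiv> of_real (exp (- 2 * \<theta>\<^sub>1 * ln K / pi))"
  shows "\<forall>z\<in>U\<^sub>2.
    (\<exists>\<gamma>. valid_path \<gamma> \<and> pathstart \<gamma> = 0 \<and> pathfinish \<gamma> = z \<and> path_image \<gamma> \<subseteq> U\<^sub>2) \<and>
    (\<forall>\<gamma>. valid_path \<gamma> \<and> pathstart \<gamma> = 0 \<and> pathfinish \<gamma> = z \<and>
        (path_image \<gamma> \<subseteq> U\<^sub>2 \<or>
         (\<exists>\<delta>. path \<delta> \<and> pathstart \<delta> = 0 \<and> pathfinish \<delta> = z \<and> path_image \<delta> \<subseteq> U\<^sub>2 \<and>
              sphere_homotopic_paths {z\<^sub>1, z\<^sub>2, z\<^sub>3, z\<^sub>4} \<gamma> \<delta>)) \<longrightarrow>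
        (\<exists>B. branch_along \<gamma> R a b B) \<and>
        (\<forall>B. branch_along \<gamma> R a b B \<longrightarrow>
           (\<exists>I. ((\<lambda>t. B t * vector_derivative \<gamma> (at t within {0..1})) has_integral I) {0..1} \<and>
                inv \<phi> z = vstretch K I)))"
proof -
  obtain g where hom: "homeomorphism UNIV UNIV \<phi> g"
    using assms(2) by (auto simp: straightening_def quasiconformal_def)
  have "sq_conformal K UNIV \<phi>"
    using straightening_conformal[OF assms(1,2)] hom
    by (simp add: sq_conformal_def homeomorphism_def Compl_eq_Diff_UNIV)
  then interpret S: sq_straightening K \<phi> g
    using assms(1,2) hom by unfold_locales (auto simp: straightening_def)
  have corners: "{Complex 1 1, Complex (-1) 1, Complex (-1) (-1), Complex 1 (-1)} = corners"
    by (simp add: corners_def)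
  have U2: "U\<^sub>2 = \<phi> ` (Sq - corners)" unfolding U\<^sub>2_def corners ..
  have zs: "{z\<^sub>1, z\<^sub>2, z\<^sub>3, z\<^sub>4} = \<phi> ` corners"
    by (simp add: z\<^sub>1_def z\<^sub>2_def z\<^sub>3_def z\<^sub>4_def corners_def)
  have z1: "z\<^sub>1 = S.z1" by (simp add: z\<^sub>1_def S.z1_def)
  have R: "R = S.R"
    unfolding R_def z\<^sub>2_def z\<^sub>3_def z\<^sub>4_def z1 S.\<phi>_corners by (simp add: fun_eq_iff S.R_def)
  have a: "a = S.a" by (simp add: a_def S.a_def)
  have b: "b = of_real (exp (- 2 * Arg S.z1 * ln K / pi))"
    unfolding b_def \<theta>\<^sub>1_def z1 S.Arg_z1 ..
  have inv: "inv \<phi> z = g z" for z by (metis S.\<phi>_g S.inj_\<phi> inv_f_f)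
  show ?thesis
    unfolding U2 zs R a
  proof (intro ballI conjI allI impI)
    fix z assume z: "z \<in> \<phi> ` (Sq - corners)"
    show "\<exists>\<gamma>. valid_path \<gamma> \<and> pathstart \<gamma> = 0 \<and> pathfinish \<gamma> = z \<and> path_image \<gamma> \<subseteq> \<phi> ` (Sq - corners)"
      using S.joining_path_exists[OF z] by metis
    fix \<gamma>
    assume \<gamma>: "valid_path \<gamma> \<and> pathstart \<gamma> = 0 \<and> pathfinish \<gamma> = z \<and>
        (path_image \<gamma> \<subseteq> \<phi> ` (Sq - corners) \<or>
         (\<exists>\<delta>. path \<delta> \<and> pathstart \<delta> = 0 \<and> pathfinish \<delta> = z \<and> path_image \<delta> \<subseteq> \<phi> ` (Sq - corners) \<and>
              sphere_homotopic_paths (\<phi> ` corners) \<gamma> \<delta>))"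
    then have \<gamma>': "valid_path \<gamma>" "pathstart \<gamma> = 0" "pathfinish \<gamma> = z"
        "path_image \<gamma> \<subseteq> \<phi> ` (Sq - corners) \<or>
         (\<exists>\<delta>. path \<delta> \<and> pathstart \<delta> = 0 \<and> pathfinish \<delta> = z \<and> path_image \<delta> \<subseteq> \<phi> ` (Sq - corners) \<and>
              sphere_homotopic_paths (\<phi> ` corners) \<gamma> \<delta>)" by blast+
    show "\<exists>B. branch_along \<gamma> S.R S.a b B"
      by (rule S.inverse_eq_branch_integral(1)[OF z b \<gamma>'])
    fix B assume "branch_along \<gamma> S.R S.a b B"
    from S.inverse_eq_branch_integral(2)[OF z b \<gamma>' this]
    show "\<exists>I. ((\<lambda>t. B t * vector_derivative \<gamma> (at t within {0..1})) has_integral I) {0..1} \<and> inv \<phi> z = vstretch K I"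
      using S.vstretch_dev[of z] z by (auto simp: inv)
  qed
qed

end
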